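(* Up to equivalence with respect to the usual equivalence group $\hat G^\sim_1$ of $\hat{\mathcal L}_1$, the Lie-symmetry extensions in the class $\hat{\mathcal L}_1$ are exhausted by the following cases, where for each case $(A^2,A^1)$ and a basis of the maximal Lie invariance algebra are given: 0. $A^2(t,x)$, $A^1(t,x)$ general: zero algebra; 1. $A^2=\phi(x)$, $A^1=\psi(x)$: $D(1)$; 2. $A^2=\phi(x)$, $A^1=\psi(x)+t$: $D(1)+S^0$; 3. $A^2={\rm e}^{-2t}\phi(x{\rm e}^t)$, $A^1={\rm e}^{-t}\psi(x{\rm e}^t)$: $D(1)-S^1$; 4. $A^2=x|x|^{\frac{\alpha}{1+\alpha}}$, $A^1=c_1|x|^{\frac{\alpha}{1+\alpha}}$: $D(1)$, $D(t)+\alpha S^1$; 5. $A^2=c_2x$, $A^1=\ln|x|$: $D(1)$, $D(t)+S^0$; 6. $A^2={\rm e}^x$, $A^1=c_1{\rm e}^x$: $D(1)$, $D(t)-P(1)-S^1$; 7. $A^2=c_2x\sqrt{|x|}$, $A^1=c_1\sqrt{|x|}+t$: $D(1)+S^0$, $D(t)+S^1$. Here $\phi,\psi$ are arbitrary sufficiently smooth functions of a single argument with $\phi\neq0$ and $\psi''\neq0$; $\alpha,c_1,c_2$ are arbitrary constants with $\alpha\notin\{-1,0\}$, $c_1\neq0$, $c_2\neq0$; in Case 7 one may assume $c_2>0$ modulo $\hat G^\sim_1$. The vector fields are $D(\tau)=\tau\partial_t+\tau_tx\partial_x$, $S^1=x\partial_x+u\partial_u$, $S^0=\partial_u$, $P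(\chi)=\chi\partial_x$.
   Context: All functions are smooth. $\hat{\mathcal L}_1$ is the class of equations $u_t+uu_x=A^2(t,x)u_{xx}+A^1(t,x)u_x$ for $u(t,x)$ with smooth arbitrary elements $A^1,A^2$ satisfying $A^2\neq0$, $A^1_{xx}\neq0$ (superscripts on $A$ are indices). Its usual equivalence group $\hat G^\sim_1$ consists of the transformations $\tilde t=T$, $\tilde x=T_tU^1x+X^0$, $\tilde u=U^1u+U^0$, $\tilde A^1=U^1A^1+U^0-\frac{T_{tt}U^1x+X^0_t}{T_t}$, $\tilde A^2=T_t(U^1)^2A^2$, with $T,X^0$ smooth functions of $t$, $T_t\neq0$, and constants $U^0$, $U^1\neq0$. A list of Lie-symmetry extensions is complete and $\hat G^\sim_1$-inequivalent if every equation of the class with nonzero maximal Lie invariance algebra is mapped by an element of $\hat G^\sim_1$ to an equation of one of the listed cases (with the listed algebra being its maximal Lie invariance algebra for generic parameter values), and the general equation of the class has zero maximal Lie invariance algebra. *)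

theory Defs
  imports "HOL-Analysis.Analysis"
begin

definition smooth1 :: "real set \<Rightarrow> (real \<Rightarrow> real) \<Rightarrow> bool" where
  "smooth1 J f \<longleftrightarrow> (\<forall>n. \<forall>y\<in>J. ((deriv ^^ n) f) differentiable (at y))"

definition pdt :: "(real \<Rightarrow> real \<Rightarrow> real) \<Rightarrow> real \<Rightarrow> real \<Rightarrow> real" where
  "pdt f = (\<lambda>t x. deriv (\<lambda>s. f s x) t)"
definition pdx :: "(real \<Rightarrow> real \<Rightarrow> real) \<Rightarrow> real \<Rightarrow> real \<Rightarrow> real" where
  "pdx f = (\<lambda>t x. deriv (\<lambda>y. f t y) x)"

fun pd2 :: "bool list \<Rightarrow> (real \<Rightarrow> real \<Rightarrow> real) \<Rightarrow> real \<Rightarrow> real \<Rightarrow> real" where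
  "pd2 [] f = f"
| "pd2 (b # bs) f = (if b then pdt else pdx) (pd2 bs f)"

definition smooth2 :: "(real \<times> real) set \<Rightarrow> (real \<Rightarrow> real \<Rightarrow> real) \<Rightarrow> bool" where
  "smooth2 \<Omega> f \<longleftrightarrow> (\<forall>bs. continuous_on \<Omega> (\<lambda>p. pd2 bs f (fst p) (snd p)) \<and>
     (\<forall>t x. (t, x) \<in> \<Omega> \<longrightarrow> (\<lambda>s. pd2 bs f s x) differentiable (at t) \<and>
                              (\<lambda>y. pd2 bs f t y) differentiable (at x)))"

definition p3t :: "(real \<Rightarrow> real \<Rightarrow> real \<Rightarrow> real) \<Rightarrow> real \<Rightarrow> real \<Rightarrow> real \<Rightarrow> real" where
  "p3t f = (\<lambda>t x u. deriv (\<lambda>s. f s x u) t)"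
definition p3x :: "(real \<Rightarrow> real \<Rightarrow> real \<Rightarrow> real) \<Rightarrow> real \<Rightarrow> real \<Rightarrow> real \<Rightarrow> real" where
  "p3x f = (\<lambda>t x u. deriv (\<lambda>y. f t y u) x)"
definition p3u :: "(real \<Rightarrow> real \<Rightarrow> real \<Rightarrow> real) \<Rightarrow> real \<Rightarrow> real \<Rightarrow> real \<Rightarrow> real" where
  "p3u f = (\<lambda>t x u. deriv (\<lambda>v. f t x v) u)"

fun pd3 :: "nat list \<Rightarrow> (real \<Rightarrow> real \<Rightarrow> real \<Rightarrow> real) \<Rightarrow> real \<Rightarrow> real \<Rightarrow> real \<Rightarrow> real" where
  "pd3 [] f = f"
| "pd3 (i # is) f = (if i = 0 then p3t else if i = 1 then p3x else p3u) (pd3 is f)"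

definition smooth3 :: "(real \<times> real \<times> real) set \<Rightarrow> (real \<Rightarrow> real \<Rightarrow> real \<Rightarrow> real) \<Rightarrow> bool" where
  "smooth3 W f \<longleftrightarrow> (\<forall>is. continuous_on W (\<lambda>p. pd3 is f (fst p) (fst (snd p)) (snd (snd p))) \<and>
     (\<forall>t x u. (t, x, u) \<in> W \<longrightarrow> (\<lambda>s. pd3 is f s x u) differentiable (at t) \<and>
                                 (\<lambda>y. pd3 is f t y u) differentiable (at x) \<and>
                                 (\<lambda>v. pd3 is f t x v) differentiable (at u)))"

text \<open>Equation \<open>u_t + u u_x = A2(t,x) u_xx + A1(t,x) u_x\<close> on an open connected
  nonempty domain \<open>\<Omega>\<close> of the (t,x)-plane, with \<open>A2 \<noteq> 0\<close>, \<open>A1_xx \<noteq> 0\<close> on \<open>\<Omega>\<close>.\<close>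
definition in_class :: "(real \<times> real) set \<Rightarrow> (real \<Rightarrow> real \<Rightarrow> real) \<Rightarrow> (real \<Rightarrow> real \<Rightarrow> real) \<Rightarrow> bool" where
  "in_class \<Omega> A2 A1 \<longleftrightarrow> open \<Omega> \<and> connected \<Omega> \<and> \<Omega> \<noteq> {} \<and> smooth2 \<Omega> A2 \<and> smooth2 \<Omega> A1 \<and>
     (\<forall>t x. (t, x) \<in> \<Omega> \<longrightarrow> A2 t x \<noteq> 0 \<and> pdx (pdx A1) t x \<noteq> 0)"

text \<open>Vector field \<open>\<tau> \<partial>_t + \<xi> \<partial>_x + \<eta> \<partial>_u\<close> with coefficients depending on (t,x,u).\<close>
type_synonym vf = "(real \<Rightarrow> real \<Rightarrow> real \<Rightarrow> real) \<times> (real \<Rightarrow> real \<Rightarrow> real \<Rightarrow> real) \<times> (real \<Rightarrow> real \<Rightarrow> real \<Rightarrow> real)"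

definition vtau :: "vf \<Rightarrow> real \<Rightarrow> real \<Rightarrow> real \<Rightarrow> real" where "vtau Q = fst Q"
definition vxi :: "vf \<Rightarrow> real \<Rightarrow> real \<Rightarrow> real \<Rightarrow> real" where "vxi Q = fst (snd Q)"
definition veta :: "vf \<Rightarrow> real \<Rightarrow> real \<Rightarrow> real \<Rightarrow> real" where "veta Q = snd (snd Q)"

text \<open>The second prolongation of Q applied to
  \<open>\<Delta> = u_t + u u_x - A2 u_xx - A1 u_x\<close>, evaluated at the jet point
  (t,x,u,u_t,u_x,u_tx,u_xx) (standard prolongation formulas, Olver Thm 2.36).\<close>
definition prolong_expr :: "(real \<Rightarrow> real \<Rightarrow> real) \<Rightarrow> (real \<Rightarrow> real \<Rightarrow> real) \<Rightarrow> vf \<Rightarrow>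
    real \<Rightarrow> real \<Rightarrow> real \<Rightarrow> real \<Rightarrow> real \<Rightarrow> real \<Rightarrow> real \<Rightarrow> real" where
  "prolong_expr A2 A1 Q t x u ut ux utx uxx =
    (let ta = vtau Q; xi = vxi Q; et = veta Q;
         eta_t = p3t et t x u - p3t xi t x u * ux + (p3u et t x u - p3t ta t x u) * ut
                 - p3u xi t x u * ux * ut - p3u ta t x u * ut ^ 2;
         eta_x = p3x et t x u + (p3u et t x u - p3x xi t x u) * ux - p3x ta t x u * ut
                 - p3u xi t x u * ux ^ 2 - p3u ta t x u * ux * ut;
         eta_xx = p3x (p3x et) t x u + (2 * p3u (p3x et) t x u - p3x (p3x xi) t x u) * ux
                 - p3x (p3x ta) t x u * ut
                 + (p3u (p3u et) t x u - 2 * p3u (p3x xi) t x u) * ux ^ 2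
                 - 2 * p3u (p3x ta) t x u * ux * ut
                 - p3u (p3u xi) t x u * ux ^ 3 - p3u (p3u ta) t x u * ux ^ 2 * ut
                 + (p3u et t x u - 2 * p3x xi t x u) * uxx - 2 * p3x ta t x u * utx
                 - 3 * p3u xi t x u * ux * uxx - p3u ta t x u * ut * uxx
                 - 2 * p3u ta t x u * ux * utx
     in eta_t + et t x u * ux + u * eta_x
        - (ta t x u * pdt A2 t x + xi t x u * pdx A2 t x) * uxx - A2 t x * eta_xx
        - (ta t x u * pdt A1 t x + xi t x u * pdx A1 t x) * ux - A1 t x * eta_x)"

text \<open>Q is a (smooth) Lie symmetry of the equation on \<open>\<Omega> \<times> \<real>\<close>: infinitesimal invariance
  criterion, i.e. the prolongation vanishes on the equation manifold
  \<open>u_t = - u u_x + A2 u_xx + A1 u_x\<close>.\<close>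
definition is_sym :: "(real \<times> real) set \<Rightarrow> (real \<Rightarrow> real \<Rightarrow> real) \<Rightarrow> (real \<Rightarrow> real \<Rightarrow> real) \<Rightarrow> vf \<Rightarrow> bool" where
  "is_sym \<Omega> A2 A1 Q \<longleftrightarrow>
     smooth3 {(t, x, u). (t, x) \<in> \<Omega>} (vtau Q) \<and> smooth3 {(t, x, u). (t, x) \<in> \<Omega>} (vxi Q) \<and>
     smooth3 {(t, x, u). (t, x) \<in> \<Omega>} (veta Q) \<and>
     (\<forall>t x u ux utx uxx. (t, x) \<in> \<Omega> \<longrightarrow>
        prolong_expr A2 A1 Q t x u (- u * ux + A2 t x * uxx + A1 t x * ux) ux utx uxx = 0)"

definition vf_agree :: "(real \<times> real) set \<Rightarrow> vf \<Rightarrow> vf \<Rightarrow> bool" where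
  "vf_agree \<Omega> Q R \<longleftrightarrow> (\<forall>t x u. (t, x) \<in> \<Omega> \<longrightarrow>
     vtau Q t x u = vtau R t x u \<and> vxi Q t x u = vxi R t x u \<and> veta Q t x u = veta R t x u)"

definition vzero :: vf where "vzero = ((\<lambda>t x u. 0), (\<lambda>t x u. 0), (\<lambda>t x u. 0))"
definition vadd :: "vf \<Rightarrow> vf \<Rightarrow> vf" where
  "vadd Q R = ((\<lambda>t x u. vtau Q t x u + vtau R t x u), (\<lambda>t x u. vxi Q t x u + vxi R t x u),
               (\<lambda>t x u. veta Q t x u + veta R t x u))"
definition vscale :: "real \<Rightarrow> vf \<Rightarrow> vf" where
  "vscale c Q = ((\<lambda>t x u. c * vtau Q t x u), (\<lambda>t x u. c * vxi Q t x u), (\<lambda>t x u. c * veta Q t x u))"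

definition alg_zero :: "(real \<times> real) set \<Rightarrow> (real \<Rightarrow> real \<Rightarrow> real) \<Rightarrow> (real \<Rightarrow> real \<Rightarrow> real) \<Rightarrow> bool" where
  "alg_zero \<Omega> A2 A1 \<longleftrightarrow> (\<forall>Q. is_sym \<Omega> A2 A1 Q \<longleftrightarrow> vf_agree \<Omega> Q vzero)"
definition alg_span1 :: "(real \<times> real) set \<Rightarrow> (real \<Rightarrow> real \<Rightarrow> real) \<Rightarrow> (real \<Rightarrow> real \<Rightarrow> real) \<Rightarrow> vf \<Rightarrow> bool" where
  "alg_span1 \<Omega> A2 A1 L \<longleftrightarrow> (\<forall>Q. is_sym \<Omega> A2 A1 Q \<longleftrightarrow> (\<exists>c. vf_agree \<Omega> Q (vscale c L)))"
definition alg_span2 :: "(real \<times> real) set \<Rightarrow> (real \<Rightarrow> real \<Rightarrow> real) \<Rightarrow> (real \<Rightarrow> real \<Rightarrow> real) \<Rightarrow> vf \<Rightarrow> vf \<Rightarrow> bool" where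
  "alg_span2 \<Omega> A2 A1 L M \<longleftrightarrow>
     (\<forall>Q. is_sym \<Omega> A2 A1 Q \<longleftrightarrow> (\<exists>a b. vf_agree \<Omega> Q (vadd (vscale a L) (vscale b M))))"

definition vD :: "(real \<Rightarrow> real) \<Rightarrow> vf" where
  "vD \<tau>' = ((\<lambda>t x u. \<tau>' t), (\<lambda>t x u. deriv \<tau>' t * x), (\<lambda>t x u. 0))"
definition vS1 :: vf where "vS1 = ((\<lambda>t x u. 0), (\<lambda>t x u. x), (\<lambda>t x u. u))"
definition vS0 :: vf where "vS0 = ((\<lambda>t x u. 0), (\<lambda>t x u. 0), (\<lambda>t x u. 1))"
definition vP :: "(real \<Rightarrow> real) \<Rightarrow> vf" where "vP ch = ((\<lambda>t x u. 0), (\<lambda>t x u. ch t), (\<lambda>t x u. 0))"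

definition eq_pt :: "(real \<Rightarrow> real) \<Rightarrow> (real \<Rightarrow> real) \<Rightarrow> real \<Rightarrow> real \<times> real \<Rightarrow> real \<times> real" where
  "eq_pt T X0 U1 p = (T (fst p), deriv T (fst p) * U1 * snd p + X0 (fst p))"

text \<open>The element of \<open>G\<^sup>~\<close> with parameters (T, X0, U0, U1), defined on \<open>\<Omega>\<close>, maps
  the equation with (A2, A1) to the equation with (B2, B1).\<close>
definition equiv_map :: "(real \<times> real) set \<Rightarrow> (real \<Rightarrow> real) \<Rightarrow> (real \<Rightarrow> real) \<Rightarrow> real \<Rightarrow> real \<Rightarrow>
    (real \<Rightarrow> real \<Rightarrow> real) \<Rightarrow> (real \<Rightarrow> real \<Rightarrow> real) \<Rightarrow>
    (real \<Rightarrow> real \<Rightarrow> real) \<Rightarrow> (real \<Rightarrow> real \<Rightarrow> real) \<Rightarrow> bool" where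
  "equiv_map \<Omega> T X0 U0 U1 A2 A1 B2 B1 \<longleftrightarrow>
     U1 \<noteq> 0 \<and> smooth1 (fst ` \<Omega>) T \<and> smooth1 (fst ` \<Omega>) X0 \<and>
     (\<forall>t x. (t, x) \<in> \<Omega> \<longrightarrow>
        deriv T t \<noteq> 0 \<and>
        B2 (T t) (deriv T t * U1 * x + X0 t) = deriv T t * U1 ^ 2 * A2 t x \<and>
        B1 (T t) (deriv T t * U1 * x + X0 t) =
          U1 * A1 t x + U0 - (deriv (deriv T) t * U1 * x + deriv X0 t) / deriv T t)"

definition adm_phipsi :: "real set \<Rightarrow> (real \<Rightarrow> real) \<Rightarrow> (real \<Rightarrow> real) \<Rightarrow> bool" where
  "adm_phipsi J \<phi> \<psi> \<longleftrightarrow> open J \<and> smooth1 J \<phi> \<and> smooth1 J \<psi> \<and>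
     (\<forall>y\<in>J. \<phi> y \<noteq> 0 \<and> deriv (deriv \<psi>) y \<noteq> 0)"

definition c1A2 :: "(real \<Rightarrow> real) \<Rightarrow> real \<Rightarrow> real \<Rightarrow> real" where "c1A2 \<phi> = (\<lambda>t x. \<phi> x)"
definition c1A1 :: "(real \<Rightarrow> real) \<Rightarrow> real \<Rightarrow> real \<Rightarrow> real" where "c1A1 \<psi> = (\<lambda>t x. \<psi> x)"
definition c2A2 :: "(real \<Rightarrow> real) \<Rightarrow> real \<Rightarrow> real \<Rightarrow> real" where "c2A2 \<phi> = (\<lambda>t x. \<phi> x)"
definition c2A1 :: "(real \<Rightarrow> real) \<Rightarrow> real \<Rightarrow> real \<Rightarrow> real" where "c2A1 \<psi> = (\<lambda>t x. \<psi> x + t)"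
definition c3A2 :: "(real \<Rightarrow> real) \<Rightarrow> real \<Rightarrow> real \<Rightarrow> real" where
  "c3A2 \<phi> = (\<lambda>t x. exp (-2 * t) * \<phi> (x * exp t))"
definition c3A1 :: "(real \<Rightarrow> real) \<Rightarrow> real \<Rightarrow> real \<Rightarrow> real" where
  "c3A1 \<psi> = (\<lambda>t x. exp (- t) * \<psi> (x * exp t))"
definition c4A2 :: "real \<Rightarrow> real \<Rightarrow> real \<Rightarrow> real" where
  "c4A2 \<alpha> = (\<lambda>t x. x * \<bar>x\<bar> powr (\<alpha> / (1 + \<alpha>)))"
definition c4A1 :: "real \<Rightarrow> real \<Rightarrow> real \<Rightarrow> real \<Rightarrow> real" where
  "c4A1 \<alpha> c1 = (\<lambda>t x. c1 * \<bar>x\<bar> powr (\<alpha> / (1 + \<alpha>)))"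
definition c5A2 :: "real \<Rightarrow> real \<Rightarrow> real \<Rightarrow> real" where "c5A2 c2 = (\<lambda>t x. c2 * x)"
definition c5A1 :: "real \<Rightarrow> real \<Rightarrow> real" where "c5A1 = (\<lambda>t x. ln \<bar>x\<bar>)"
definition c6A2 :: "real \<Rightarrow> real \<Rightarrow> real" where "c6A2 = (\<lambda>t x. exp x)"
definition c6A1 :: "real \<Rightarrow> real \<Rightarrow> real \<Rightarrow> real" where "c6A1 c1 = (\<lambda>t x. c1 * exp x)"
definition c7A2 :: "real \<Rightarrow> real \<Rightarrow> real \<Rightarrow> real" where "c7A2 c2 = (\<lambda>t x. c2 * x * sqrt \<bar>x\<bar>)"
definition c7A1 :: "real \<Rightarrow> real \<Rightarrow> real \<Rightarrow> real" where "c7A1 c1 = (\<lambda>t x. c1 * sqrt \<bar>x\<bar> + t)"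

definition domJ :: "real set \<Rightarrow> (real \<times> real) set" where "domJ J = {(t, x). x \<in> J}"
definition domJ3 :: "real set \<Rightarrow> (real \<times> real) set" where "domJ3 J = {(t, x). x * exp t \<in> J}"
definition domNZ :: "(real \<times> real) set" where "domNZ = {(t, x). x \<noteq> 0}"

definition listed_case :: "nat \<Rightarrow> (real \<Rightarrow> real \<Rightarrow> real) \<Rightarrow> (real \<Rightarrow> real \<Rightarrow> real) \<Rightarrow> (real \<times> real) set \<Rightarrow> bool" where
  "listed_case k B2 B1 D \<longleftrightarrow>
    (k = 1 \<and> (\<exists>J \<phi> \<psi>. adm_phipsi J \<phi> \<psi> \<and> D \<subseteq> domJ J \<and> B2 = c1A2 \<phi> \<and> B1 = c1A1 \<psi>)) \<or>
    (k = 2 \<and> (\<exists>J \<phi> \<psi>. adm_phipsi J \<phi> \<psi> \<and> D \<subseteq> domJ J \<and> B2 = c2A2 \<phi> \<and> B1 = c2A1 \<psi>)) \<or>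
    (k = 3 \<and> (\<exists>J \<phi> \<psi>. adm_phipsi J \<phi> \<psi> \<and> D \<subseteq> domJ3 J \<and> B2 = c3A2 \<phi> \<and> B1 = c3A1 \<psi>)) \<or>
    (k = 4 \<and> (\<exists>\<alpha> c1. \<alpha> \<noteq> -1 \<and> \<alpha> \<noteq> 0 \<and> c1 \<noteq> 0 \<and> D \<subseteq> domNZ \<and> B2 = c4A2 \<alpha> \<and> B1 = c4A1 \<alpha> c1)) \<or>
    (k = 5 \<and> (\<exists>c2. c2 \<noteq> 0 \<and> D \<subseteq> domNZ \<and> B2 = c5A2 c2 \<and> B1 = c5A1)) \<or>
    (k = 6 \<and> (\<exists>c1. c1 \<noteq> 0 \<and> B2 = c6A2 \<and> B1 = c6A1 c1)) \<or>
    (k = 7 \<and> (\<exists>c1 c2. c1 \<noteq> 0 \<and> c2 > 0 \<and> D \<subseteq> domNZ \<and> B2 = c7A2 c2 \<and> B1 = c7A1 c1))"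

definition locally_equiv_to :: "nat set \<Rightarrow> (real \<times> real) set \<Rightarrow> (real \<Rightarrow> real \<Rightarrow> real) \<Rightarrow> (real \<Rightarrow> real \<Rightarrow> real) \<Rightarrow> bool" where
  "locally_equiv_to K \<Omega> A2 A1 \<longleftrightarrow>
     (\<exists>\<Omega>' T X0 U0 U1 k B2 B1. \<Omega>' \<subseteq> \<Omega> \<and> open \<Omega>' \<and> convex \<Omega>' \<and> \<Omega>' \<noteq> {} \<and> k \<in> K \<and>
        equiv_map \<Omega>' T X0 U0 U1 A2 A1 B2 B1 \<and> listed_case k B2 B1 (eq_pt T X0 U1 ` \<Omega>'))"

definition good_dom :: "(real \<times> real) set \<Rightarrow> bool" where
  "good_dom D \<longleftrightarrow> open D \<and> convex D \<and> D \<noteq> {}"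

end

theory Submission
  imports Defs
begin

text \<open>The invariance criterion, split in the jet variables, forces a symmetry to be
  \<open>\<tau>(t) \<partial>_t + ((\<tau>' + s1) x + \<rho>(t)) \<partial>_x + (s1 u + s0) \<partial>_u\<close> with constants \<open>s1\<close>, \<open>s0\<close>; here
  \<open>A1_xx \<noteq> 0\<close> makes \<open>s1\<close>, \<open>s0\<close> constant and excludes \<open>\<tau> = 0\<close>.  Rectifying one symmetry with
  \<open>T' = 1 / \<tau>\<close> brings the equation to Case 1, 2 or 3, uniformly written as
  \<open>A2 = exp (2 \<sigma> t) \<phi>(y)\<close>, \<open>A1 = exp (\<sigma> t) \<psi>(y) + \<sigma>0 t\<close>, \<open>y = x exp (- \<sigma> t)\<close>, with
  \<open>(\<sigma>, \<sigma>0) = (0, 0), (0, 1), (-1, 0)\<close>.  At a fixed time a further symmetry yields the first-order ODEs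
  \<open>(p y + q) \<psi>' = (p - a) \<psi> + l - e y\<close> and \<open>(p y + q) \<phi>' = (2 p - a) \<phi>\<close>, whose space of admissible
  coefficient vectors is at most one-dimensional, because a vector with \<open>p y + q\<close> vanishing somewhere is
  zero.  Hence the coefficients are proportional for all times, \<open>(a, p, q, e, l) = \<tau>' (1, k, n, m, L)\<close>,
  the algebra is at most two-dimensional, and solving the ODEs for \<open>k = 0\<close>, \<open>k = 1\<close> and the remaining
  \<open>k\<close> gives Case 6, Case 5 and Cases 4 and 7, after the time change \<open>T' = \<kappa> exp (- m t)\<close>.\<close>

section \<open>Smooth functions of one variable\<close>

text \<open>Proportionality makes the entries \<open>p\<close>, \<open>q\<close>, \<open>e\<close>,
  \<open>l\<close> of a second symmetry multiples of \<tau>'. Differentiating these identities in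
  \<open>t\<close> leaves two relations, \<open>k * m = m - \<sigma>\<close> and \<open>(m +
  \<sigma>) * (L + n * (m + \<sigma>)) = \<sigma>0 * (k - 2)\<close>, and these decide the final
  case. For \<open>k\<close> other than 0 and 1 the solutions are powers of
  \<open>|y + n / k|\<close> with exponent \<open>1 - 1 / k\<close>, and after the time change
  \<open>A1\<close> carries a leftover \<open>U1 * (exp (\<sigma> t) h + \<sigma>0 t) + U0\<close>.
  If it is constant, \<open>U0\<close> removes it and Case 4 with \<open>\<alpha> = k - 1\<close>
  remains. Otherwise the relations force \<open>k = 2\<close>, hence exponent 1/2, and the leftover
  can be made equal to \<open>T\<close> itself: this is the origin of the square root and of the
  summand \<open>t\<close> in Case 7.

  The classification is local. A symmetry can be rectified only where \<tau> does not vanish, and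
  integrating vanishing partial derivatives needs convexity, while a domain of the class is only
  open and connected. Both are obtained by passing to boxes.\<close>

lemma deriv_cong_open:
  assumes "open J" "\<And>y. y \<in> J \<Longrightarrow> f y = (g y :: real)" "x \<in> J"
  shows "deriv f x = deriv g x"
  by (rule deriv_cong_ev) (use assms eventually_nhds_in_open[of J x] in \<open>auto elim: eventually_mono\<close>)

lemma funpow_deriv_cong_open:
  assumes "open J" "\<And>y. y \<in> J \<Longrightarrow> f y = (g y :: real)" "x \<in> J"
  shows "(deriv ^^ n) f x = (deriv ^^ n) g x"
  using assms(3)
proof (induction n arbitrary: x)
  case (Suc n)
  then show ?case using deriv_cong_open[OF assms(1), of "(deriv ^^ n) f" "(deriv ^^ n) g" x] by simp
qed (use assms in simp)

lemma differentiable_cong_open: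
  fixes f g :: "real \<Rightarrow> real"
  assumes "open J" "\<And>y. y \<in> J \<Longrightarrow> f y = g y" "x \<in> J" "f differentiable (at x)"
  shows "g differentiable (at x)"
proof -
  obtain D where "(f has_real_derivative D) (at x)"
    using assms(4) real_differentiable_def by blast
  then have "(g has_real_derivative D) (at x)"
    by (rule has_field_derivative_transform_within_open[OF _ assms(1,3)]) (rule assms(2))
  then show ?thesis using real_differentiable_def by blast
qed

lemma smooth1_cong:
  assumes "open J" "\<And>y. y \<in> J \<Longrightarrow> f y = g y" "smooth1 J f"
  shows "smooth1 J g"
  unfolding smooth1_def
proof (intro allI ballI)
  fix n y assume "y \<in> J"
  then show "(deriv ^^ n) g differentiable at y"
    using assms funpow_deriv_cong_open[OF assms(1,2)]
    by (intro differentiable_cong_open[of J "(deriv ^^ n) f" "(deriv ^^ n) g" y])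
      (auto simp: smooth1_def)
qed

lemma smooth1_subset: "smooth1 J f \<Longrightarrow> K \<subseteq> J \<Longrightarrow> smooth1 K f"
  by (auto simp: smooth1_def)

lemma smooth1_differentiable: "smooth1 J f \<Longrightarrow> y \<in> J \<Longrightarrow> f differentiable (at y)"
  unfolding smooth1_def by (metis funpow_0)

lemma smooth1_deriv: "smooth1 J f \<Longrightarrow> smooth1 J (deriv f)"
  unfolding smooth1_def by (metis comp_apply funpow_Suc_right)

lemma smooth1_DERIV: "smooth1 J f \<Longrightarrow> y \<in> J \<Longrightarrow> (f has_real_derivative deriv f y) (at y)"
  using smooth1_differentiable DERIV_deriv_iff_real_differentiable by blast

lemma smooth1_continuous_on: "smooth1 J f \<Longrightarrow> continuous_on J f"
  by (meson continuous_at_imp_continuous_on DERIV_isCont smooth1_DERIV)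

text \<open>Lifts smoothness from a derivative to the function; this is how antiderivatives, such as
  the new time \<open>T\<close>, become smooth.\<close>

lemma smooth1_stepI:
  assumes "open J" "\<And>y. y \<in> J \<Longrightarrow> (f has_real_derivative f' y) (at y)" "smooth1 J f'"
  shows "smooth1 J f"
proof -
  have d: "smooth1 J (deriv f)"
    by (rule smooth1_cong[OF assms(1) _ assms(3)]) (metis DERIV_imp_deriv assms(2))
  show ?thesis unfolding smooth1_def
  proof (intro allI ballI)
    fix n y assume y: "y \<in> J"
    show "(deriv ^^ n) f differentiable at y"
    proof (cases n)
      case 0
      then show ?thesis using assms(2)[OF y] real_differentiable_def by auto
    next
      case (Suc k)
      then show ?thesis using d y
        by (metis smooth1_def comp_apply funpow_Suc_right)
    qed
  qed
qed

text \<open>A finite order of differentiability serves as the induction parameter for the closure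
  properties: the product and chain rules express a derivative through functions that are known to
  one order less. \<open>smooth1\<close> offers no such parameter.\<close>

definition diff_upto :: "nat \<Rightarrow> real set \<Rightarrow> (real \<Rightarrow> real) \<Rightarrow> bool" where
  "diff_upto n J f \<longleftrightarrow> (\<forall>k\<le>n. \<forall>y\<in>J. (deriv ^^ k) f differentiable (at y))"

lemma smooth1_iff_diff_upto: "smooth1 J f \<longleftrightarrow> (\<forall>n. diff_upto n J f)"
  by (auto simp: smooth1_def diff_upto_def)

lemma diff_upto_mono: "diff_upto n J f \<Longrightarrow> m \<le> n \<Longrightarrow> diff_upto m J f"
  by (auto simp: diff_upto_def)

lemma diff_upto_Suc:
  "diff_upto (Suc n) J f \<longleftrightarrow> (\<forall>y\<in>J. f differentiable (at y)) \<and> diff_upto n J (deriv f)"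
proof -
  have "(\<forall>k\<le>Suc n. P k) \<longleftrightarrow> P 0 \<and> (\<forall>k\<le>n. P (Suc k))" for P :: "nat \<Rightarrow> bool"
    by (metis Suc_le_mono le0 not0_implies_Suc)
  note this[of "\<lambda>k. \<forall>y\<in>J. (deriv ^^ k) f differentiable (at y)"]
  then show ?thesis
    unfolding diff_upto_def funpow_Suc_right by simp
qed

lemma diff_upto_SucI:
  assumes "open J" "\<And>y. y \<in> J \<Longrightarrow> (f has_real_derivative f' y) (at y)" "diff_upto n J f'"
  shows "diff_upto (Suc n) J f"
  unfolding diff_upto_Suc
proof (intro conjI ballI)
  fix y assume "y \<in> J" then show "f differentiable (at y)"
    using assms(2) real_differentiable_def by blast
next
  have eq: "f' y = deriv f y" if "y \<in> J" for y using assms(2)[OF that] by (metis DERIV_imp_deriv)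
  show "diff_upto n J (deriv f)"
    unfolding diff_upto_def
  proof (intro allI impI ballI)
    fix k y assume "k \<le> n" "y \<in> J"
    then show "(deriv ^^ k) (deriv f) differentiable at y"
      using assms funpow_deriv_cong_open[OF assms(1) eq]
      by (intro differentiable_cong_open[of J "(deriv ^^ k) f'" "(deriv ^^ k) (deriv f)" y])
        (auto simp: diff_upto_def)
  qed
qed

lemma diff_upto_differentiable: "diff_upto n J f \<Longrightarrow> y \<in> J \<Longrightarrow> (f has_real_derivative deriv f y) (at y)"
  unfolding diff_upto_def using DERIV_deriv_iff_real_differentiable by (metis funpow_0 le0)

lemma diff_upto_0I: "(\<And>y. y \<in> J \<Longrightarrow> (f has_real_derivative f' y) (at y)) \<Longrightarrow> diff_upto 0 J f"
  unfolding diff_upto_def using real_differentiable_def by auto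

lemma diff_upto_add:
  assumes "open J" "diff_upto n J f" "diff_upto n J g"
  shows "diff_upto n J (\<lambda>y. f y + g y)"
  using assms(2,3)
proof (induction n arbitrary: f g)
  case 0
  then show ?case
    by (intro diff_upto_0I) (rule DERIV_add; erule diff_upto_differentiable[rotated]; simp)
next
  case (Suc n)
  have "diff_upto n J (\<lambda>y. deriv f y + deriv g y)"
    using Suc by (simp add: diff_upto_Suc)
  then show ?case
    by (intro diff_upto_SucI[OF assms(1) DERIV_add[OF diff_upto_differentiable[OF Suc.prems(1)]
        diff_upto_differentiable[OF Suc.prems(2)]]])
qed

lemma diff_upto_mult:
  assumes "open J" "diff_upto n J f" "diff_upto n J g"
  shows "diff_upto n J (\<lambda>y. f y * g y)"
  using assms(2,3)
proof (induction n arbitrary: f g)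
  case 0
  then show ?case
    by (intro diff_upto_0I) (rule DERIV_mult; erule diff_upto_differentiable[rotated]; simp)
next
  case (Suc n)
  have "diff_upto n J f" "diff_upto n J g" "diff_upto n J (deriv f)" "diff_upto n J (deriv g)"
    using Suc.prems diff_upto_mono[of "Suc n" J _ n] by (simp_all add: diff_upto_Suc)
  then have "diff_upto n J (\<lambda>y. deriv f y * g y + deriv g y * f y)"
    by (intro diff_upto_add[OF assms(1)] Suc.IH)
  then show ?case
    by (intro diff_upto_SucI[OF assms(1) DERIV_mult[OF diff_upto_differentiable[OF Suc.prems(1)]
        diff_upto_differentiable[OF Suc.prems(2)]]])
qed

lemma diff_upto_compose:
  assumes "open J" "diff_upto n K f" "diff_upto n J g" "g ` J \<subseteq> K"
  shows "diff_upto n J (\<lambda>y. f (g y))"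
  using assms(2,3)
proof (induction n arbitrary: f)
  case 0
  have "((\<lambda>y. f (g y)) has_real_derivative deriv f (g y) * deriv g y) (at y)" if "y \<in> J" for y
    using 0 that assms(4) by (intro DERIV_chain2) (auto intro!: diff_upto_differentiable)
  then show ?case by (rule diff_upto_0I)
next
  case (Suc n)
  have d: "((\<lambda>y. f (g y)) has_real_derivative deriv f (g y) * deriv g y) (at y)" if "y \<in> J" for y
    using Suc.prems that assms(4) by (intro DERIV_chain2) (auto intro!: diff_upto_differentiable)
  have "diff_upto n J g" "diff_upto n K (deriv f)" "diff_upto n J (deriv g)"
    using Suc.prems diff_upto_mono[of "Suc n" J _ n] by (simp_all add: diff_upto_Suc)
  then have "diff_upto n J (\<lambda>y. deriv f (g y) * deriv g y)"
    using diff_upto_mult[OF assms(1) Suc.IH] by blast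
  with d show ?case
    by (intro diff_upto_SucI[OF assms(1)])
qed

section \<open>Closure properties of smooth functions and antiderivatives\<close>

lemma smooth1_const [simp]: "smooth1 J (\<lambda>y. c)"
proof -
  have "(deriv ^^ n) (\<lambda>y. c) = (\<lambda>y. if n = 0 then c else 0)" for n
    by (induction n) auto
  then show ?thesis by (auto simp: smooth1_def)
qed

lemma smooth1_ident [simp]: "smooth1 J (\<lambda>y. y)"
  by (rule smooth1_subset[OF smooth1_stepI[of UNIV "\<lambda>y. y" "\<lambda>y. 1"]]) auto

lemma smooth1_add:
  "open J \<Longrightarrow> smooth1 J f \<Longrightarrow> smooth1 J g \<Longrightarrow> smooth1 J (\<lambda>y. f y + g y)"
  by (simp add: smooth1_iff_diff_upto diff_upto_add)

lemma smooth1_mult: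
  "open J \<Longrightarrow> smooth1 J f \<Longrightarrow> smooth1 J g \<Longrightarrow> smooth1 J (\<lambda>y. f y * g y)"
  by (simp add: smooth1_iff_diff_upto diff_upto_mult)

lemma smooth1_compose:
  "open J \<Longrightarrow> smooth1 K f \<Longrightarrow> smooth1 J g \<Longrightarrow> g ` J \<subseteq> K \<Longrightarrow> smooth1 J (\<lambda>y. f (g y))"
  unfolding smooth1_iff_diff_upto using diff_upto_compose by blast

lemma smooth1_minus: "open J \<Longrightarrow> smooth1 J f \<Longrightarrow> smooth1 J (\<lambda>y. - f y)"
  using smooth1_mult[of J "\<lambda>y. -1" f] by simp

lemma smooth1_diff:
  "open J \<Longrightarrow> smooth1 J f \<Longrightarrow> smooth1 J g \<Longrightarrow> smooth1 J (\<lambda>y. f y - g y)"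
  using smooth1_add[of J f "\<lambda>y. - g y"] smooth1_minus[of J g] by simp

lemma smooth1_exp [simp]: "smooth1 J exp"
proof -
  have "deriv exp = (exp :: real \<Rightarrow> real)" by (rule ext) (metis DERIV_exp DERIV_imp_deriv)
  then have "(deriv ^^ n) exp = (exp :: real \<Rightarrow> real)" for n by (induction n) auto
  then show ?thesis by (simp add: smooth1_def real_differentiable_def) (metis DERIV_exp)
qed

lemma smooth1_exp_comp: "open J \<Longrightarrow> smooth1 J f \<Longrightarrow> smooth1 J (\<lambda>y. exp (f y))"
  by (rule smooth1_compose[where K = UNIV]) auto

text \<open>The derivative of \<open>inverse f\<close> contains \<open>inverse f\<close> again, so
  order \<open>n + 1\<close> follows from order \<open>n\<close> of the same function.\<close>

lemma smooth1_inverse: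
  assumes J: "open J" and f: "smooth1 J f" and nz: "\<And>y. y \<in> J \<Longrightarrow> f y \<noteq> 0"
  shows "smooth1 J (\<lambda>y. inverse (f y))"
proof -
  have "diff_upto n J (\<lambda>y. inverse (f y))" for n
  proof (induction n)
    case 0
    show ?case
      by (rule diff_upto_0I[OF DERIV_inverse'[OF smooth1_DERIV[OF f] nz]])
  next
    case (Suc n)
    have f': "diff_upto n J (\<lambda>y. - 1)" "diff_upto n J (deriv f)"
      using smooth1_deriv[OF f] smooth1_const[of J "-1"] unfolding smooth1_iff_diff_upto by blast+
    have "diff_upto n J (\<lambda>y. (-1) * ((inverse (f y) * deriv f y) * inverse (f y)))"
      by (intro diff_upto_mult J Suc f')
    then have "diff_upto n J (\<lambda>y. - (inverse (f y) * deriv f y * inverse (f y)))" by simp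
    then show ?case
      by (intro diff_upto_SucI[OF J DERIV_inverse'[OF smooth1_DERIV[OF f] nz]])
  qed
  then show ?thesis by (simp add: smooth1_iff_diff_upto)
qed

lemma smooth1_divide:
  assumes "open J" "smooth1 J f" "smooth1 J g" "\<And>y. y \<in> J \<Longrightarrow> g y \<noteq> 0"
  shows "smooth1 J (\<lambda>y. f y / g y)"
  unfolding divide_inverse using assms by (intro smooth1_mult smooth1_inverse)

lemmas smooth1_intros = smooth1_const smooth1_ident smooth1_add smooth1_mult smooth1_minus
  smooth1_diff smooth1_exp_comp smooth1_deriv

text \<open>Needed for \<tau> and \<rho>: they are recovered from a field along segments of fixed
  \<open>x\<close>, and different times may require different \<open>x\<close>.\<close>

lemma smooth1_local:
  assumes "\<And>y. y \<in> J \<Longrightarrow> \<exists>K g. open K \<and> y \<in> K \<and> smooth1 K g \<and> (\<forall>z\<in>K. g z = f z)"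
  shows "smooth1 J f"
  unfolding smooth1_def
proof (intro allI ballI)
  fix n y assume "y \<in> J"
  then obtain K g where K: "open K" "y \<in> K" "smooth1 K g" "\<forall>z\<in>K. g z = f z" using assms by blast
  then have "smooth1 K f" using smooth1_cong[of K g f] by blast
  then show "(deriv ^^ n) f differentiable at y" using K by (auto simp: smooth1_def)
qed

lemma smooth1_antiderivative:
  fixes f :: "real \<Rightarrow> real"
  assumes "r > 0" and f: "smooth1 {t0 - r<..<t0 + r} f"
  shows "\<exists>F. smooth1 {t0 - r<..<t0 + r} F \<and> F t0 = 0 \<and>
    (\<forall>t\<in>{t0 - r<..<t0 + r}. (F has_real_derivative f t) (at t))"
proof -
  let ?I = "{t0 - r<..<t0 + r}"
  have "convex ?I" by simp
  have "continuous_on ?I f" using f by (rule smooth1_continuous_on)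
  define G where "G t = (LBINT s=t0..t. f s)" for t :: real
  have G: "(G has_real_derivative f t) (at t)" if "t \<in> ?I" for t
  proof -
    have "((\<lambda>u. LBINT y=t0..u. f y) has_vector_derivative (f t)) (at t)"
    proof -
      \<comment> \<open>Shrinking the interval by half the distance from \<open>t\<close> to its
        boundary leaves a compact interval with \<open>t\<close> and \<open>t0\<close> inside, as
        the fundamental theorem requires.\<close>
      obtain e where e: "e > 0" "t \<in> {t0 - r + e<..<t0 + r - e}" "t0 \<in> {t0 - r + e<..<t0 + r - e}"
      proof -
        define e where "e = (r - \<bar>t - t0\<bar>) / 2"
        show ?thesis by (rule that[of e]) (use \<open>t \<in> ?I\<close> assms(1) in \<open>auto simp: e_def abs_if field_simps\<close>)
      qed
      have "((\<lambda>u. LBINT y=t0..u. f y) has_vector_derivative (f t)) (at t within {t0 - r + e..t0 + r - e})"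
        by (rule interval_integral_FTC2)
          (use e in \<open>auto intro!: continuous_on_subset[OF \<open>continuous_on ?I f\<close>]\<close>)
      then have "((\<lambda>u. LBINT y=t0..u. f y) has_vector_derivative (f t)) (at t within {t0 - r + e<..<t0 + r - e})"
        by (rule has_vector_derivative_within_subset) auto
      then show ?thesis 
        unfolding at_within_open[OF e(2) open_greaterThanLessThan] .
    qed
    then show ?thesis by (simp add: has_real_derivative_iff_has_vector_derivative G_def[abs_def])
  qed
  have "smooth1 ?I G" by (rule smooth1_stepI[OF open_greaterThanLessThan _ f]) (rule G)
  moreover have "G t0 = 0" by (simp add: G_def)
  ultimately show ?thesis using G by blast
qed

section \<open>Partial derivatives on plane domains\<close>

lemma open_prod_box:
  fixes D :: "(real \<times> real) set"
  assumes "open D" "(t0, x0) \<in> D"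
  obtains r where "r > 0" "{t0 - r<..<t0 + r} \<times> {x0 - r<..<x0 + r} \<subseteq> D"
proof -
  obtain A B where AB: "open A" "open B" "t0 \<in> A" "x0 \<in> B" "A \<times> B \<subseteq> D"
    using assms unfolding open_prod_def by fastforce
  obtain r1 where r1: "r1 > 0" "\<And>y. \<bar>y - t0\<bar> < r1 \<Longrightarrow> y \<in> A" 
    using AB open_real by blast
  obtain r2 where r2: "r2 > 0" "\<And>y. \<bar>y - x0\<bar> < r2 \<Longrightarrow> y \<in> B"
    using AB open_real by blast
  have "{t0 - min r1 r2<..<t0 + min r1 r2} \<times> {x0 - min r1 r2<..<x0 + min r1 r2} \<subseteq> A \<times> B"
    by (rule Sigma_mono) (rule subsetI, rule r1(2), auto simp: abs_less_iff,
        rule r2(2), auto simp: abs_less_iff)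
  with AB r1(1) r2(1) show ?thesis by (intro that[of "min r1 r2"]) auto
qed

lemma open_slices:
  fixes D :: "(real \<times> real) set"
  assumes "open D" shows "open {t. (t, x) \<in> D}" "open {x. (t, x) \<in> D}"
proof -
  have "continuous_on UNIV (\<lambda>t. (t, x))" "continuous_on UNIV (\<lambda>x. (t, x))"
    by (intro continuous_intros)+
  then show "open {t. (t, x) \<in> D}" "open {x. (t, x) \<in> D}"
    using open_vimage[OF assms] by (force simp: vimage_def)+
qed

lemma eventually_in_slice:
  fixes D :: "(real \<times> real) set"
  assumes "open D" "(t, x) \<in> D"
  shows "eventually (\<lambda>s. (s, x) \<in> D) (nhds t)" "eventually (\<lambda>y. (t, y) \<in> D) (nhds x)"
  using eventually_nhds_in_open[OF open_slices(1)[OF assms(1), of x], of t]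
    eventually_nhds_in_open[OF open_slices(2)[OF assms(1), of t], of x] assms(2) by simp_all

lemma convex_slice:
  fixes D :: "(real \<times> real) set"
  assumes "convex D" shows "convex {x. (t, x) \<in> D}"
proof -
  have "(\<lambda>x. (t, x)) -` D = {x. (t, x) \<in> D}" by auto
  moreover have "{x. (t, x) \<in> D} = snd ` (D \<inter> ({t} \<times> UNIV))" by force
  moreover have "convex (D \<inter> ({t} \<times> UNIV))"
    by (intro convex_Int assms convex_Times) auto
  ultimately show ?thesis using convex_linear_image linear_snd by metis
qed

lemma convex_fst_image:
  fixes D :: "(real \<times> real) set"
  assumes "convex D" shows "convex (fst ` D)"
  using assms convex_linear_image linear_fst by blast

lemma open_fst_image:
  fixes D :: "(real \<times> real) set"
  assumes "open D" shows "open (fst ` D)"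
proof -
  have "fst ` D = (\<Union>x. {t. (t, x) \<in> D})" by force
  then show ?thesis using open_slices(1)[OF assms] by auto
qed

text \<open>Convexity enters only through the slices of fixed \<open>t\<close>: they are intervals,
  so a vanishing x-derivative leaves a function of \<open>t\<close> alone.\<close>

lemma constant_on_slices:
  fixes D :: "(real \<times> real) set"
  assumes "convex D"
    and "\<And>t x. (t, x) \<in> D \<Longrightarrow> ((\<lambda>y. f t y) has_real_derivative 0) (at x)"
  shows "\<exists>h. \<forall>t x. (t, x) \<in> D \<longrightarrow> f t x = h t"
proof -
  have "\<exists>c. \<forall>x. (t, x) \<in> D \<longrightarrow> f t x = c" for t
    using has_field_derivative_zero_constant[OF convex_slice[OF assms(1)], of t "f t"] assms(2)
    by (metis (no_types, lifting) has_field_derivative_at_within mem_Collect_eq)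
  then show ?thesis by metis
qed

section \<open>Iterated partial derivatives and restriction to slices\<close>

lemma pd3_append: "pd3 is (pd3 js f) = pd3 (is @ js) f"
  by (induction "is") auto

lemma pd2_append: "pd2 is (pd2 js f) = pd2 (is @ js) f"
  by (induction "is") auto

lemma smooth3_p3x: "smooth3 W f \<Longrightarrow> smooth3 W (p3x f)"
  and smooth3_p3u: "smooth3 W f \<Longrightarrow> smooth3 W (p3u f)"
  using pd3_append[of _ "[1]" f] pd3_append[of _ "[2]" f]
  by (simp_all add: smooth3_def)

lemma smooth2_pdx: "smooth2 W f \<Longrightarrow> smooth2 W (pdx f)"
  using pd2_append[of _ "[False]" f] by (simp add: smooth2_def)

lemma smooth3_DERIV:
  assumes "smooth3 W f" "(t, x, u) \<in> W"
  shows "((\<lambda>s. f s x u) has_real_derivative p3t f t x u) (at t)"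
    "((\<lambda>y. f t y u) has_real_derivative p3x f t x u) (at x)"
    "((\<lambda>v. f t x v) has_real_derivative p3u f t x u) (at u)"
  using assms spec[of _ "[]"] unfolding smooth3_def p3t_def p3x_def p3u_def
  by (metis pd3.simps(1) DERIV_deriv_iff_real_differentiable)+

lemma smooth2_DERIV:
  assumes "smooth2 W f" "(t, x) \<in> W"
  shows "((\<lambda>s. f s x) has_real_derivative pdt f t x) (at t)"
    "((\<lambda>y. f t y) has_real_derivative pdx f t x) (at x)"
  using assms spec[of _ "[]"] unfolding smooth2_def pdt_def pdx_def
  by (metis pd2.simps(1) DERIV_deriv_iff_real_differentiable)+

lemma smooth2_continuous_on: "smooth2 W f \<Longrightarrow> continuous_on W (\<lambda>p. f (fst p) (snd p))"
  unfolding smooth2_def by (metis pd2.simps(1))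

lemma smooth3_subset: "smooth3 W f \<Longrightarrow> V \<subseteq> W \<Longrightarrow> smooth3 V f"
  unfolding smooth3_def by (meson continuous_on_subset subset_iff)

lemma smooth2_subset: "smooth2 W f \<Longrightarrow> V \<subseteq> W \<Longrightarrow> smooth2 V f"
  unfolding smooth2_def by (meson continuous_on_subset subset_iff)

lemma smooth2_slice_x:
  assumes "smooth2 W f" shows "smooth1 {x. (t, x) \<in> W} (f t)"
proof -
  have "(deriv ^^ n) (f t) = pd2 (replicate n False) f t" for n
    by (induction n) (auto simp: pdx_def)
  then show ?thesis using assms by (auto simp: smooth1_def smooth2_def)
qed

lemma smooth3_slice_t:
  assumes "smooth3 W f" shows "smooth1 {t. (t, x, u) \<in> W} (\<lambda>t. f t x u)"
proof -
  have "(deriv ^^ n) (\<lambda>t. f t x u) = (\<lambda>t. pd3 (replicate n 0) f t x u)" for n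
    by (induction n) (auto simp: p3t_def)
  then show ?thesis using assms by (auto simp: smooth1_def smooth3_def)
qed

lemma is_sym_subset:
  assumes "is_sym \<Omega> A2 A1 Q" "D \<subseteq> \<Omega>" shows "is_sym D A2 A1 Q"
proof -
  have "{(t, x, u). (t, x) \<in> D} \<subseteq> {(t, x, u :: real). (t, x) \<in> \<Omega>}" using assms(2) by auto
  then show ?thesis using assms smooth3_subset unfolding is_sym_def by blast
qed

section \<open>Determining equations\<close>

lemma open_cylinder:
  fixes D :: "(real \<times> real) set"
  assumes "open D" shows "open {(t, x, u :: real). (t, x) \<in> D}"
proof -
  have "{(t, x, u :: real). (t, x) \<in> D} = (\<lambda>p. (fst p, fst (snd p))) -` D" by auto
  moreover have "continuous_on UNIV (\<lambda>p :: real \<times> real \<times> real. (fst p, fst (snd p)))"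
    by (intro continuous_intros)
  ultimately show ?thesis using open_vimage[OF assms] by metis
qed

lemma deriv_zero_eventually:
  "eventually (\<lambda>y. f y = 0) (nhds x) \<Longrightarrow> deriv f x = (0 :: real)"
  using deriv_cong_ev[of f "\<lambda>y. 0" x x] by simp

text \<open>After \<open>u_t\<close> is replaced, the criterion is a polynomial in
  \<open>u_x\<close>, \<open>u_tx\<close>, \<open>u_xx\<close> over a fixed point
  \<open>(t, x, u)\<close>, and its coefficients are read off as finite differences of values at 0,
  1 and -1. The order matters: \<tau>_x and \<tau>_u must vanish on all of \<open>D\<close> first,
  so that their own derivatives drop out of the later coefficients.\<close>

lemma determining_equations_pointwise:
  assumes D: "open D" and sym: "is_sym D A2 A1 Q"
    and A2: "\<And>t x. (t, x) \<in> D \<Longrightarrow> A2 t x \<noteq> 0"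
    and tx: "(t, x) \<in> D"
  shows "p3x (vtau Q) t x u = 0" "p3u (vtau Q) t x u = 0" "p3u (vxi Q) t x u = 0"
    "p3u (p3u (veta Q)) t x u = 0"
    "vtau Q t x u * pdt A2 t x + vxi Q t x u * pdx A2 t x
       = A2 t x * (2 * p3x (vxi Q) t x u - p3t (vtau Q) t x u)"
    "- p3t (vxi Q) t x u + (p3x (vxi Q) t x u - p3t (vtau Q) t x u) * A1 t x
       + (p3t (vtau Q) t x u - p3x (vxi Q) t x u) * u + veta Q t x u
       - A2 t x * (2 * p3u (p3x (veta Q)) t x u - p3x (p3x (vxi Q)) t x u)
       - vtau Q t x u * pdt A1 t x - vxi Q t x u * pdx A1 t x = 0"
    "p3t (veta Q) t x u + (u - A1 t x) * p3x (veta Q) t x u - A2 t x * p3x (p3x (veta Q)) t x u = 0"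
proof -
  define P where "P t x u ux utx uxx
    = prolong_expr A2 A1 Q t x u (- u * ux + A2 t x * uxx + A1 t x * ux) ux utx uxx"
    for t x u ux utx uxx
  have P0: "P t x u ux utx uxx = 0" if "(t, x) \<in> D" for t x u ux utx uxx
    using sym that by (simp add: is_sym_def P_def)
  have tau_x: "p3x (vtau Q) t x u = 0" if "(t, x) \<in> D" for t x u
  proof -
    have "P t x u 0 1 0 - P t x u 0 0 0 = 2 * A2 t x * p3x (vtau Q) t x u"
      by (simp add: P_def prolong_expr_def Let_def algebra_simps)
    then show ?thesis using P0 A2 that by simp
  qed
  have tau_u: "p3u (vtau Q) t x u = 0" if "(t, x) \<in> D" for t x u
  proof -
    have "P t x u 1 1 0 - P t x u 1 0 0 = 2 * A2 t x * (p3x (vtau Q) t x u + p3u (vtau Q) t x u)"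
      by (simp add: P_def prolong_expr_def Let_def algebra_simps)
    then show ?thesis using P0 A2 that tau_x by simp
  qed
  have tau2: "p3x (p3x (vtau Q)) t x u = 0" "p3u (p3x (vtau Q)) t x u = 0"
      "p3u (p3u (vtau Q)) t x u = 0" if "(t, x) \<in> D" for t x u
  proof -
    show "p3x (p3x (vtau Q)) t x u = 0"
      unfolding p3x_def[of "p3x (vtau Q)"]
      using eventually_in_slice(2)[OF D that]
      by (intro deriv_zero_eventually) (auto elim!: eventually_mono intro: tau_x)
    have "p3x (vtau Q) t x = (\<lambda>v. 0)" "p3u (vtau Q) t x = (\<lambda>v. 0)"
      using tau_x[OF that] tau_u[OF that] by auto
    then show "p3u (p3x (vtau Q)) t x u = 0" "p3u (p3u (vtau Q)) t x u = 0"
      unfolding p3u_def[of "p3u (vtau Q)"] p3u_def[of "p3x (vtau Q)"] by simp_all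
  qed
  have xi_u: "p3u (vxi Q) t x u = 0" if "(t, x) \<in> D" for t x u
  proof -
    \<comment> \<open>The mixed second difference isolates the coefficient of
      \<open>u_x * u_xx\<close>: it receives \<open>3 * A2 * \<xi>_u\<close> from
      \<open>eta_xx\<close> and \<open>- A2 * \<xi>_u\<close> from \<open>eta_t\<close>, where
      \<open>u_t\<close> contributes \<open>A2 * u_xx\<close>.\<close>
    have "P t x u 1 0 1 - P t x u 1 0 0 - P t x u 0 0 1 + P t x u 0 0 0 = 2 * A2 t x * p3u (vxi Q) t x u"
      by (simp add: P_def prolong_expr_def Let_def tau_x[OF that] tau_u[OF that] tau2[OF that])
        (simp add: algebra_simps)
    then show ?thesis using P0 A2 that by simp
  qed
  have xi_const: "vxi Q t x u = vxi Q t x 0" if "(t, x) \<in> D" for t x u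
  proof -
    have "\<forall>v. ((\<lambda>v. vxi Q t x v) has_real_derivative 0) (at v)"
      using smooth3_DERIV(3)[of "{(t, x, u). (t, x) \<in> D}" "vxi Q" t x] sym xi_u that
      by (simp add: is_sym_def)
    then show ?thesis by (rule DERIV_isconst_all)
  qed
  have xi_x: "p3x (vxi Q) t x u = p3x (vxi Q) t x 0" if "(t, x) \<in> D" for t x u
    unfolding p3x_def
    using eventually_in_slice(2)[OF D that]
    by (intro deriv_cong_ev) (auto elim!: eventually_mono intro: xi_const)
  have xi2: "p3u (p3x (vxi Q)) t x u = 0" "p3u (p3u (vxi Q)) t x u = 0" if "(t, x) \<in> D" for t x u
  proof -
    define c where "c = p3x (vxi Q) t x 0"
    have "p3x (vxi Q) t x = (\<lambda>v. c)" unfolding c_def by (rule ext, rule xi_x[OF that])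
    then show "p3u (p3x (vxi Q)) t x u = 0" by (simp add: p3u_def)
    have "p3u (vxi Q) t x = (\<lambda>v. 0)" using xi_u[OF that] by auto
    then show "p3u (p3u (vxi Q)) t x u = 0"
      unfolding p3u_def[of "p3u (vxi Q)"] by simp
  qed
  note simps = P_def prolong_expr_def Let_def tau_x[OF tx] tau_u[OF tx] tau2[OF tx] xi_u[OF tx] xi2[OF tx]
  show "p3x (vtau Q) t x u = 0" "p3u (vtau Q) t x u = 0" "p3u (vxi Q) t x u = 0"
    using tau_x tau_u xi_u tx by auto
  \<comment> \<open>Twice the coefficient of the square of \<open>u_x\<close>; odd powers
    cancel.\<close>
  have "P t x u 1 0 0 + P t x u (-1) 0 0 - 2 * P t x u 0 0 0 = - 2 * A2 t x * p3u (p3u (veta Q)) t x u"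
    by (simp add: simps) (simp add: algebra_simps)
  then show uu: "p3u (p3u (veta Q)) t x u = 0"
    using P0 A2 tx by simp
  have "P t x u 0 0 1 - P t x u 0 0 0
    = A2 t x * (2 * p3x (vxi Q) t x u - p3t (vtau Q) t x u)
      - (vtau Q t x u * pdt A2 t x + vxi Q t x u * pdx A2 t x)"
    by (simp add: simps) (simp add: algebra_simps)
  then show "vtau Q t x u * pdt A2 t x + vxi Q t x u * pdx A2 t x
       = A2 t x * (2 * p3x (vxi Q) t x u - p3t (vtau Q) t x u)"
    using P0 tx by simp
  \<comment> \<open>Twice the linear coefficient in \<open>u_x\<close>; even powers cancel.\<close>
  have "P t x u 1 0 0 - P t x u (-1) 0 0
    = 2 * (- p3t (vxi Q) t x u + (p3x (vxi Q) t x u - p3t (vtau Q) t x u) * A1 t x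
       + (p3t (vtau Q) t x u - p3x (vxi Q) t x u) * u + veta Q t x u
       - A2 t x * (2 * p3u (p3x (veta Q)) t x u - p3x (p3x (vxi Q)) t x u)
       - vtau Q t x u * pdt A1 t x - vxi Q t x u * pdx A1 t x)"
    by (simp add: simps) (simp add: algebra_simps)
  then show "- p3t (vxi Q) t x u + (p3x (vxi Q) t x u - p3t (vtau Q) t x u) * A1 t x
       + (p3t (vtau Q) t x u - p3x (vxi Q) t x u) * u + veta Q t x u
       - A2 t x * (2 * p3u (p3x (veta Q)) t x u - p3x (p3x (vxi Q)) t x u)
       - vtau Q t x u * pdt A1 t x - vxi Q t x u * pdx A1 t x = 0"
    using P0[OF tx] by simp
  have "P t x u 0 0 0 = p3t (veta Q) t x u + (u - A1 t x) * p3x (veta Q) t x u - A2 t x * p3x (p3x (veta Q)) t x u"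
    by (simp add: simps) (simp add: algebra_simps)
  then show "p3t (veta Q) t x u + (u - A1 t x) * p3x (veta Q) t x u - A2 t x * p3x (p3x (veta Q)) t x u = 0"
    using P0[OF tx] by simp
qed

lemma DERIV_fst_component:
  fixes D :: "(real \<times> real) set"
  assumes "open D" "(t, x) \<in> D" "\<And>s y. (s, y) \<in> D \<Longrightarrow> f s y = h s"
    and "((\<lambda>s. f s x) has_real_derivative d) (at t)"
  shows "(h has_real_derivative d) (at t)"
proof (rule has_field_derivative_transform_within_open[OF assms(4) open_slices(1)[OF assms(1)]])
  show "t \<in> {s. (s, x) \<in> D}" using assms(2) by simp
qed (use assms(3) in auto)

lemma constant_on_domain:
  fixes D :: "(real \<times> real) set"
  assumes "open D" "convex D"
    and "\<And>t x. (t, x) \<in> D \<Longrightarrow> ((\<lambda>y. f t y) has_real_derivative 0) (at x)"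
    and "\<And>t x. (t, x) \<in> D \<Longrightarrow> ((\<lambda>s. f s x) has_real_derivative 0) (at t)"
  shows "\<exists>c. \<forall>t x. (t, x) \<in> D \<longrightarrow> f t x = c"
proof -
  obtain h where h: "\<And>t x. (t, x) \<in> D \<Longrightarrow> f t x = h t"
    using constant_on_slices[of D f, OF assms(2,3)] by blast
  have "(h has_real_derivative 0) (at t)" if "t \<in> fst ` D" for t
    using that DERIV_fst_component[of D t _ f h 0, OF assms(1) _ h assms(4)] by force
  then obtain c where "\<forall>t\<in>fst ` D. h t = c"
    using has_field_derivative_zero_constant[OF convex_fst_image[OF assms(2)], of h]
    by (metis has_field_derivative_at_within)
  then have "f t x = c" if "(t, x) \<in> D" for t x using that h by force
  then show ?thesis by blast
qed

lemma pdx_pdx_affine_zero: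
  assumes "open D" "(t, x) \<in> D" "\<And>y. (t, y) \<in> D \<Longrightarrow> f t y = a * y + b"
  shows "pdx (pdx f) t x = 0"
proof -
  have "pdx f t y = a" if "(t, y) \<in> D" for y
  proof -
    have "deriv (f t) y = deriv (\<lambda>y. a * y + b) y"
      using eventually_in_slice(2)[OF assms(1) that]
      by (intro deriv_cong_ev) (auto elim!: eventually_mono intro: assms(3))
    also have "\<dots> = a" by (rule DERIV_imp_deriv) (auto intro!: derivative_eq_intros)
    finally show ?thesis by (simp add: pdx_def)
  qed
  then have "deriv (pdx f t) x = deriv (\<lambda>y. a) x"
    using eventually_in_slice(2)[OF assms(1,2)]
    by (intro deriv_cong_ev) (auto elim!: eventually_mono)
  then show ?thesis by (simp add: pdx_def[of "pdx f"])
qed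

text \<open>With \<open>eta = E1 u + E0\<close> the last determining equation splits in powers of
  \<open>u\<close>: the square gives \<open>E1_x = 0\<close>, the linear part
  \<open>E0_x = - E1_t\<close>, the rest \<open>E0_t = A1 E0_x + A2 E0_xx\<close>. Thus
  \<open>E0\<close> is affine in \<open>x\<close> with slope \<open>- d\<close>, where
  \<open>d = E1_t\<close>. Where \<open>d\<close> is nonzero, \<open>A1 = - E0_t / d\<close> would
  be affine in \<open>x\<close> too, against \<open>A1_xx \<noteq> 0\<close>.\<close>

lemma symmetry_eta_affine:
  assumes D: "open D" "convex D" and sym: "is_sym D A2 A1 Q"
    and A2: "\<And>t x. (t, x) \<in> D \<Longrightarrow> A2 t x \<noteq> 0"
    and A1: "\<And>t x. (t, x) \<in> D \<Longrightarrow> pdx (pdx A1) t x \<noteq> 0"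
  obtains s1 s0 where "\<And>t x u. (t, x) \<in> D \<Longrightarrow> veta Q t x u = s1 * u + s0"
proof -
  let ?W = "{(t, x, u :: real). (t, x) \<in> D}"
  let ?et = "veta Q"
  note pw = determining_equations_pointwise[OF D(1) sym A2]
  have sm: "smooth3 ?W ?et" using sym by (simp add: is_sym_def)
  define E0 where "E0 t x = ?et t x 0" for t x
  define E1 where "E1 t x = ?et t x 1 - ?et t x 0" for t x
  have et: "?et t x u = E1 t x * u + E0 t x" if tx: "(t, x) \<in> D" for t x u
  proof -
    have u': "\<forall>v. (p3u ?et t x has_real_derivative 0) (at v)"
      using smooth3_DERIV(3)[OF smooth3_p3u[OF sm], of t x] pw(4)[OF _ tx] tx by simp
    then have c: "p3u ?et t x v = p3u ?et t x 0" for v by (rule DERIV_isconst_all)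
    have "\<forall>v. ((\<lambda>v. ?et t x v - p3u ?et t x 0 * v) has_real_derivative 0) (at v)"
      using smooth3_DERIV(3)[OF sm, of t x] tx c by (auto intro!: derivative_eq_intros)
    then have "?et t x v - p3u ?et t x 0 * v = ?et t x 0 - p3u ?et t x 0 * 0" for v
      by (rule DERIV_isconst_all)
    from this[of u] this[of 1] show ?thesis by (simp add: E0_def E1_def algebra_simps)
  qed
  define E0t E0x E0xx E1t E1x E1xx where
    "E0t = (\<lambda>t x. p3t ?et t x 0)" "E0x = (\<lambda>t x. p3x ?et t x 0)" "E0xx = (\<lambda>t x. p3x (p3x ?et) t x 0)"
    "E1t = (\<lambda>t x. p3t ?et t x 1 - p3t ?et t x 0)" "E1x = (\<lambda>t x. p3x ?et t x 1 - p3x ?et t x 0)"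
    "E1xx = (\<lambda>t x. p3x (p3x ?et) t x 1 - p3x (p3x ?et) t x 0)"
  note Edefs = this
  have dE: "((\<lambda>s. E0 s x) has_real_derivative E0t t x) (at t)"
     "((\<lambda>y. E0 t y) has_real_derivative E0x t x) (at x)"
     "((\<lambda>y. E0x t y) has_real_derivative E0xx t x) (at x)"
     "((\<lambda>s. E1 s x) has_real_derivative E1t t x) (at t)"
     "((\<lambda>y. E1 t y) has_real_derivative E1x t x) (at x)"
     "((\<lambda>y. E1x t y) has_real_derivative E1xx t x) (at x)" if "(t, x) \<in> D" for t x
    unfolding E0_def E1_def Edefs using that
    by (auto intro!: DERIV_diff smooth3_DERIV[OF sm] smooth3_DERIV[OF smooth3_p3x[OF sm]])
  have eqs: "E1t t x * u + E0t t x + (u - A1 t x) * (E1x t x * u + E0x t x)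
      - A2 t x * (E1xx t x * u + E0xx t x) = 0" if tx: "(t, x) \<in> D" for t x u
  proof -
    have ev: "eventually (\<lambda>s. ?et s x u = E1 s x * u + E0 s x) (nhds t)"
         "eventually (\<lambda>y. ?et t y u = E1 t y * u + E0 t y) (nhds x)"
      if "(t, x) \<in> D" for t x
      using eventually_in_slice[OF D(1) that] by (auto elim!: eventually_mono intro: et)
    have 1: "p3t ?et t x u = E1t t x * u + E0t t x" if "(t, x) \<in> D" for t x
    proof -
      have "p3t ?et t x u = deriv (\<lambda>s. E1 s x * u + E0 s x) t"
        unfolding p3t_def by (rule deriv_cong_ev[OF ev(1)[OF that]]) simp
      also have "\<dots> = E1t t x * u + E0t t x"
        by (rule DERIV_imp_deriv) (auto intro!: derivative_eq_intros dE that)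
      finally show ?thesis .
    qed
    have 2: "p3x ?et t x u = E1x t x * u + E0x t x" if "(t, x) \<in> D" for t x
    proof -
      have "p3x ?et t x u = deriv (\<lambda>y. E1 t y * u + E0 t y) x"
        unfolding p3x_def by (rule deriv_cong_ev[OF ev(2)[OF that]]) simp
      also have "\<dots> = E1x t x * u + E0x t x"
        by (rule DERIV_imp_deriv) (auto intro!: derivative_eq_intros dE that)
      finally show ?thesis .
    qed
    have "p3x (p3x ?et) t x u = deriv (\<lambda>y. E1x t y * u + E0x t y) x"
      unfolding p3x_def[of "p3x ?et"]
      using eventually_in_slice(2)[OF D(1) tx] 2
      by (intro deriv_cong_ev) (auto elim!: eventually_mono)
    also have "\<dots> = E1xx t x * u + E0xx t x"
      by (rule DERIV_imp_deriv) (auto intro!: derivative_eq_intros dE tx)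
    finally show ?thesis using pw(7)[OF _ tx, of u] 1[OF tx] 2[OF tx] by simp
  qed
  have E1x0: "E1x t x = 0" if "(t, x) \<in> D" for t x
  proof -
    from eqs[OF that, of 0] eqs[OF that, of 1] eqs[OF that, of "-1"]
    show ?thesis by (simp add: algebra_simps)
  qed
  have E1xx0: "E1xx t x = 0" if "(t, x) \<in> D" for t x
  proof -
    have "((\<lambda>y. 0) has_real_derivative E1xx t x) (at x)"
      by (rule has_field_derivative_transform_within_open[OF dE(6)[OF that]
            open_slices(2)[OF D(1), of t]]) (use that E1x0 in auto)
    then show ?thesis using DERIV_unique DERIV_const by blast
  qed
  have E0x: "E0x t x = - E1t t x" and E0t: "E0t t x = A1 t x * E0x t x + A2 t x * E0xx t x"
    if "(t, x) \<in> D" for t x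
    using eqs[OF that, of 0] eqs[OF that, of 1] E1x0[OF that] E1xx0[OF that]
    by (simp_all add: algebra_simps)
  obtain e1 where e1: "\<And>t x. (t, x) \<in> D \<Longrightarrow> E1 t x = e1 t"
    using constant_on_slices[OF D(2), of E1] dE(5) E1x0 by (metis (no_types, lifting))
  have De1: "(e1 has_real_derivative E1t t x) (at t)" if "(t, x) \<in> D" for t x
    using DERIV_fst_component[of D t x E1 e1, OF D(1) that e1] dE(4)[OF that] by blast
  define d where "d = deriv e1"
  have E1t: "E1t t x = d t" if "(t, x) \<in> D" for t x
    unfolding d_def using DERIV_imp_deriv[OF De1[OF that]] by simp
  have E0xx0: "E0xx t x = 0" if "(t, x) \<in> D" for t x
  proof -
    have "((\<lambda>y. - d t) has_real_derivative E0xx t x) (at x)"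
      by (rule has_field_derivative_transform_within_open[OF dE(3)[OF that]
            open_slices(2)[OF D(1), of t]]) (use that E0x E1t in auto)
    then show ?thesis using DERIV_unique DERIV_const by blast
  qed
  have "\<exists>e0. \<forall>t x. (t, x) \<in> D \<longrightarrow> E0 t x + d t * x = e0 t"
  proof (rule constant_on_slices[OF D(2)])
    fix t x assume tx: "(t, x) \<in> D"
    show "((\<lambda>y. E0 t y + d t * y) has_real_derivative 0) (at x)"
      using dE(2)[OF tx] E0x[OF tx] E1t[OF tx] by (auto intro!: derivative_eq_intros)
  qed
  then obtain e0 where e0: "\<And>t x. (t, x) \<in> D \<Longrightarrow> E0 t x + d t * x = e0 t" by blast
  have d0: "d t = 0" if tx: "(t, x) \<in> D" for t x
  proof (rule ccontr)
    assume nz: "d t \<noteq> 0"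
    obtain r where r: "r > 0" "{t - r<..<t + r} \<times> {x - r<..<x + r} \<subseteq> D"
      using open_prod_box[OF D(1) tx] by blast
    \<comment> \<open>\<open>d\<close> is itself a t-derivative, so its differentiability in
      \<open>t\<close> needs an argument: a second point \<open>y\<close> of the slice gives
      \<open>E0 s x - E0 s y = d s * (y - x)\<close>, and \<open>E0\<close> is differentiable in
      \<open>t\<close>.\<close>
    define y where "y = x + r / 2"
    have ty: "(t, y) \<in> D" using r by (intro subsetD[OF r(2)]) (auto simp: y_def)
    have xy: "y \<noteq> x" using r by (simp add: y_def)
    have "((\<lambda>s. (E0 s x - E0 s y) / (y - x)) has_real_derivative (E0t t x - E0t t y) / (y - x)) (at t)"
      using dE(1)[OF tx] dE(1)[OF ty] by (auto intro!: derivative_intros DERIV_cdivide)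
    then have Dd: "(d has_real_derivative (E0t t x - E0t t y) / (y - x)) (at t)"
    proof (rule has_field_derivative_transform_within_open)
      show "open ({s. (s, x) \<in> D} \<inter> {s. (s, y) \<in> D})"
        by (intro open_Int open_slices D)
      show "t \<in> {s. (s, x) \<in> D} \<inter> {s. (s, y) \<in> D}" using tx ty by simp
      fix s assume "s \<in> {s. (s, x) \<in> D} \<inter> {s. (s, y) \<in> D}"
      then have "E0 s x + d s * x = E0 s y + d s * y" using e0 by simp
      then have "E0 s x - E0 s y = d s * (y - x)" by (simp add: algebra_simps)
      then show "(E0 s x - E0 s y) / (y - x) = d s" using xy by simp
    qed
    define c where "c = (E0t t x - E0t t y) / (y - x)"
    have De0: "(e0 has_real_derivative (E0t t x + c * x)) (at t)"
    proof (rule DERIV_fst_component[of D t x "\<lambda>s x. E0 s x + d s * x" e0, OF D(1) tx])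
      show "((\<lambda>s. E0 s x + d s * x) has_real_derivative E0t t x + c * x) (at t)"
        using Dd dE(1)[OF tx] unfolding c_def[symmetric] by (auto intro!: derivative_eq_intros)
    qed (use e0 in auto)
    have aff: "A1 t z = (c / d t) * z - (E0t t x + c * x) / d t" if tz: "(t, z) \<in> D" for z
    proof -
      have "((\<lambda>s. e0 s - d s * z) has_real_derivative (E0t t x + c * x) - c * z) (at t)"
        using De0 Dd unfolding c_def[symmetric] by (auto intro!: derivative_eq_intros)
      then have "((\<lambda>s. E0 s z) has_real_derivative (E0t t x + c * x) - c * z) (at t)"
        by (rule has_field_derivative_transform_within_open[OF _ open_slices(1)[OF D(1), of z]])
          (use tz e0 in \<open>auto simp: algebra_simps dest: e0\<close>)
      then have "E0t t z = (E0t t x + c * x) - c * z" using dE(1)[OF tz] DERIV_unique by blast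
      then have "- A1 t z * d t = (E0t t x + c * x) - c * z"
        using E0t[OF tz] E0x[OF tz] E1t[OF tz] E0xx0[OF tz] by simp
      then show ?thesis using nz by (simp add: field_simps)
    qed
    have "pdx (pdx A1) t x = 0"
      by (rule pdx_pdx_affine_zero[of D t x A1 "c / d t" "- ((E0t t x + c * x) / d t)", OF D(1) tx])
        (use aff in simp)
    then show False using A1[OF tx] by simp
  qed
  have "\<exists>s1. \<forall>t x. (t, x) \<in> D \<longrightarrow> E1 t x = s1"
    by (rule constant_on_domain[OF D]) (use dE(4,5) E1x0 E1t d0 in metis)+
  then obtain s1 where s1: "\<And>t x. (t, x) \<in> D \<Longrightarrow> E1 t x = s1" by blast
  have z: "E0x t x = 0" "E0t t x = 0" if "(t, x) \<in> D" for t x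
    using E0x[OF that] E0t[OF that] E1t[OF that] d0[OF that] E0xx0[OF that] by simp_all
  have "\<exists>s0. \<forall>t x. (t, x) \<in> D \<longrightarrow> E0 t x = s0"
    by (rule constant_on_domain[OF D]) (use dE(1,2) z in metis)+
  then obtain s0 where s0: "\<And>t x. (t, x) \<in> D \<Longrightarrow> E0 t x = s0" by blast
  show ?thesis by (rule that[of s1 s0]) (use et s1 s0 in simp)
qed

text \<open>Once \<open>eta = s1 u + s0\<close>, the coefficient of \<open>u_x\<close> is affine in
  \<open>u\<close>, and its slope forces \<open>\<xi>_x = \<tau>' + s1\<close>. The rest of the
  criterion consists of the two conditions on \<open>A2\<close> and \<open>A1\<close>.\<close>

lemma determining_equations:
  assumes D: "open D" "convex D" and sym: "is_sym D A2 A1 Q"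
    and A2: "\<And>t x. (t, x) \<in> D \<Longrightarrow> A2 t x \<noteq> 0"
    and A1: "\<And>t x. (t, x) \<in> D \<Longrightarrow> pdx (pdx A1) t x \<noteq> 0"
  obtains \<tau> \<rho> s1 s0 where "smooth1 (fst ` D) \<tau>" "smooth1 (fst ` D) \<rho>"
    "\<And>t x u. (t, x) \<in> D \<Longrightarrow> vtau Q t x u = \<tau> t"
    "\<And>t x u. (t, x) \<in> D \<Longrightarrow> vxi Q t x u = (deriv \<tau> t + s1) * x + \<rho> t"
    "\<And>t x u. (t, x) \<in> D \<Longrightarrow> veta Q t x u = s1 * u + s0"
    "\<And>t x. (t, x) \<in> D \<Longrightarrow> \<tau> t * pdt A2 t x + ((deriv \<tau> t + s1) * x + \<rho> t) * pdx A2 t x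
        = (deriv \<tau> t + 2 * s1) * A2 t x"
    "\<And>t x. (t, x) \<in> D \<Longrightarrow> \<tau> t * pdt A1 t x + ((deriv \<tau> t + s1) * x + \<rho> t) * pdx A1 t x
        = s1 * A1 t x + s0 - deriv (deriv \<tau>) t * x - deriv \<rho> t"
proof -
  let ?W = "{(t, x, u :: real). (t, x) \<in> D}"
  note pw = determining_equations_pointwise[OF D(1) sym A2]
  have sm: "smooth3 ?W (vtau Q)" "smooth3 ?W (vxi Q)" using sym by (simp_all add: is_sym_def)
  obtain s1 s0 where eta: "\<And>t x u. (t, x) \<in> D \<Longrightarrow> veta Q t x u = s1 * u + s0"
    using symmetry_eta_affine[OF D sym A2 A1] by blast
  have u_const: "vtau Q t x u = vtau Q t x 0" "vxi Q t x u = vxi Q t x 0" if "(t, x) \<in> D" for t x u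
  proof -
    have "\<forall>v. (vtau Q t x has_real_derivative 0) (at v)" "\<forall>v. (vxi Q t x has_real_derivative 0) (at v)"
      using smooth3_DERIV(3)[OF sm(1), of t x] smooth3_DERIV(3)[OF sm(2), of t x] pw(2,3)[OF _ that] that
      by simp_all
    then show "vtau Q t x u = vtau Q t x 0" "vxi Q t x u = vxi Q t x 0"
      using DERIV_isconst_all by blast+
  qed
  have "\<exists>\<tau>. \<forall>t x. (t, x) \<in> D \<longrightarrow> vtau Q t x 0 = \<tau> t"
  proof (rule constant_on_slices[OF D(2)])
    fix t x assume tx: "(t, x) \<in> D"
    show "((\<lambda>y. vtau Q t y 0) has_real_derivative 0) (at x)"
      using smooth3_DERIV(2)[OF sm(1), of t x 0] pw(1)[OF _ tx, of 0] tx by simp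
  qed
  then obtain \<tau> where \<tau>: "\<And>t x. (t, x) \<in> D \<Longrightarrow> vtau Q t x 0 = \<tau> t" by blast
  have s\<tau>: "smooth1 (fst ` D) \<tau>"
  proof (rule smooth1_local)
    fix t assume "t \<in> fst ` D"
    then obtain x where tx: "(t, x) \<in> D" by auto
    show "\<exists>K g. open K \<and> t \<in> K \<and> smooth1 K g \<and> (\<forall>z\<in>K. g z = \<tau> z)"
      using smooth3_slice_t[OF sm(1), of x 0] \<tau> tx open_slices(1)[OF D(1), of x]
      by (intro exI[of _ "{t. (t, x) \<in> D}"] exI[of _ "\<lambda>t. vtau Q t x 0"]) auto
  qed
  have \<tau>': "p3t (vtau Q) t x u = deriv \<tau> t" if tx: "(t, x) \<in> D" for t x u
  proof -
    have "(\<tau> has_real_derivative p3t (vtau Q) t x u) (at t)"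
    proof (rule DERIV_fst_component[OF D(1) tx])
      show "vtau Q s y u = \<tau> s" if "(s, y) \<in> D" for s y
        using \<tau>[OF that] u_const(1)[OF that, of u] by simp
      show "((\<lambda>s. vtau Q s x u) has_real_derivative p3t (vtau Q) t x u) (at t)"
        using smooth3_DERIV(1)[OF sm(1), of t x u] tx by simp
    qed
    then show ?thesis using DERIV_imp_deriv by force
  qed
  have eta_x: "p3x (veta Q) t x u = 0" if "(t, x) \<in> D" for t x u
  proof -
    have "deriv (\<lambda>y. veta Q t y u) x = deriv (\<lambda>y. s1 * u + s0) x"
      using eventually_in_slice(2)[OF D(1) that]
      by (intro deriv_cong_ev) (auto elim!: eventually_mono intro: eta)
    then show ?thesis by (simp add: p3x_def)
  qed
  have eta_xu: "p3u (p3x (veta Q)) t x u = 0" if "(t, x) \<in> D" for t x u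
  proof -
    have "p3x (veta Q) t x = (\<lambda>u. 0)" using eta_x[OF that] by auto
    then show ?thesis by (simp add: p3u_def)
  qed
  have xi_x: "p3x (vxi Q) t x u = deriv \<tau> t + s1" if tx: "(t, x) \<in> D" for t x u
  proof -
    have e: "vxi Q t x u = vxi Q t x 0" "p3t (vxi Q) t x u = p3t (vxi Q) t x 0" 
      "p3x (vxi Q) t x u = p3x (vxi Q) t x 0" "p3x (p3x (vxi Q)) t x u = p3x (p3x (vxi Q)) t x 0"
      if tx: "(t, x) \<in> D" for t x u
    proof -
      show "vxi Q t x u = vxi Q t x 0" by (rule u_const[OF tx])
      show "p3t (vxi Q) t x u = p3t (vxi Q) t x 0" unfolding p3t_def
        using eventually_in_slice(1)[OF D(1) tx]
        by (intro deriv_cong_ev) (auto elim!: eventually_mono intro: u_const)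
      have *: "p3x (vxi Q) t y u = p3x (vxi Q) t y 0" if "(t, y) \<in> D" for y unfolding p3x_def
        using eventually_in_slice(2)[OF D(1) that]
        by (intro deriv_cong_ev) (auto elim!: eventually_mono intro: u_const)
      show "p3x (vxi Q) t x u = p3x (vxi Q) t x 0" by (rule *[OF tx])
      show "p3x (p3x (vxi Q)) t x u = p3x (p3x (vxi Q)) t x 0" unfolding p3x_def[of "p3x (vxi Q)"]
        using eventually_in_slice(2)[OF D(1) tx]
        by (intro deriv_cong_ev) (auto elim!: eventually_mono intro: *)
    qed
    \<comment> \<open>Comparing \<open>u = 0\<close> with \<open>u = 1\<close> isolates the slope in
      \<open>u\<close>, since \<tau>, \<xi> and their derivatives do not depend on
      \<open>u\<close>.\<close>
    have "(deriv \<tau> t - p3x (vxi Q) t x 0) + s1 = 0"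
      using pw(6)[OF _ tx, of 0] pw(6)[OF _ tx, of 1]
      by (simp add: \<tau>'[OF tx] e[OF tx, of 1] eta[OF tx] eta_xu[OF tx] u_const(1)[OF tx, of 1])
    then show ?thesis by (simp add: e(3)[OF tx, of u])
  qed
  have "\<exists>\<rho>. \<forall>t x. (t, x) \<in> D \<longrightarrow> vxi Q t x 0 - (deriv \<tau> t + s1) * x = \<rho> t"
  proof (rule constant_on_slices[OF D(2)])
    fix t x assume tx: "(t, x) \<in> D"
    show "((\<lambda>y. vxi Q t y 0 - (deriv \<tau> t + s1) * y) has_real_derivative 0) (at x)"
      using smooth3_DERIV(2)[OF sm(2), of t x 0] xi_x[OF tx] tx by (auto intro!: derivative_eq_intros)
  qed
  then obtain \<rho> where \<rho>: "\<And>t x. (t, x) \<in> D \<Longrightarrow> vxi Q t x 0 - (deriv \<tau> t + s1) * x = \<rho> t" by blast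
  have s\<rho>: "smooth1 (fst ` D) \<rho>"
  proof (rule smooth1_local)
    fix t assume "t \<in> fst ` D"
    then obtain x where tx: "(t, x) \<in> D" by auto
    let ?K = "{t. (t, x) \<in> D}"
    have K: "open ?K" "?K \<subseteq> fst ` D" using open_slices(1)[OF D(1), of x] by force+
    have "smooth1 ?K (\<lambda>t. vxi Q t x 0 - (deriv \<tau> t + s1) * x)"
      using smooth3_slice_t[OF sm(2), of x 0] smooth1_subset[OF smooth1_deriv[OF s\<tau>] K(2)]
      by (intro smooth1_diff smooth1_mult smooth1_add smooth1_const K(1)) auto
    then show "\<exists>K g. open K \<and> t \<in> K \<and> smooth1 K g \<and> (\<forall>z\<in>K. g z = \<rho> z)"
      using \<rho> tx K(1) by (intro exI[of _ ?K]) auto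
  qed
  have xi: "vxi Q t x u = (deriv \<tau> t + s1) * x + \<rho> t" if "(t, x) \<in> D" for t x u
    using \<rho>[OF that] u_const(2)[OF that, of u] by simp
  have xi_t: "p3t (vxi Q) t x u = deriv (deriv \<tau>) t * x + deriv \<rho> t" if tx: "(t, x) \<in> D" for t x u
  proof -
    have t: "t \<in> fst ` D" using tx by force
    have "p3t (vxi Q) t x u = deriv (\<lambda>s. (deriv \<tau> s + s1) * x + \<rho> s) t" unfolding p3t_def
      using eventually_in_slice(1)[OF D(1) tx]
      by (intro deriv_cong_ev) (auto elim!: eventually_mono intro: xi)
    also have "\<dots> = deriv (deriv \<tau>) t * x + deriv \<rho> t"
      by (rule DERIV_imp_deriv)
        (auto intro!: derivative_eq_intros smooth1_DERIV[OF s\<rho> t] smooth1_DERIV[OF smooth1_deriv[OF s\<tau>] t])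
    finally show ?thesis .
  qed
  have xi_xx: "p3x (p3x (vxi Q)) t x u = 0" if "(t, x) \<in> D" for t x u
  proof -
    have "deriv (\<lambda>y. p3x (vxi Q) t y u) x = deriv (\<lambda>y. deriv \<tau> t + s1) x"
      using eventually_in_slice(2)[OF D(1) that]
      by (intro deriv_cong_ev) (auto elim!: eventually_mono intro: xi_x)
    then show ?thesis by (simp add: p3x_def[of "p3x (vxi Q)"])
  qed
  show ?thesis
  proof (rule that[OF s\<tau> s\<rho> _ xi eta])
    show "vtau Q t x u = \<tau> t" if "(t, x) \<in> D" for t x u
      using \<tau>[OF that] u_const(1)[OF that, of u] by simp
    fix t x assume tx: "(t, x) \<in> D"
    have "vtau Q t x 0 = \<tau> t" by (rule \<tau>[OF tx])
    then show "\<tau> t * pdt A2 t x + ((deriv \<tau> t + s1) * x + \<rho> t) * pdx A2 t x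
        = (deriv \<tau> t + 2 * s1) * A2 t x"
      and "\<tau> t * pdt A1 t x + ((deriv \<tau> t + s1) * x + \<rho> t) * pdx A1 t x
        = s1 * A1 t x + s0 - deriv (deriv \<tau>) t * x - deriv \<rho> t"
      using pw(5)[OF _ tx, of 0] pw(6)[OF _ tx, of 0]
      by (simp_all add: xi[OF tx] xi_x[OF tx] xi_xx[OF tx] xi_t[OF tx] \<tau>'[OF tx] eta[OF tx] eta_xu[OF tx]
          algebra_simps)
  qed
qed

section \<open>Affine vector fields\<close>

text \<open>All generators of the list and their linear combinations lie in this six-parameter
  family, so that spans become arithmetic of parameters.\<close>

definition affine_vf :: "real \<Rightarrow> real \<Rightarrow> real \<Rightarrow> real \<Rightarrow> real \<Rightarrow> real \<Rightarrow> vf" where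
  "affine_vf a b k n s1 s0 = ((\<lambda>t x u. a + b * t), (\<lambda>t x u. k * x + n), (\<lambda>t x u. s1 * u + s0))"

lemma affine_vf_simps [simp]:
  "vtau (affine_vf a b k n s1 s0) = (\<lambda>t x u. a + b * t)"
  "vxi (affine_vf a b k n s1 s0) = (\<lambda>t x u. k * x + n)"
  "veta (affine_vf a b k n s1 s0) = (\<lambda>t x u. s1 * u + s0)"
  by (simp_all add: affine_vf_def vtau_def vxi_def veta_def)

lemma p3_affine:
  "p3t (\<lambda>t x u. a + b * t + c * x + d * u) = (\<lambda>t x u. b)"
  "p3x (\<lambda>t x u. a + b * t + c * x + d * u) = (\<lambda>t x u. c)"
  "p3u (\<lambda>t x u. a + b * t + c * x + d * u) = (\<lambda>t x u. d)"
  unfolding p3t_def p3x_def p3u_def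
  by (intro ext DERIV_imp_deriv; auto intro!: derivative_eq_intros)+

lemma smooth3_affine: "smooth3 W (\<lambda>t x u. a + b * t + c * x + d * u)"
proof -
  have "\<exists>a' b' c' d'. pd3 is (\<lambda>t x u. a + b * t + c * x + d * u) = (\<lambda>t x u. a' + b' * t + c' * x + d' * u)" for "is"
  proof (induction "is")
    case (Cons i "is")
    then obtain a' b' c' d' where
      "pd3 is (\<lambda>t x u. a + b * t + c * x + d * u) = (\<lambda>t x u. a' + b' * t + c' * x + d' * u)" by blast
    then have "\<exists>a'. pd3 (i # is) (\<lambda>t x u. a + b * t + c * x + d * u) = (\<lambda>t x u. a')"
      by (auto simp: p3_affine)
    then obtain a'' where "pd3 (i # is) (\<lambda>t x u. a + b * t + c * x + d * u) = (\<lambda>t x u. a'' + 0 * t + 0 * x + 0 * u)"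
      by auto
    then show ?case by blast
  qed auto
  note ex = this
  show ?thesis unfolding smooth3_def
  proof (intro allI conjI impI)
    fix "is" t x u
    obtain a' b' c' d' where *: "pd3 is (\<lambda>t x u. a + b * t + c * x + d * u) = (\<lambda>t x u. a' + b' * t + c' * x + d' * u)"
      using ex by blast
    show "continuous_on W (\<lambda>p. pd3 is (\<lambda>t x u. a + b * t + c * x + d * u) (fst p) (fst (snd p)) (snd (snd p)))"
      unfolding * by (intro continuous_intros)
    show "(\<lambda>s. pd3 is (\<lambda>t x u. a + b * t + c * x + d * u) s x u) differentiable at t"
      "(\<lambda>y. pd3 is (\<lambda>t x u. a + b * t + c * x + d * u) t y u) differentiable at x"
      "(\<lambda>v. pd3 is (\<lambda>t x u. a + b * t + c * x + d * u) t x v) differentiable at u"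
      unfolding * by (intro derivative_intros differentiable_add differentiable_mult; simp)+
  qed
qed

text \<open>The relation \<open>k = b + s1\<close> cancels the terms in \<open>u * u_x\<close>; what
  is left is linear in \<open>u_xx\<close> and \<open>u_x\<close>, and the two hypotheses annihilate
  its coefficients.\<close>

lemma is_sym_affine_vf:
  assumes "k = b + s1"
    and A2: "\<And>t x. (t, x) \<in> D \<Longrightarrow> (a + b * t) * pdt A2 t x + (k * x + n) * pdx A2 t x = (b + 2 * s1) * A2 t x"
    and A1: "\<And>t x. (t, x) \<in> D \<Longrightarrow> (a + b * t) * pdt A1 t x + (k * x + n) * pdx A1 t x = s1 * A1 t x + s0"
  shows "is_sym D A2 A1 (affine_vf a b k n s1 s0)"
  unfolding is_sym_def
proof (intro conjI allI impI)
  let ?Q = "affine_vf a b k n s1 s0"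
  show "smooth3 {(t, x, u). (t, x) \<in> D} (vtau ?Q)" "smooth3 {(t, x, u). (t, x) \<in> D} (vxi ?Q)"
    "smooth3 {(t, x, u). (t, x) \<in> D} (veta ?Q)"
    using smooth3_affine[of _ a b 0 0] smooth3_affine[of _ n 0 k 0] smooth3_affine[of _ s0 0 0 s1]
    by (simp_all add: add.commute)
  fix t x u ux utx uxx assume tx: "(t, x) \<in> D"
  have "p3t (vtau ?Q) = (\<lambda>t x u. b)" "p3x (vtau ?Q) = (\<lambda>t x u. 0)" "p3u (vtau ?Q) = (\<lambda>t x u. 0)"
    "p3t (vxi ?Q) = (\<lambda>t x u. 0)" "p3x (vxi ?Q) = (\<lambda>t x u. k)" "p3u (vxi ?Q) = (\<lambda>t x u. 0)"
    "p3t (veta ?Q) = (\<lambda>t x u. 0)" "p3x (veta ?Q) = (\<lambda>t x u. 0)" "p3u (veta ?Q) = (\<lambda>t x u. s1)"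
    using p3_affine[of a b 0 0] p3_affine[of n 0 k 0] p3_affine[of s0 0 0 s1]
    by (simp_all add: add.commute)
  moreover have "p3x (\<lambda>t x u. c) = (\<lambda>t x u. 0)" "p3u (\<lambda>t x u. c) = (\<lambda>t x u. 0)" for c
    by (simp_all add: p3x_def p3u_def)
  ultimately have "prolong_expr A2 A1 ?Q t x u (- u * ux + A2 t x * uxx + A1 t x * ux) ux utx uxx
    = ((b + 2 * s1) * A2 t x - ((a + b * t) * pdt A2 t x + (k * x + n) * pdx A2 t x)) * uxx
      + (s1 * A1 t x + s0 - ((a + b * t) * pdt A1 t x + (k * x + n) * pdx A1 t x)) * ux"
    unfolding prolong_expr_def Let_def by (simp add: assms(1) algebra_simps)
  then show "prolong_expr A2 A1 ?Q t x u (- u * ux + A2 t x * uxx + A1 t x * ux) ux utx uxx = 0"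
    by (simp add: A2[OF tx] A1[OF tx])
qed

lemma pd3_cong_open:
  assumes "open W" and "\<And>t x u. (t, x, u) \<in> W \<Longrightarrow> f t x u = g t x u"
  shows "(t, x, u) \<in> W \<Longrightarrow> pd3 is f t x u = pd3 is g t x u"
proof (induction "is" arbitrary: t x u)
  case (Cons i "is")
  have c: "continuous_on UNIV (\<lambda>s. (s, x, u))" "continuous_on UNIV (\<lambda>y. (t, y, u))"
    "continuous_on UNIV (\<lambda>v. (t, x, v))" by (intro continuous_intros)+
  have o: "open {s. (s, x, u) \<in> W}" "open {y. (t, y, u) \<in> W}" "open {v. (t, x, v) \<in> W}"
    using c[THEN open_vimage[OF assms(1)]] by (force simp: vimage_def)+
  show ?case
    using deriv_cong_open[OF o(1), of "\<lambda>s. pd3 is f s x u" "\<lambda>s. pd3 is g s x u" t]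
      deriv_cong_open[OF o(2), of "\<lambda>y. pd3 is f t y u" "\<lambda>y. pd3 is g t y u" x]
      deriv_cong_open[OF o(3), of "\<lambda>v. pd3 is f t x v" "\<lambda>v. pd3 is g t x v" u] Cons
    by (auto simp: p3t_def p3x_def p3u_def)
qed (use assms(2) in simp)

lemma smooth3_cong:
  assumes W: "open W" and eq: "\<And>t x u. (t, x, u) \<in> W \<Longrightarrow> f t x u = g t x u" and f: "smooth3 W f"
  shows "smooth3 W g"
  unfolding smooth3_def
proof (intro allI conjI impI)
  fix "is" t x u
  have pd: "pd3 is f t x u = pd3 is g t x u" if "(t, x, u) \<in> W" for t x u
    using pd3_cong_open[OF W eq that] .
  have "continuous_on W (\<lambda>p. pd3 is f (fst p) (fst (snd p)) (snd (snd p)))"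
    using f by (simp add: smooth3_def)
  then show "continuous_on W (\<lambda>p. pd3 is g (fst p) (fst (snd p)) (snd (snd p)))"
    by (rule continuous_on_eq) (use pd in auto)
  assume mem: "(t, x, u) \<in> W"
  have c: "continuous_on UNIV (\<lambda>s. (s, x, u))" "continuous_on UNIV (\<lambda>y. (t, y, u))"
    "continuous_on UNIV (\<lambda>v. (t, x, v))" by (intro continuous_intros)+
  have o: "open {s. (s, x, u) \<in> W}" "open {y. (t, y, u) \<in> W}" "open {v. (t, x, v) \<in> W}"
    using c[THEN open_vimage[OF W]] by (force simp: vimage_def)+
  have df: "(\<lambda>s. pd3 is f s x u) differentiable at t" "(\<lambda>y. pd3 is f t y u) differentiable at x"
    "(\<lambda>v. pd3 is f t x v) differentiable at u"
    using f mem by (auto simp: smooth3_def)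
  show "(\<lambda>s. pd3 is g s x u) differentiable at t"
    by (rule differentiable_cong_open[OF o(1) _ _ df(1)]) (use mem pd in auto)
  show "(\<lambda>y. pd3 is g t y u) differentiable at x"
    by (rule differentiable_cong_open[OF o(2) _ _ df(2)]) (use mem pd in auto)
  show "(\<lambda>v. pd3 is g t x v) differentiable at u"
    by (rule differentiable_cong_open[OF o(3) _ _ df(3)]) (use mem pd in auto)
qed

text \<open>Algebras are described up to agreement on \<open>D\<close>, whereas a field is a total
  function; openness of \<open>D\<close> makes all derivatives in the criterion depend only on the
  values over \<open>D\<close>.\<close>

lemma is_sym_cong:
  assumes D: "open D" and agree: "vf_agree D Q R" and R: "is_sym D A2 A1 R"
  shows "is_sym D A2 A1 Q"
proof -
  let ?W = "{(t, x, u :: real). (t, x) \<in> D}"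
  note W = open_cylinder[OF D]
  have eq: "vtau R t x u = vtau Q t x u" "vxi R t x u = vxi Q t x u" "veta R t x u = veta Q t x u"
    if "(t, x, u) \<in> ?W" for t x u
    using agree that by (auto simp: vf_agree_def)
  have pd: "pd3 is (vtau Q) t x u = pd3 is (vtau R) t x u" "pd3 is (vxi Q) t x u = pd3 is (vxi R) t x u"
    "pd3 is (veta Q) t x u = pd3 is (veta R) t x u" if "(t, x) \<in> D" for "is" t x u
    using that eq by (intro pd3_cong_open[OF W]; simp)+
  have pd': "p3t f = pd3 [0] f" "p3x f = pd3 [1] f" "p3u f = pd3 [2] f"
    "p3x (p3x f) = pd3 [1, 1] f" "p3u (p3x f) = pd3 [2, 1] f" "p3u (p3u f) = pd3 [2, 2] f"
    for f by simp_all
  have "prolong_expr A2 A1 Q t x u ut ux utx uxx = prolong_expr A2 A1 R t x u ut ux utx uxx"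
    if tx: "(t, x) \<in> D" for t x u ut ux utx uxx
    unfolding prolong_expr_def Let_def pd'(4-6) unfolding pd'(1-3) pd[OF tx]
    using eq[of t x u] tx by (simp del: pd3.simps)
  moreover have "smooth3 ?W (vtau Q)" "smooth3 ?W (vxi Q)" "smooth3 ?W (veta Q)"
    using R smooth3_cong[OF W] eq unfolding is_sym_def by blast+
  ultimately show ?thesis using R by (simp add: is_sym_def)
qed

section \<open>Equations with a basic symmetry\<close>

definition nfA2 :: "real \<Rightarrow> (real \<Rightarrow> real) \<Rightarrow> real \<Rightarrow> real \<Rightarrow> real" where
  "nfA2 \<sigma> \<phi> = (\<lambda>t x. exp (2 * \<sigma> * t) * \<phi> (x * exp (- \<sigma> * t)))"
definition nfA1 :: "real \<Rightarrow> real \<Rightarrow> (real \<Rightarrow> real) \<Rightarrow> real \<Rightarrow> real \<Rightarrow> real" where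
  "nfA1 \<sigma> \<sigma>0 \<psi> = (\<lambda>t x. exp (\<sigma> * t) * \<psi> (x * exp (- \<sigma> * t)) + \<sigma>0 * t)"
definition nf_dom :: "real \<Rightarrow> real set \<Rightarrow> (real \<times> real) set" where
  "nf_dom \<sigma> J = {(t, x). x * exp (- \<sigma> * t) \<in> J}"

text \<open>The derivatives are parameters instead of \<open>deriv\<close>, so that the closed
  formulas of Cases 4 to 7 fit as well. The condition \<open>\<sigma> * \<sigma>0 = 0\<close> makes
  \<open>\<partial>_t + \<sigma> (x \<partial>_x + u \<partial>_u) + \<sigma>0 \<partial>_u\<close>
  a symmetry: it removes the term \<open>\<sigma> * \<sigma>0 * t\<close> from the condition on
  \<open>A1\<close>.\<close>

locale normal_form =
  fixes J :: "real set" and \<phi> \<psi> d\<phi> d\<psi> dd\<psi> :: "real \<Rightarrow> real" and \<sigma> \<sigma>0 :: real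
  assumes open_J: "open J"
    and d\<phi>: "\<And>y. y \<in> J \<Longrightarrow> (\<phi> has_real_derivative d\<phi> y) (at y)"
    and d\<psi>: "\<And>y. y \<in> J \<Longrightarrow> (\<psi> has_real_derivative d\<psi> y) (at y)"
    and dd\<psi>: "\<And>y. y \<in> J \<Longrightarrow> (d\<psi> has_real_derivative dd\<psi> y) (at y)"
    and \<phi>_nz: "\<And>y. y \<in> J \<Longrightarrow> \<phi> y \<noteq> 0"
    and dd\<psi>_nz: "\<And>y. y \<in> J \<Longrightarrow> dd\<psi> y \<noteq> 0"
    and \<sigma>\<sigma>0: "\<sigma> * \<sigma>0 = 0"
begin

lemma partials:
  assumes "x * exp (- \<sigma> * t) \<in> J"
  defines "y \<equiv> x * exp (- \<sigma> * t)"
  shows "pdt (nfA2 \<sigma> \<phi>) t x = exp (2 * \<sigma> * t) * (2 * \<sigma> * \<phi> y - \<sigma> * y * d\<phi> y)"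
    "pdx (nfA2 \<sigma> \<phi>) t x = exp (\<sigma> * t) * d\<phi> y"
    "pdt (nfA1 \<sigma> \<sigma>0 \<psi>) t x = exp (\<sigma> * t) * (\<sigma> * \<psi> y - \<sigma> * y * d\<psi> y) + \<sigma>0"
    "pdx (nfA1 \<sigma> \<sigma>0 \<psi>) t x = d\<psi> y"
proof -
  have y: "y \<in> J" using assms by simp
  have dt: "((\<lambda>s. x * exp (- \<sigma> * s)) has_real_derivative (- \<sigma> * y)) (at t)"
    unfolding y_def by (auto intro!: derivative_eq_intros)
  have dx: "((\<lambda>z. z * exp (- \<sigma> * t)) has_real_derivative exp (- \<sigma> * t)) (at x)"
    by (auto intro!: derivative_eq_intros)
  have c\<phi>: "((\<lambda>s. \<phi> (x * exp (- \<sigma> * s))) has_real_derivative d\<phi> y * (- \<sigma> * y)) (at t)"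
    and c\<psi>: "((\<lambda>s. \<psi> (x * exp (- \<sigma> * s))) has_real_derivative d\<psi> y * (- \<sigma> * y)) (at t)"
    using DERIV_chain2[OF _ dt, of \<phi> "d\<phi> y"] DERIV_chain2[OF _ dt, of \<psi> "d\<psi> y"] d\<phi>[OF y] d\<psi>[OF y]
    by (simp_all add: y_def)
  have x\<phi>: "((\<lambda>z. \<phi> (z * exp (- \<sigma> * t))) has_real_derivative d\<phi> y * exp (- \<sigma> * t)) (at x)"
    and x\<psi>: "((\<lambda>z. \<psi> (z * exp (- \<sigma> * t))) has_real_derivative d\<psi> y * exp (- \<sigma> * t)) (at x)"
    using DERIV_chain2[OF _ dx, of \<phi> "d\<phi> y"] DERIV_chain2[OF _ dx, of \<psi> "d\<psi> y"] d\<phi>[OF y] d\<psi>[OF y]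
    by (simp_all add: y_def)
  have e: "exp (2 * \<sigma> * t) * exp (- \<sigma> * t) = exp (\<sigma> * t)" "exp (\<sigma> * t) * exp (- \<sigma> * t) = 1"
    by (simp_all flip: exp_add)
  have e2: "((\<lambda>s. exp (2 * \<sigma> * s)) has_real_derivative exp (2 * \<sigma> * t) * (2 * \<sigma>)) (at t)"
    and e1: "((\<lambda>s. exp (\<sigma> * s)) has_real_derivative exp (\<sigma> * t) * \<sigma>) (at t)"
    by (auto intro!: derivative_eq_intros)
  have "pdt (nfA2 \<sigma> \<phi>) t x = exp (2 * \<sigma> * t) * (2 * \<sigma>) * \<phi> y + d\<phi> y * (- \<sigma> * y) * exp (2 * \<sigma> * t)"
    unfolding pdt_def nfA2_def y_def
    by (rule DERIV_imp_deriv) (rule DERIV_mult[OF e2 c\<phi>[unfolded y_def]])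
  then show "pdt (nfA2 \<sigma> \<phi>) t x = exp (2 * \<sigma> * t) * (2 * \<sigma> * \<phi> y - \<sigma> * y * d\<phi> y)"
    by (simp add: algebra_simps)
  have "pdt (nfA1 \<sigma> \<sigma>0 \<psi>) t x = exp (\<sigma> * t) * \<sigma> * \<psi> y + d\<psi> y * (- \<sigma> * y) * exp (\<sigma> * t) + \<sigma>0"
    unfolding pdt_def nfA1_def y_def
    by (rule DERIV_imp_deriv)
      (rule DERIV_add[OF DERIV_mult[OF e1 c\<psi>[unfolded y_def]]], auto intro!: derivative_eq_intros)
  then show "pdt (nfA1 \<sigma> \<sigma>0 \<psi>) t x = exp (\<sigma> * t) * (\<sigma> * \<psi> y - \<sigma> * y * d\<psi> y) + \<sigma>0"
    by (simp add: algebra_simps)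
  have "pdx (nfA2 \<sigma> \<phi>) t x = exp (2 * \<sigma> * t) * (d\<phi> y * exp (- \<sigma> * t))"
    unfolding pdx_def nfA2_def
    by (rule DERIV_imp_deriv) (rule DERIV_cmult[OF x\<phi>])
  then show "pdx (nfA2 \<sigma> \<phi>) t x = exp (\<sigma> * t) * d\<phi> y" using e(1) by (simp add: algebra_simps)
  have "pdx (nfA1 \<sigma> \<sigma>0 \<psi>) t x = exp (\<sigma> * t) * (d\<psi> y * exp (- \<sigma> * t)) + 0"
    unfolding pdx_def nfA1_def
    by (rule DERIV_imp_deriv) (rule DERIV_add[OF DERIV_cmult[OF x\<psi>] DERIV_const])
  then show "pdx (nfA1 \<sigma> \<sigma>0 \<psi>) t x = d\<psi> y" using e(2) by (simp add: algebra_simps)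
qed

lemma open_nf_dom: "open (nf_dom \<sigma> J)"
proof -
  have "nf_dom \<sigma> J = (\<lambda>p. snd p * exp (- \<sigma> * fst p)) -` J" by (auto simp: nf_dom_def)
  then show ?thesis by (auto intro!: open_vimage open_J continuous_intros)
qed

lemma pdx_pdx_nonzero:
  assumes "x * exp (- \<sigma> * t) \<in> J"
  shows "pdx (pdx (nfA1 \<sigma> \<sigma>0 \<psi>)) t x \<noteq> 0"
proof -
  have "pdx (pdx (nfA1 \<sigma> \<sigma>0 \<psi>)) t x = deriv (\<lambda>z. d\<psi> (z * exp (- \<sigma> * t))) x"
    unfolding pdx_def[of "pdx (nfA1 \<sigma> \<sigma>0 \<psi>)"]
  proof (rule deriv_cong_ev)
    have "(t, x) \<in> nf_dom \<sigma> J" using assms by (simp add: nf_dom_def)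
    then show "\<forall>\<^sub>F z in nhds x. pdx (nfA1 \<sigma> \<sigma>0 \<psi>) t z = d\<psi> (z * exp (- \<sigma> * t))"
      by (rule eventually_mono[OF eventually_in_slice(2)[OF open_nf_dom]]) (simp add: partials nf_dom_def)
  qed simp
  also have "\<dots> = dd\<psi> (x * exp (- \<sigma> * t)) * exp (- \<sigma> * t)"
    by (rule DERIV_imp_deriv, rule DERIV_chain2[of d\<psi> _ "\<lambda>z. z * exp (- \<sigma> * t)" x, OF dd\<psi>[OF assms]])
      (auto intro!: derivative_eq_intros)
  finally show ?thesis using dd\<psi>_nz[OF assms] by simp
qed

lemma nfA2_nonzero: "x * exp (- \<sigma> * t) \<in> J \<Longrightarrow> nfA2 \<sigma> \<phi> t x \<noteq> 0"
  by (simp add: nfA2_def \<phi>_nz)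

text \<open>\<open>comp_eqs a p q e l y\<close>: the two classifying conditions at a fixed time, in terms of the invariant
  \<open>y = x exp (- \<sigma> t)\<close>.  Here \<open>a = \<tau>'\<close>, \<open>e = \<tau>''\<close>, and \<open>p y + q\<close> is the \<open>y\<close>-component of the symmetry
  after subtracting the multiple of the basic symmetry that cancels its \<open>t\<close>-component.\<close>
definition comp_eqs :: "real \<Rightarrow> real \<Rightarrow> real \<Rightarrow> real \<Rightarrow> real \<Rightarrow> real \<Rightarrow> bool" where
  "comp_eqs a p q e l y \<longleftrightarrow> (p * y + q) * d\<psi> y = (p - a) * \<psi> y + l - e * y
     \<and> (p * y + q) * d\<phi> y = (2 * p - a) * \<phi> y"

text \<open>Both equations are linear and homogeneous in the coefficient vector, so the admissible
  vectors form a linear space.\<close>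

lemma comp_eqs_diff:
  assumes "comp_eqs a p q e l y" "comp_eqs a' p' q' e' l' y"
  shows "comp_eqs (a - c * a') (p - c * p') (q - c * q') (e - c * e') (l - c * l') y"
proof -
  have w: "((p - c * p') * y + (q - c * q')) * z = (p * y + q) * z - c * ((p' * y + q') * z)" for z
    by (simp add: algebra_simps)
  show ?thesis
    using assms unfolding comp_eqs_def w by (simp only:) (simp add: algebra_simps)
qed

text \<open>Differentiation in \<open>y\<close> eliminates \<open>l\<close> and \<psi> itself. If
  \<open>a = e = 0\<close>, the nonvanishing \<psi>'' then forces
  \<open>p y + q = 0\<close>.\<close>

lemma comp_eqs_deriv:
  assumes J: "{u<..<v} \<subseteq> J" and eqs: "\<And>y. y \<in> {u<..<v} \<Longrightarrow> comp_eqs a p q e l y"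
    and y: "y \<in> {u<..<v}"
  shows "a * d\<psi> y + (p * y + q) * dd\<psi> y = - e"
proof -
  have yJ: "y \<in> J" using y J by auto
  have "((\<lambda>y. (p * y + q) * d\<psi> y) has_real_derivative p * d\<psi> y + (p * y + q) * dd\<psi> y) (at y)"
    by (auto intro!: derivative_eq_intros dd\<psi>[OF yJ])
  moreover have "((\<lambda>y. (p * y + q) * d\<psi> y) has_real_derivative (p - a) * d\<psi> y - e) (at y)"
  proof (rule has_field_derivative_transform_within_open[OF _ open_greaterThanLessThan y])
    show "((\<lambda>y. (p - a) * \<psi> y + l - e * y) has_real_derivative (p - a) * d\<psi> y - e) (at y)"
      by (auto intro!: derivative_eq_intros d\<psi>[OF yJ])
  qed (use eqs in \<open>auto simp: comp_eqs_def\<close>)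
  ultimately have "p * d\<psi> y + (p * y + q) * dd\<psi> y = (p - a) * d\<psi> y - e" by (rule DERIV_unique)
  then show ?thesis by (simp add: algebra_simps)
qed

text \<open>Differentiating the \<open>\<psi>\<close>-equation, a nonzero \<open>p\<close> would force \<open>2 (\<psi>' - \<psi>'(y0)) + (y - y0) \<psi>'' = 0\<close>, so
  \<open>(y - y0)^2 (\<psi>' - \<psi>'(y0))\<close> is constant and \<open>\<psi>''\<close> would vanish.\<close>
lemma comp_eqs_unique:
  assumes r: "r > 0" and J: "{y0 - r<..<y0 + r} \<subseteq> J"
    and eqs: "\<And>y. y \<in> {y0 - r<..<y0 + r} \<Longrightarrow> comp_eqs a p q e l y"
    and zero: "p * y0 + q = 0"
  shows "a = 0 \<and> p = 0 \<and> q = 0 \<and> e = 0 \<and> l = 0"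
proof -
  let ?S = "{y0 - r<..<y0 + r}"
  have y0: "y0 \<in> ?S" "y0 \<in> J" using r J by auto
  \<comment> \<open>At \<open>y0\<close> the \<phi>-equation reads
    \<open>0 = (2 p - a) \<phi>(y0)\<close>.\<close>
  have a: "a = 2 * p" using eqs[OF y0(1)] zero \<phi>_nz[OF y0(2)] by (simp add: comp_eqs_def)
  have q: "q = - p * y0" using zero by simp
  have deq: "a * d\<psi> y + p * (y - y0) * dd\<psi> y = - e" if "y \<in> ?S" for y
    using comp_eqs_deriv[OF J eqs that] q by (simp add: algebra_simps)
  have e: "e = - a * d\<psi> y0" using deq[OF y0(1)] by simp
  have "p = 0"
  proof (rule ccontr)
    assume p: "p \<noteq> 0"
    have rel: "2 * (d\<psi> y - d\<psi> y0) + (y - y0) * dd\<psi> y = 0" if "y \<in> ?S" for y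
    proof -
      have "p * (2 * (d\<psi> y - d\<psi> y0) + (y - y0) * dd\<psi> y) = 0"
        using deq[OF that] a e by (simp add: algebra_simps)
      then show ?thesis using p by simp
    qed
    define F where "F y = (y - y0)\<^sup>2 * (d\<psi> y - d\<psi> y0)" for y
    have "(F has_real_derivative 0) (at y)" if y: "y \<in> ?S" for y
    proof -
      have yJ: "y \<in> J" using y J by auto
      have "(F has_real_derivative (y - y0) * (2 * (d\<psi> y - d\<psi> y0) + (y - y0) * dd\<psi> y)) (at y)"
        unfolding F_def
        by (rule derivative_eq_intros dd\<psi>[OF yJ] refl)+ (simp add: power2_eq_square algebra_simps)
      then show ?thesis unfolding rel[OF y] by simp
    qed
    then have "\<exists>c. \<forall>y\<in>?S. F y = c"
      by (intro has_field_derivative_zero_constant) (auto simp: has_field_derivative_at_within)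
    then have F0: "F y = 0" if "y \<in> ?S" for y
      using that y0(1) by (metis F_def diff_self mult_zero_right)
    then have const: "d\<psi> y = d\<psi> y0" if "y \<in> ?S" for y
      using F0[OF that] by (auto simp: F_def)
    have "((\<lambda>y. d\<psi> y0) has_real_derivative dd\<psi> y0) (at y0)"
      by (rule has_field_derivative_transform_within_open[OF dd\<psi>[OF y0(2)] open_greaterThanLessThan y0(1)])
        (rule const)
    then have "dd\<psi> y0 = 0" using DERIV_unique DERIV_const by blast
    then show False using dd\<psi>_nz[OF y0(2)] by simp
  qed
  then show ?thesis using a q e eqs[OF y0(1)] by (simp add: comp_eqs_def)
qed

text \<open>Subtract the multiple \<open>c\<close> of the normalised vector for which the component
  vanishes at \<open>y0\<close>. By uniqueness the difference is zero, and its first entry says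
  \<open>c = a\<close>.\<close>

lemma comp_eqs_proportional:
  assumes "r > 0" "{y0 - r<..<y0 + r} \<subseteq> J"
    and "\<And>y. y \<in> {y0 - r<..<y0 + r} \<Longrightarrow> comp_eqs a p q e l y"
    and "\<And>y. y \<in> {y0 - r<..<y0 + r} \<Longrightarrow> comp_eqs 1 k n m L y"
  shows "p = a * k \<and> q = a * n \<and> e = a * m \<and> l = a * L"
proof -
  have nz: "k * y0 + n \<noteq> 0" using comp_eqs_unique[OF assms(1,2,4)] by auto
  define c where "c = (p * y0 + q) / (k * y0 + n)"
  have "a - c * 1 = 0 \<and> p - c * k = 0 \<and> q - c * n = 0 \<and> e - c * m = 0 \<and> l - c * L = 0"
  proof (rule comp_eqs_unique[OF assms(1,2)])
    show "(p - c * k) * y0 + (q - c * n) = 0"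
      using nz unfolding c_def by (simp add: field_simps)
  qed (rule comp_eqs_diff[OF assms(3,4)])
  then show ?thesis by simp
qed

text \<open>The conditions on \<open>A2\<close> and \<open>A1\<close> after division by
  \<open>exp (2 \<sigma> t)\<close> and \<open>exp (\<sigma> t)\<close>. The last coefficient
  collects the terms of the \<psi>-equation containing neither \<open>y\<close> nor \<psi>.\<close>

definition sym_data :: "(real \<times> real) set \<Rightarrow> vf \<Rightarrow> (real \<Rightarrow> real) \<Rightarrow> (real \<Rightarrow> real) \<Rightarrow> real \<Rightarrow> real \<Rightarrow> bool" where
  "sym_data D Q \<tau> \<rho> s1 s0 \<longleftrightarrow> smooth1 (fst ` D) \<tau> \<and> smooth1 (fst ` D) \<rho> \<and>
    (\<forall>t x u. (t, x) \<in> D \<longrightarrow> vtau Q t x u = \<tau> t \<and> vxi Q t x u = (deriv \<tau> t + s1) * x + \<rho> t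
       \<and> veta Q t x u = s1 * u + s0) \<and>
    (\<forall>t x. (t, x) \<in> D \<longrightarrow> comp_eqs (deriv \<tau> t) (deriv \<tau> t + s1 - \<sigma> * \<tau> t) (\<rho> t * exp (- \<sigma> * t))
       (deriv (deriv \<tau>) t) (exp (- \<sigma> * t) * (s0 - deriv \<rho> t - \<sigma>0 * \<tau> t + s1 * \<sigma>0 * t)) (x * exp (- \<sigma> * t)))"

lemma symmetry_sym_data:
  assumes D: "open D" "convex D" "D \<subseteq> nf_dom \<sigma> J"
    and sym: "is_sym D (nfA2 \<sigma> \<phi>) (nfA1 \<sigma> \<sigma>0 \<psi>) Q"
  shows "\<exists>\<tau> \<rho> s1 s0. sym_data D Q \<tau> \<rho> s1 s0"
proof -
  have J: "x * exp (- \<sigma> * t) \<in> J" if "(t, x) \<in> D" for t x using that D(3) by (auto simp: nf_dom_def)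
  show ?thesis
  proof (rule determining_equations[OF D(1,2) sym])
    show "nfA2 \<sigma> \<phi> t x \<noteq> 0" "pdx (pdx (nfA1 \<sigma> \<sigma>0 \<psi>)) t x \<noteq> 0" if "(t, x) \<in> D" for t x
      using nfA2_nonzero pdx_pdx_nonzero J[OF that] by auto
    fix \<tau> \<rho> s1 s0
    assume 1: "smooth1 (fst ` D) \<tau>" "smooth1 (fst ` D) \<rho>"
      "\<And>t x u. (t, x) \<in> D \<Longrightarrow> vtau Q t x u = \<tau> t"
      "\<And>t x u. (t, x) \<in> D \<Longrightarrow> vxi Q t x u = (deriv \<tau> t + s1) * x + \<rho> t"
      "\<And>t x u. (t, x) \<in> D \<Longrightarrow> veta Q t x u = s1 * u + s0"
      and e2: "\<And>t x. (t, x) \<in> D \<Longrightarrow> \<tau> t * pdt (nfA2 \<sigma> \<phi>) t x + ((deriv \<tau> t + s1) * x + \<rho> t) * pdx (nfA2 \<sigma> \<phi>) t x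
        = (deriv \<tau> t + 2 * s1) * nfA2 \<sigma> \<phi> t x"
      and e1: "\<And>t x. (t, x) \<in> D \<Longrightarrow> \<tau> t * pdt (nfA1 \<sigma> \<sigma>0 \<psi>) t x + ((deriv \<tau> t + s1) * x + \<rho> t) * pdx (nfA1 \<sigma> \<sigma>0 \<psi>) t x
        = s1 * nfA1 \<sigma> \<sigma>0 \<psi> t x + s0 - deriv (deriv \<tau>) t * x - deriv \<rho> t"
    have "comp_eqs (deriv \<tau> t) (deriv \<tau> t + s1 - \<sigma> * \<tau> t) (\<rho> t * exp (- \<sigma> * t))
       (deriv (deriv \<tau>) t) (exp (- \<sigma> * t) * (s0 - deriv \<rho> t - \<sigma>0 * \<tau> t + s1 * \<sigma>0 * t)) (x * exp (- \<sigma> * t))"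
      if tx: "(t, x) \<in> D" for t x
    proof -
      \<comment> \<open>With \<open>x = y * E\<close> both conditions become polynomial identities
        in \<open>E\<close>, from which a power of \<open>E\<close> cancels.\<close>
      define E where "E = exp (\<sigma> * t)"
      define y where "y = x * exp (- \<sigma> * t)"
      have E: "E > 0" "exp (- \<sigma> * t) = 1 / E" "exp (2 * \<sigma> * t) = E * E" "x = y * E"
        by (simp_all add: E_def y_def exp_minus field_simps flip: exp_add)
      have v: "nfA2 \<sigma> \<phi> t x = E * E * \<phi> y" "nfA1 \<sigma> \<sigma>0 \<psi> t x = E * \<psi> y + \<sigma>0 * t"
        unfolding nfA2_def nfA1_def y_def[symmetric] E_def[symmetric] E(3) by simp_all
      note p = partials[OF J[OF tx], folded y_def E_def, unfolded E(3)]
      have "\<tau> t * (E * E * (2 * \<sigma> * \<phi> y - \<sigma> * y * d\<phi> y)) + ((deriv \<tau> t + s1) * (y * E) + \<rho> t) * (E * d\<phi> y)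
        = (deriv \<tau> t + 2 * s1) * (E * E * \<phi> y)"
        using e2[OF tx] unfolding p v unfolding E(4) .
      moreover define R where "R = \<rho> t / E"
      moreover define l where "l = (s0 - deriv \<rho> t - \<sigma>0 * \<tau> t + s1 * \<sigma>0 * t) / E"
      ultimately have R: "\<rho> t = R * E" and l: "s0 - deriv \<rho> t - \<sigma>0 * \<tau> t + s1 * \<sigma>0 * t = l * E"
        and "\<tau> t * (E * E * (2 * \<sigma> * \<phi> y - \<sigma> * y * d\<phi> y)) + ((deriv \<tau> t + s1) * (y * E) + R * E) * (E * d\<phi> y)
        = (deriv \<tau> t + 2 * s1) * (E * E * \<phi> y)"
        using E(1) by simp_all
      then have "(E * E) * (((deriv \<tau> t + s1 - \<sigma> * \<tau> t) * y + R) * d\<phi> y)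
        = (E * E) * ((2 * (deriv \<tau> t + s1 - \<sigma> * \<tau> t) - deriv \<tau> t) * \<phi> y)"
        by (simp add: algebra_simps)
      then have 2: "((deriv \<tau> t + s1 - \<sigma> * \<tau> t) * y + R) * d\<phi> y
        = (2 * (deriv \<tau> t + s1 - \<sigma> * \<tau> t) - deriv \<tau> t) * \<phi> y" using E(1) by simp
      have "\<tau> t * (E * (\<sigma> * \<psi> y - \<sigma> * y * d\<psi> y) + \<sigma>0) + ((deriv \<tau> t + s1) * (y * E) + \<rho> t) * d\<psi> y
        = s1 * (E * \<psi> y + \<sigma>0 * t) + s0 - deriv (deriv \<tau>) t * (y * E) - deriv \<rho> t"
        using e1[OF tx] unfolding p v unfolding E(4) .
      then have "E * (((deriv \<tau> t + s1 - \<sigma> * \<tau> t) * y + R) * d\<psi> y)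
        = (s1 - \<sigma> * \<tau> t) * (E * \<psi> y) + (s0 - deriv \<rho> t - \<sigma>0 * \<tau> t + s1 * \<sigma>0 * t) - deriv (deriv \<tau>) t * (y * E)"
        unfolding R by (simp add: algebra_simps)
      then have "E * (((deriv \<tau> t + s1 - \<sigma> * \<tau> t) * y + R) * d\<psi> y)
        = E * ((s1 - \<sigma> * \<tau> t) * \<psi> y + l - deriv (deriv \<tau>) t * y)"
        unfolding l by (simp add: algebra_simps)
      then have "((deriv \<tau> t + s1 - \<sigma> * \<tau> t) * y + R) * d\<psi> y
        = (s1 - \<sigma> * \<tau> t) * \<psi> y + l - deriv (deriv \<tau>) t * y"
        using E(1) by simp
      with 2 show ?thesis
        unfolding comp_eqs_def y_def[symmetric] unfolding E(2) by (simp add: R_def l_def add_diff_eq)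
    qed
    with 1 show ?thesis unfolding sym_data_def by blast
  qed
qed

text \<open>\<open>y\<close> is an invariant of this field, so on \<open>A2\<close> and
  \<open>A1\<close> it differentiates only the exponential factors and
  \<open>\<sigma>0 * t\<close>.\<close>

lemma basic_symmetry:
  assumes "D \<subseteq> nf_dom \<sigma> J"
  shows "is_sym D (nfA2 \<sigma> \<phi>) (nfA1 \<sigma> \<sigma>0 \<psi>) (affine_vf c 0 (c * \<sigma>) 0 (c * \<sigma>) (c * \<sigma>0))"
proof (rule is_sym_affine_vf)
  fix t x assume "(t, x) \<in> D"
  then have J: "x * exp (- \<sigma> * t) \<in> J" using assms by (auto simp: nf_dom_def)
  define y where "y = x * exp (- \<sigma> * t)"
  define E where "E = exp (\<sigma> * t)"
  have E: "exp (2 * \<sigma> * t) = E * E" "x = y * E"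
    by (simp_all add: E_def y_def exp_minus field_simps flip: exp_add)
  have v: "nfA2 \<sigma> \<phi> t x = E * E * \<phi> y" "nfA1 \<sigma> \<sigma>0 \<psi> t x = E * \<psi> y + \<sigma>0 * t"
    unfolding nfA2_def nfA1_def y_def[symmetric] E_def[symmetric] E(1) by simp_all
  note p = partials[OF J, folded y_def E_def, unfolded E(1)]
  show "(c + 0 * t) * pdt (nfA2 \<sigma> \<phi>) t x + (c * \<sigma> * x + 0) * pdx (nfA2 \<sigma> \<phi>) t x
        = (0 + 2 * (c * \<sigma>)) * nfA2 \<sigma> \<phi> t x"
    unfolding p v unfolding E(2) by (simp add: algebra_simps)
  have "c * \<sigma> * (\<sigma>0 * t) = 0" using \<sigma>\<sigma>0 by auto
  then show "(c + 0 * t) * pdt (nfA1 \<sigma> \<sigma>0 \<psi>) t x + (c * \<sigma> * x + 0) * pdx (nfA1 \<sigma> \<sigma>0 \<psi>) t x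
        = c * \<sigma> * nfA1 \<sigma> \<sigma>0 \<psi> t x + c * \<sigma>0"
    unfolding p v unfolding E(2) by (simp add: algebra_simps)
qed simp

end

lemma vscale_affine_vf [simp]:
  "vscale c (affine_vf a b k n s1 s0) = affine_vf (c * a) (c * b) (c * k) (c * n) (c * s1) (c * s0)"
  by (simp add: vscale_def) (simp add: affine_vf_def algebra_simps)

lemma vadd_affine_vf [simp]:
  "vadd (affine_vf a b k n s1 s0) (affine_vf a' b' k' n' s1' s0')
    = affine_vf (a + a') (b + b') (k + k') (n + n') (s1 + s1') (s0 + s0')"
  by (simp add: vadd_def) (simp add: affine_vf_def algebra_simps)

lemma basis_fields_affine:
  "vD (\<lambda>t. 1) = affine_vf 1 0 0 0 0 0" "vD (\<lambda>t. t) = affine_vf 0 1 1 0 0 0"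
  "vS1 = affine_vf 0 0 1 0 1 0" "vS0 = affine_vf 0 0 0 0 0 1" "vP (\<lambda>t. 1) = affine_vf 0 0 0 1 0 0"
  "vzero = affine_vf 0 0 0 0 0 0"
  by (simp_all add: vD_def vS1_def vS0_def vP_def vzero_def affine_vf_def)

lemma interval_constant:
  fixes f :: "real \<Rightarrow> real"
  assumes "open I" "convex I" "\<And>t. t \<in> I \<Longrightarrow> (f has_real_derivative 0) (at t)"
  shows "\<exists>c. \<forall>t\<in>I. f t = c"
  using has_field_derivative_zero_constant[OF assms(2), of f] assms(3) has_field_derivative_at_within by blast

lemma deriv_zero_on_open:
  assumes "open I" "t \<in> I" "\<And>t. t \<in> I \<Longrightarrow> f t = (c :: real)"
  shows "deriv f t = 0"
  using deriv_cong_open[OF assms(1), of f "\<lambda>t. c" t] assms(2,3) by simp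

text \<open>A box in the coordinates \<open>(t, y)\<close> instead of \<open>(t, x)\<close>: all
  times near \<open>t0\<close> share one interval of \<open>y\<close>, so that \<open>t\<close> can
  vary at fixed \<open>y\<close>.\<close>

lemma flow_box:
  fixes D :: "(real \<times> real) set"
  assumes "open D" "(t0, x0) \<in> D"
  obtains r where "r > 0"
    "\<And>t y. t \<in> {t0 - r<..<t0 + r} \<Longrightarrow> y \<in> {x0 * exp (- \<sigma> * t0) - r<..<x0 * exp (- \<sigma> * t0) + r} \<Longrightarrow>
      (t, y * exp (\<sigma> * t)) \<in> D"
proof -
  let ?f = "\<lambda>p :: real \<times> real. (fst p, snd p * exp (\<sigma> * fst p))"
  have "open (?f -` D)" by (intro open_vimage assms(1) continuous_intros)
  moreover have "(t0, x0 * exp (- \<sigma> * t0)) \<in> ?f -` D"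
    using assms(2) by (simp add: mult.assoc flip: exp_add)
  ultimately obtain r where "r > 0"
     "{t0 - r<..<t0 + r} \<times> {x0 * exp (- \<sigma> * t0) - r<..<x0 * exp (- \<sigma> * t0) + r} \<subseteq> ?f -` D"
    using open_prod_box by blast
  then have "(t, y) \<in> ?f -` D" if "t \<in> {t0 - r<..<t0 + r}"
    "y \<in> {x0 * exp (- \<sigma> * t0) - r<..<x0 * exp (- \<sigma> * t0) + r}" for t y
    using that by blast
  with \<open>r > 0\<close> show ?thesis by (intro that[of r]) simp_all
qed

section \<open>Maximality of the basic symmetry\<close>

context normal_form
begin

lemma sym_data_box:
  assumes D: "open D" "D \<subseteq> nf_dom \<sigma> J" and data: "sym_data D Q \<tau> \<rho> s1 s0" and tx: "(t0, x0) \<in> D"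
  obtains r where "r > 0" "{t0 - r<..<t0 + r} \<subseteq> fst ` D"
    "{x0 * exp (- \<sigma> * t0) - r<..<x0 * exp (- \<sigma> * t0) + r} \<subseteq> J"
    "\<And>t y. t \<in> {t0 - r<..<t0 + r} \<Longrightarrow> y \<in> {x0 * exp (- \<sigma> * t0) - r<..<x0 * exp (- \<sigma> * t0) + r} \<Longrightarrow>
      comp_eqs (deriv \<tau> t) (deriv \<tau> t + s1 - \<sigma> * \<tau> t) (\<rho> t * exp (- \<sigma> * t))
       (deriv (deriv \<tau>) t) (exp (- \<sigma> * t) * (s0 - deriv \<rho> t - \<sigma>0 * \<tau> t + s1 * \<sigma>0 * t)) y"
proof -
  define y0 where "y0 = x0 * exp (- \<sigma> * t0)"
  obtain r where r: "r > 0"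
    "\<And>t y. t \<in> {t0 - r<..<t0 + r} \<Longrightarrow> y \<in> {y0 - r<..<y0 + r} \<Longrightarrow> (t, y * exp (\<sigma> * t)) \<in> D"
    using flow_box[OF D(1) tx] unfolding y0_def by metis
  have e: "y * exp (\<sigma> * t) * exp (- \<sigma> * t) = y" for t y
    by (simp add: mult.assoc flip: exp_add)
  show ?thesis
  proof (rule that[OF r(1), folded y0_def])
    show "{t0 - r<..<t0 + r} \<subseteq> fst ` D"
      using r(2)[of _ y0] r(1) by force
    show "{y0 - r<..<y0 + r} \<subseteq> J"
    proof
      fix y assume "y \<in> {y0 - r<..<y0 + r}"
      then have "(t0, y * exp (\<sigma> * t0)) \<in> nf_dom \<sigma> J" using r(2)[of t0 y] r(1) D(2) by auto
      then have "y * exp (\<sigma> * t0) * exp (- \<sigma> * t0) \<in> J" by (simp add: nf_dom_def)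
      then show "y \<in> J" unfolding e .
    qed
    fix t y assume "t \<in> {t0 - r<..<t0 + r}" "y \<in> {y0 - r<..<y0 + r}"
    from data[unfolded sym_data_def, THEN conjunct2, THEN conjunct2, THEN conjunct2, rule_format, OF r(2)[OF this]]
    show "comp_eqs (deriv \<tau> t) (deriv \<tau> t + s1 - \<sigma> * \<tau> t) (\<rho> t * exp (- \<sigma> * t))
       (deriv (deriv \<tau>) t) (exp (- \<sigma> * t) * (s0 - deriv \<rho> t - \<sigma>0 * \<tau> t + s1 * \<sigma>0 * t)) y"
      unfolding e .
  qed
qed

text \<open>If \<open>\<tau>' = 0\<close> then \<open>a = e = 0\<close>, so the differentiated
  \<psi>-equation makes \<open>p y + q\<close> vanish, and uniqueness kills \<open>p\<close>,
  \<open>q\<close> and \<open>l\<close>. These say \<open>s1 = \<sigma> c\<close>,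
  \<open>\<rho> = 0\<close> and \<open>s0 = \<sigma>0 c\<close>, where \<open>c\<close> is the value
  of \<tau>.\<close>

lemma multiple_of_basic:
  assumes D: "good_dom D" "D \<subseteq> nf_dom \<sigma> J" and data: "sym_data D Q \<tau> \<rho> s1 s0"
    and zero: "\<And>t. t \<in> fst ` D \<Longrightarrow> deriv \<tau> t = 0"
  shows "\<exists>c. vf_agree D Q (affine_vf c 0 (c * \<sigma>) 0 (c * \<sigma>) (c * \<sigma>0))"
proof -
  have oD: "open D" "convex D" "D \<noteq> {}" using D(1) by (auto simp: good_dom_def)
  note I = open_fst_image[OF oD(1)] convex_fst_image[OF oD(2)]
  have s\<tau>: "smooth1 (fst ` D) \<tau>" using data by (simp add: sym_data_def)
  obtain c where c: "\<And>t. t \<in> fst ` D \<Longrightarrow> \<tau> t = c"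
    using interval_constant[OF I, of \<tau>] smooth1_DERIV[OF s\<tau>] zero by metis
  have pql: "s1 - \<sigma> * c = 0 \<and> \<rho> t = 0 \<and> s0 - deriv \<rho> t - \<sigma>0 * c + s1 * \<sigma>0 * t = 0"
    if tI: "t \<in> fst ` D" for t
  proof -
    obtain x where tx: "(t, x) \<in> D" using tI by auto
    define y0 where "y0 = x * exp (- \<sigma> * t)"
    have e: "deriv (deriv \<tau>) t = 0" by (rule deriv_zero_on_open[OF I(1) tI zero])
    obtain r where r: "r > 0" "{y0 - r<..<y0 + r} \<subseteq> J"
      "\<And>s y. s \<in> {t - r<..<t + r} \<Longrightarrow> y \<in> {y0 - r<..<y0 + r} \<Longrightarrow>
      comp_eqs (deriv \<tau> s) (deriv \<tau> s + s1 - \<sigma> * \<tau> s) (\<rho> s * exp (- \<sigma> * s))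
       (deriv (deriv \<tau>) s) (exp (- \<sigma> * s) * (s0 - deriv \<rho> s - \<sigma>0 * \<tau> s + s1 * \<sigma>0 * s)) y"
      using sym_data_box[OF oD(1) D(2) data tx] unfolding y0_def by metis
    have ce: "comp_eqs 0 (s1 - \<sigma> * c) (\<rho> t * exp (- \<sigma> * t)) 0
         (exp (- \<sigma> * t) * (s0 - deriv \<rho> t - \<sigma>0 * c + s1 * \<sigma>0 * t)) y"
      if "y \<in> {y0 - r<..<y0 + r}" for y
      using r(3)[of t y] that r(1) by (simp add: zero[OF tI] e c[OF tI])
    have y0: "y0 \<in> {y0 - r<..<y0 + r}" using r(1) by simp
    have "((s1 - \<sigma> * c) * y0 + \<rho> t * exp (- \<sigma> * t)) * dd\<psi> y0 = 0"
      using comp_eqs_deriv[OF r(2) ce y0] by simp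
    then have "(s1 - \<sigma> * c) * y0 + \<rho> t * exp (- \<sigma> * t) = 0"
      using dd\<psi>_nz[OF subsetD[OF r(2) y0]] by simp
    from comp_eqs_unique[OF r(1,2) ce this] show ?thesis by auto
  qed
  obtain t where t: "t \<in> fst ` D" using oD(3) by auto
  have s1: "s1 = \<sigma> * c" using pql[OF t] by simp
  have \<rho>: "\<rho> t = 0" if "t \<in> fst ` D" for t using pql that by simp
  have "deriv \<rho> t = 0" by (rule deriv_zero_on_open[OF I(1) t \<rho>])
  moreover have "s1 * \<sigma>0 * t = 0" using \<sigma>\<sigma>0 by (auto simp: s1)
  ultimately have s0: "s0 = \<sigma>0 * c" using pql[OF t] by auto
  have "vf_agree D Q (affine_vf c 0 (c * \<sigma>) 0 (c * \<sigma>) (c * \<sigma>0))"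
    unfolding vf_agree_def
  proof (intro allI impI)
    fix t x u assume tx: "(t, x) \<in> D"
    then have tI: "t \<in> fst ` D" by force
    show "vtau Q t x u = vtau (affine_vf c 0 (c * \<sigma>) 0 (c * \<sigma>) (c * \<sigma>0)) t x u \<and>
      vxi Q t x u = vxi (affine_vf c 0 (c * \<sigma>) 0 (c * \<sigma>) (c * \<sigma>0)) t x u \<and>
      veta Q t x u = veta (affine_vf c 0 (c * \<sigma>) 0 (c * \<sigma>) (c * \<sigma>0)) t x u"
      using data tx c[OF tI] zero[OF tI] \<rho>[OF tI] s0 s1 by (simp add: sym_data_def mult.commute)
  qed
  then show ?thesis by blast
qed

text \<open>The algebra can exceed the basic symmetry only through a symmetry with nonconstant
  \<tau>; such a one is the input for the reduction to Cases 4 to 7.\<close>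

lemma span1_or_second_symmetry:
  assumes D: "good_dom D" "D \<subseteq> nf_dom \<sigma> J"
  shows "alg_span1 D (nfA2 \<sigma> \<phi>) (nfA1 \<sigma> \<sigma>0 \<psi>) (affine_vf 1 0 \<sigma> 0 \<sigma> \<sigma>0) \<or>
    (\<exists>Q \<tau> \<rho> s1 s0 t. sym_data D Q \<tau> \<rho> s1 s0 \<and> t \<in> fst ` D \<and> deriv \<tau> t \<noteq> 0)"
proof (rule disjCI)
  have oD: "open D" "convex D" using D(1) by (auto simp: good_dom_def)
  assume no: "\<not> (\<exists>Q \<tau> \<rho> s1 s0 t. sym_data D Q \<tau> \<rho> s1 s0 \<and> t \<in> fst ` D \<and> deriv \<tau> t \<noteq> 0)"
  show "alg_span1 D (nfA2 \<sigma> \<phi>) (nfA1 \<sigma> \<sigma>0 \<psi>) (affine_vf 1 0 \<sigma> 0 \<sigma> \<sigma>0)"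
    unfolding alg_span1_def
  proof (intro allI iffI)
    fix Q assume "is_sym D (nfA2 \<sigma> \<phi>) (nfA1 \<sigma> \<sigma>0 \<psi>) Q"
    then obtain \<tau> \<rho> s1 s0 where data: "sym_data D Q \<tau> \<rho> s1 s0"
      using symmetry_sym_data[OF oD D(2)] by blast
    then have "\<And>t. t \<in> fst ` D \<Longrightarrow> deriv \<tau> t = 0" using no by blast
    from multiple_of_basic[OF D data this]
    show "\<exists>c. vf_agree D Q (vscale c (affine_vf 1 0 \<sigma> 0 \<sigma> \<sigma>0))" by simp
  next
    fix Q assume "\<exists>c. vf_agree D Q (vscale c (affine_vf 1 0 \<sigma> 0 \<sigma> \<sigma>0))"
    then obtain c where "vf_agree D Q (affine_vf c 0 (c * \<sigma>) 0 (c * \<sigma>) (c * \<sigma>0))" by auto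
    then show "is_sym D (nfA2 \<sigma> \<phi>) (nfA1 \<sigma> \<sigma>0 \<psi>) Q"
      by (rule is_sym_cong[OF oD(1) _ basic_symmetry[OF D(2)]])
  qed
qed

end

text \<open>Common form of Cases 4 to 7: \<open>k = 1 + \<alpha>\<close>, \<open>n = L = 0\<close>
  in Case 4; \<open>(k, n, L)\<close> is \<open>(1, 0, 1)\<close> in Case 5 and
  \<open>(0, - 1, 0)\<close> in Case 6; \<open>k = 2\<close>, \<open>n = L = 0\<close>,
  \<open>\<sigma>0 = 1\<close> in Case 7. The second field reproduces \<open>\<sigma>0 * t\<close>,
  while the condition on \<open>A1\<close> asks for the factor \<open>k - 1\<close>; hence
  \<open>\<sigma>0 * (k - 2) = 0\<close>.\<close>

lemma alg_span2_stationary: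
  assumes nf: "normal_form J \<phi> \<psi> d\<phi> d\<psi> dd\<psi> 0 \<sigma>0" and D: "good_dom D" "D \<subseteq> domJ J"
    and e1: "\<And>y. y \<in> J \<Longrightarrow> (k * y + n) * d\<psi> y = (k - 1) * \<psi> y + L"
    and e2: "\<And>y. y \<in> J \<Longrightarrow> (k * y + n) * d\<phi> y = (2 * k - 1) * \<phi> y"
    and \<sigma>0: "\<sigma>0 * (k - 2) = 0"
  shows "alg_span2 D (\<lambda>t. \<phi>) (\<lambda>t x. \<psi> x + \<sigma>0 * t) (affine_vf 1 0 0 0 0 \<sigma>0) (affine_vf 0 1 k n (k - 1) L)"
proof -
  interpret normal_form J \<phi> \<psi> d\<phi> d\<psi> dd\<psi> 0 \<sigma>0
    by (rule nf)
  have oD: "open D" "convex D" "D \<noteq> {}" using D(1) by (auto simp: good_dom_def)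
  note I = open_fst_image[OF oD(1)] convex_fst_image[OF oD(2)]
  have dom: "D \<subseteq> nf_dom 0 J" using D(2) by (simp add: domJ_def nf_dom_def)
  have A: "(\<lambda>t. \<phi>) = nfA2 0 \<phi>" "(\<lambda>t x. \<psi> x + \<sigma>0 * t) = nfA1 0 \<sigma>0 \<psi>"
    by (simp_all add: nfA2_def nfA1_def)
  have base: "comp_eqs 1 k n 0 L y" if "y \<in> J" for y
    using e1[OF that] e2[OF that] by (simp add: comp_eqs_def)
  have \<sigma>0': "\<sigma>0 = 0 \<or> k = 2" using \<sigma>0 by auto
  show ?thesis
    unfolding alg_span2_def A
  proof (intro allI iffI)
    fix Q assume "is_sym D (nfA2 0 \<phi>) (nfA1 0 \<sigma>0 \<psi>) Q"
    then obtain \<tau> \<rho> s1 s0 where data: "sym_data D Q \<tau> \<rho> s1 s0"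
      using symmetry_sym_data[OF oD(1,2) dom] by blast
    have s\<tau>: "smooth1 (fst ` D) \<tau>" using data by (simp add: sym_data_def)
    \<comment> \<open>The reference vector has \<open>m = 0\<close>, so proportionality yields
      \<open>\<tau>'' = 0\<close>; the other entries determine \<open>s1\<close>, \<rho> and
      \<open>s0\<close>.\<close>
    have props: "deriv \<tau> t + s1 = deriv \<tau> t * k \<and> \<rho> t = deriv \<tau> t * n \<and> deriv (deriv \<tau>) t = 0 \<and>
      s0 - deriv \<rho> t - \<sigma>0 * \<tau> t + s1 * \<sigma>0 * t = deriv \<tau> t * L" if tI: "t \<in> fst ` D" for t
    proof -
      obtain x where tx: "(t, x) \<in> D" using tI by auto
      obtain r where r: "r > 0" "{x - r<..<x + r} \<subseteq> J"
        "\<And>s y. s \<in> {t - r<..<t + r} \<Longrightarrow> y \<in> {x - r<..<x + r} \<Longrightarrow>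
          comp_eqs (deriv \<tau> s) (deriv \<tau> s + s1) (\<rho> s) (deriv (deriv \<tau>) s) (s0 - deriv \<rho> s - \<sigma>0 * \<tau> s + s1 * \<sigma>0 * s) y"
        by (rule sym_data_box[OF oD(1) dom data tx, simplified]) auto
      have ce: "comp_eqs (deriv \<tau> t) (deriv \<tau> t + s1) (\<rho> t) (deriv (deriv \<tau>) t)
          (s0 - deriv \<rho> t - \<sigma>0 * \<tau> t + s1 * \<sigma>0 * t) y" if "y \<in> {x - r<..<x + r}" for y
        using r(3)[OF _ that, of t] r(1) by simp
      have "deriv \<tau> t + s1 = deriv \<tau> t * k \<and> \<rho> t = deriv \<tau> t * n \<and> deriv (deriv \<tau>) t = deriv \<tau> t * 0 \<and>
          s0 - deriv \<rho> t - \<sigma>0 * \<tau> t + s1 * \<sigma>0 * t = deriv \<tau> t * L"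
        by (rule comp_eqs_proportional[OF r(1,2) ce base]) (use r(2) in auto)
      then show ?thesis by simp
    qed
    have ds: "(deriv \<tau> has_real_derivative 0) (at t)" if "t \<in> fst ` D" for t
      using smooth1_DERIV[OF smooth1_deriv[OF s\<tau>] that] props[OF that] by simp
    obtain b where b: "\<And>t. t \<in> fst ` D \<Longrightarrow> deriv \<tau> t = b"
      using interval_constant[OF I, of "deriv \<tau>"] ds by metis
    have "((\<lambda>t. \<tau> t - b * t) has_real_derivative 0) (at t)" if "t \<in> fst ` D" for t
      using smooth1_DERIV[OF s\<tau> that] b[OF that] by (auto intro!: derivative_eq_intros)
    then obtain a where "\<And>t. t \<in> fst ` D \<Longrightarrow> \<tau> t - b * t = a"
      using interval_constant[OF I, of "\<lambda>t. \<tau> t - b * t"] by metis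
    then have a: "\<tau> t = a + b * t" if "t \<in> fst ` D" for t using that by (simp add: algebra_simps)
    have \<rho>: "\<rho> t = b * n" if "t \<in> fst ` D" for t using props[OF that] b[OF that] by simp
    obtain t where t: "t \<in> fst ` D" using oD(3) by auto
    have "deriv \<rho> t = 0" by (rule deriv_zero_on_open[OF I(1) t \<rho>])
    moreover have s1: "s1 = b * (k - 1)" using props[OF t] b[OF t] by (simp add: algebra_simps)
    ultimately have s0: "s0 = a * \<sigma>0 + b * L"
      using props[OF t] b[OF t] a[OF t] \<sigma>0' by (auto simp: algebra_simps)
    have "vf_agree D Q (affine_vf a b (b * k) (b * n) (b * (k - 1)) (a * \<sigma>0 + b * L))"
      unfolding vf_agree_def
    proof (intro allI impI)
      fix t x u assume tx: "(t, x) \<in> D"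
      then have tI: "t \<in> fst ` D" by force
      let ?R = "affine_vf a b (b * k) (b * n) (b * (k - 1)) (a * \<sigma>0 + b * L)"
      have "vtau Q t x u = \<tau> t" "vxi Q t x u = (deriv \<tau> t + s1) * x + \<rho> t" "veta Q t x u = s1 * u + s0"
        using data tx by (auto simp: sym_data_def)
      then show "vtau Q t x u = vtau ?R t x u \<and> vxi Q t x u = vxi ?R t x u \<and> veta Q t x u = veta ?R t x u"
        using a[OF tI] b[OF tI] \<rho>[OF tI] s0 s1 by (simp add: algebra_simps)
    qed
    then show "\<exists>a b. vf_agree D Q (vadd (vscale a (affine_vf 1 0 0 0 0 \<sigma>0)) (vscale b (affine_vf 0 1 k n (k - 1) L)))"
      by auto
  next
    fix Q assume "\<exists>a b. vf_agree D Q (vadd (vscale a (affine_vf 1 0 0 0 0 \<sigma>0)) (vscale b (affine_vf 0 1 k n (k - 1) L)))"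
    then obtain a b where ag: "vf_agree D Q (affine_vf a b (b * k) (b * n) (b * (k - 1)) (a * \<sigma>0 + b * L))"
      by auto
    have "is_sym D (nfA2 0 \<phi>) (nfA1 0 \<sigma>0 \<psi>) (affine_vf a b (b * k) (b * n) (b * (k - 1)) (a * \<sigma>0 + b * L))"
    proof (rule is_sym_affine_vf)
      fix t x assume "(t, x) \<in> D"
      then have x: "x \<in> J" using D(2) by (auto simp: domJ_def)
      have v: "nfA2 0 \<phi> t x = \<phi> x" "nfA1 0 \<sigma>0 \<psi> t x = \<psi> x + \<sigma>0 * t" by (simp_all add: nfA2_def nfA1_def)
      have p: "pdt (nfA2 0 \<phi>) t x = 0" "pdx (nfA2 0 \<phi>) t x = d\<phi> x" "pdt (nfA1 0 \<sigma>0 \<psi>) t x = \<sigma>0"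
        "pdx (nfA1 0 \<sigma>0 \<psi>) t x = d\<psi> x"
        using partials[of x t] x by simp_all
      have "(b * k * x + b * n) * d\<phi> x = b * ((k * x + n) * d\<phi> x)" by (simp add: algebra_simps)
      then show "(a + b * t) * pdt (nfA2 0 \<phi>) t x + (b * k * x + b * n) * pdx (nfA2 0 \<phi>) t x
          = (b + 2 * (b * (k - 1))) * nfA2 0 \<phi> t x"
        unfolding p v e2[OF x] by (simp add: algebra_simps)
      have "(b * k * x + b * n) * d\<psi> x = b * ((k * x + n) * d\<psi> x)" by (simp add: algebra_simps)
      then show "(a + b * t) * pdt (nfA1 0 \<sigma>0 \<psi>) t x + (b * k * x + b * n) * pdx (nfA1 0 \<sigma>0 \<psi>) t x
          = b * (k - 1) * nfA1 0 \<sigma>0 \<psi> t x + (a * \<sigma>0 + b * L)"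
        unfolding p v e1[OF x] using \<sigma>0' by (auto simp: algebra_simps)
    qed (simp add: algebra_simps)
    with ag show "is_sym D (nfA2 0 \<phi>) (nfA1 0 \<sigma>0 \<psi>) Q" by (rule is_sym_cong[OF oD(1)])
  qed
qed

section \<open>The coefficient functions of Cases 4 to 7 and their algebras\<close>

lemma DERIV_abs_powr:
  fixes z \<gamma> :: real
  assumes "z \<noteq> 0"
  shows "((\<lambda>z. \<bar>z\<bar> powr \<gamma>) has_real_derivative \<gamma> * \<bar>z\<bar> powr \<gamma> / z) (at z)"
proof (cases "z > 0")
  case True
  have "((\<lambda>z. z powr \<gamma>) has_real_derivative \<gamma> * z powr (\<gamma> - 1)) (at z)"
    using True by (rule has_real_derivative_powr)
  then have "((\<lambda>z. \<bar>z\<bar> powr \<gamma>) has_real_derivative \<gamma> * z powr (\<gamma> - 1)) (at z)"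
    by (rule has_field_derivative_transform_within_open[of _ _ _ "{0<..}"]) (use True in auto)
  then show ?thesis using True by (simp add: powr_diff)
next
  case False
  then have z: "- z > 0" using assms by simp
  have "((\<lambda>z. (- z) powr \<gamma>) has_real_derivative \<gamma> * (- z) powr (\<gamma> - 1) * (- 1)) (at z)"
    by (rule DERIV_chain2[of "\<lambda>z. z powr \<gamma>" _ uminus z, OF has_real_derivative_powr[OF z]]) (auto intro!: derivative_eq_intros)
  then have "((\<lambda>z. \<bar>z\<bar> powr \<gamma>) has_real_derivative \<gamma> * (- z) powr (\<gamma> - 1) * (- 1)) (at z)"
    by (rule has_field_derivative_transform_within_open[of _ _ _ "{..<0}"]) (use z in auto)
  then show ?thesis using z by (simp add: powr_diff)
qed

lemma DERIV_ln_abs: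
  fixes z :: real
  assumes "z \<noteq> 0" shows "((\<lambda>z. ln \<bar>z\<bar>) has_real_derivative 1 / z) (at z)"
proof (cases "z > 0")
  case True
  have "((\<lambda>z. ln z) has_real_derivative 1 / z) (at z)" using True by (auto intro!: derivative_eq_intros)
  then show ?thesis
    by (rule has_field_derivative_transform_within_open[of _ _ _ "{0<..}"]) (use True in auto)
next
  case False
  then have z: "z < 0" using assms by simp
  have "((\<lambda>z. ln (- z)) has_real_derivative 1 / z) (at z)"
    using z by (auto intro!: derivative_eq_intros)
  then show ?thesis
    by (rule has_field_derivative_transform_within_open[of _ _ _ "{..<0}"]) (use z in auto)
qed

text \<open>Serves Cases 4 and 7. The identity \<open>k * \<beta> = k - 1\<close> is what both ODEs
  require of the exponent, and \<beta> avoids 0 and 1, where \<psi>'' would vanish.\<close>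

lemma alg_span2_power:
  assumes "k \<noteq> 0" "k \<noteq> 1" "c1 \<noteq> 0" "c2 \<noteq> 0" "\<sigma>0 * (k - 2) = 0" "\<beta> = 1 - 1 / k" "good_dom D" "D \<subseteq> domNZ"
  shows "alg_span2 D (\<lambda>t x. c2 * (x * \<bar>x\<bar> powr \<beta>)) (\<lambda>t x. c1 * \<bar>x\<bar> powr \<beta> + \<sigma>0 * t)
    (affine_vf 1 0 0 0 0 \<sigma>0) (affine_vf 0 1 k 0 (k - 1) 0)"
proof -
  have kb: "k * \<beta> = k - 1" using assms(1,6) by (simp add: field_simps)
  have b: "\<beta> \<noteq> 0" "\<beta> \<noteq> 1" using assms by auto
  have D: "D \<subseteq> domJ (- {0})" using assms(8) by (auto simp: domJ_def domNZ_def)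
  show ?thesis
  proof (rule alg_span2_stationary[OF _ assms(7) D _ _ assms(5), where d\<psi> = "\<lambda>x. c1 * (\<beta> * \<bar>x\<bar> powr \<beta> / x)"
        and d\<phi> = "\<lambda>x. c2 * ((1 + \<beta>) * \<bar>x\<bar> powr \<beta>)"
        and dd\<psi> = "\<lambda>x. c1 * (\<beta> * ((\<beta> - 1) * \<bar>x\<bar> powr \<beta> / x\<^sup>2))"])
    show "normal_form (- {0}) (\<lambda>x. c2 * (x * \<bar>x\<bar> powr \<beta>)) (\<lambda>x. c1 * \<bar>x\<bar> powr \<beta>)
      (\<lambda>x. c2 * ((1 + \<beta>) * \<bar>x\<bar> powr \<beta>)) (\<lambda>x. c1 * (\<beta> * \<bar>x\<bar> powr \<beta> / x))
      (\<lambda>x. c1 * (\<beta> * ((\<beta> - 1) * \<bar>x\<bar> powr \<beta> / x\<^sup>2))) 0 \<sigma>0"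
    proof
      fix y :: real assume "y \<in> - {0}"
      then have y: "y \<noteq> 0" by simp
      note d = DERIV_abs_powr[OF y, of \<beta>]
      show "((\<lambda>x. c2 * (x * \<bar>x\<bar> powr \<beta>)) has_real_derivative c2 * ((1 + \<beta>) * \<bar>y\<bar> powr \<beta>)) (at y)"
        using y by (intro DERIV_cmult DERIV_cong[OF DERIV_mult[OF DERIV_ident d]]) (simp add: field_simps)
      show "((\<lambda>x. c1 * \<bar>x\<bar> powr \<beta>) has_real_derivative c1 * (\<beta> * \<bar>y\<bar> powr \<beta> / y)) (at y)"
        by (rule DERIV_cmult[OF d])
      have "((\<lambda>x. \<bar>x\<bar> powr \<beta> / x) has_real_derivative (\<beta> - 1) * \<bar>y\<bar> powr \<beta> / y\<^sup>2) (at y)"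
        using y by (intro DERIV_cong[OF DERIV_divide[OF d DERIV_ident]])
          (simp_all add: field_simps power2_eq_square)
      from DERIV_cmult[OF DERIV_cmult[OF this, of \<beta>], of c1]
      show "((\<lambda>x. c1 * (\<beta> * \<bar>x\<bar> powr \<beta> / x)) has_real_derivative
        c1 * (\<beta> * ((\<beta> - 1) * \<bar>y\<bar> powr \<beta> / y\<^sup>2))) (at y)" by simp
      show "c2 * (y * \<bar>y\<bar> powr \<beta>) \<noteq> 0" "c1 * (\<beta> * ((\<beta> - 1) * \<bar>y\<bar> powr \<beta> / y\<^sup>2)) \<noteq> 0"
        using y b assms(3,4) by simp_all
    qed (simp_all add: open_Compl)
    fix y :: real assume "y \<in> - {0}"
    then have y: "y \<noteq> 0" by simp
    have "(k * y + 0) * (c1 * (\<beta> * \<bar>y\<bar> powr \<beta> / y)) = c1 * ((k * \<beta>) * \<bar>y\<bar> powr \<beta>)"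
      using y by (simp add: field_simps)
    then show "(k * y + 0) * (c1 * (\<beta> * \<bar>y\<bar> powr \<beta> / y)) = (k - 1) * (c1 * \<bar>y\<bar> powr \<beta>) + 0"
      unfolding kb by simp
    have "(k * y + 0) * (c2 * ((1 + \<beta>) * \<bar>y\<bar> powr \<beta>)) = (k + k * \<beta>) * (c2 * (y * \<bar>y\<bar> powr \<beta>))"
      by (simp add: algebra_simps)
    then show "(k * y + 0) * (c2 * ((1 + \<beta>) * \<bar>y\<bar> powr \<beta>)) = (2 * k - 1) * (c2 * (y * \<bar>y\<bar> powr \<beta>))"
      unfolding kb by simp
  qed
qed

lemma alg_span2_log:
  assumes "c2 \<noteq> 0" "good_dom D" "D \<subseteq> domNZ"
  shows "alg_span2 D (\<lambda>t x. c2 * x) (\<lambda>t x. ln \<bar>x\<bar>) (affine_vf 1 0 0 0 0 0) (affine_vf 0 1 1 0 0 1)"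
proof -
  have D: "D \<subseteq> domJ (- {0})" using assms(3) by (auto simp: domJ_def domNZ_def)
  have "normal_form (- {0}) (\<lambda>x. c2 * x) (\<lambda>x. ln \<bar>x\<bar>) (\<lambda>x. c2) (\<lambda>x. 1 / x) (\<lambda>x. - 1 / x\<^sup>2) 0 0"
    using assms(1)
    by unfold_locales (auto intro!: derivative_eq_intros DERIV_ln_abs simp: power2_eq_square open_Compl)
  from alg_span2_stationary[OF this assms(2) D, of 1 0 1] show ?thesis by simp
qed

lemma alg_span2_exp:
  assumes "c1 \<noteq> 0" "good_dom D"
  shows "alg_span2 D (\<lambda>t. exp) (\<lambda>t x. c1 * exp x) (affine_vf 1 0 0 0 0 0) (affine_vf 0 1 0 (- 1) (- 1) 0)"
proof -
  have "normal_form UNIV exp (\<lambda>x. c1 * exp x) exp (\<lambda>x. c1 * exp x) (\<lambda>x. c1 * exp x) 0 0"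
    using assms(1) by unfold_locales (auto intro!: derivative_eq_intros)
  from alg_span2_stationary[OF this assms(2), of 0 "-1" 0] show ?thesis by (simp add: domJ_def)
qed

text \<open>Witness that Cases 1 to 3 occur with a one-dimensional algebra. For constant \<phi> the
  second equation forces \<open>a = 2 p\<close>, and the differentiated \<psi>-equation makes
  \<open>(a + q + p y) exp y\<close> constant in \<open>y\<close>, which forces \<open>p = 0\<close>
  and thus \<open>a = 0\<close>.\<close>

lemma alg_span1_exp:
  assumes "\<sigma> * \<sigma>0 = 0"
  shows "alg_span1 UNIV (nfA2 \<sigma> (\<lambda>y. 1)) (nfA1 \<sigma> \<sigma>0 exp) (affine_vf 1 0 \<sigma> 0 \<sigma> \<sigma>0)"
proof -
  interpret normal_form UNIV "\<lambda>y. 1" exp "\<lambda>y. 0" exp exp \<sigma> \<sigma>0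
    using assms by unfold_locales (auto intro!: derivative_eq_intros)
  have D: "good_dom UNIV" "UNIV \<subseteq> nf_dom \<sigma> UNIV" by (simp_all add: good_dom_def nf_dom_def)
  have "deriv \<tau> t = 0" if data: "sym_data UNIV Q \<tau> \<rho> s1 s0" for Q \<tau> \<rho> s1 s0 t
  proof -
    define a p q e l where "a = deriv \<tau> t" "p = deriv \<tau> t + s1 - \<sigma> * \<tau> t" "q = \<rho> t * exp (- \<sigma> * t)"
       "e = deriv (deriv \<tau>) t" "l = exp (- \<sigma> * t) * (s0 - deriv \<rho> t - \<sigma>0 * \<tau> t + s1 * \<sigma>0 * t)"
    note defs = this
    have c: "comp_eqs a p q e l y" for y
    proof -
      have "comp_eqs a p q e l ((y * exp (\<sigma> * t)) * exp (- \<sigma> * t))"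
        using data unfolding sym_data_def defs by blast
      then show ?thesis by (simp add: mult.assoc flip: exp_add)
    qed
    have a: "a = 2 * p" using c[of 0] by (simp add: comp_eqs_def)
    have eq: "a * exp y + (p * y + q) * exp y = - e" for y
      by (rule comp_eqs_deriv[of "y - 1" "y + 1", OF _ c]) auto
    \<comment> \<open>The values at \<open>y = 0, 1, -1\<close> give \<open>b = - e\<close>,
      \<open>(b + p) * exp 1 = b\<close> and \<open>b - p = b * exp 1\<close>; eliminating
      \<open>p\<close> leaves \<open>b * (exp 1 - 1)^2 = 0\<close>.\<close>
    define b where "b = a + q"
    have b0: "b = - e" using eq[of 0] by (simp add: b_def)
    have "(b + p) * exp 1 = a * exp 1 + (p * 1 + q) * exp 1" by (simp add: b_def algebra_simps)
    then have b1: "(b + p) * exp 1 = b" unfolding eq b0 .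
    have "(b - p) * exp (- 1) = a * exp (- 1) + (p * (- 1) + q) * exp (- 1)" by (simp add: b_def algebra_simps)
    then have "(b - p) * exp (- 1) = b" unfolding eq b0 .
    then have b2: "b - p = b * exp 1" by (simp add: exp_minus field_simps)
    have "b * (exp 1 - 1)\<^sup>2 = b * exp 1 * exp 1 - 2 * b * exp 1 + b"
      by (simp add: power2_eq_square algebra_simps)
    also have "\<dots> = (b - p) * exp 1 - 2 * b * exp 1 + (b + p) * exp 1" unfolding b1 b2 ..
    also have "\<dots> = 0" by (simp add: algebra_simps)
    finally have "b = 0" by simp
    then have "p = 0" using b2 by simp
    then show ?thesis using a by (simp add: defs)
  qed
  then show ?thesis using span1_or_second_symmetry[OF D] by blast
qed

section \<open>An equation with zero algebra\<close>

lemma pd2_poly_product: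
  "\<exists>P R. pd2 bs (\<lambda>t x. poly p t * poly r x) = (\<lambda>t x. poly P t * poly R x)"
proof (induction bs)
  case (Cons b bs)
  then obtain P R where *: "pd2 bs (\<lambda>t x. poly p t * poly r x) = (\<lambda>t x. poly P t * poly R x)" by blast
  have "pdt (\<lambda>t x. poly P t * poly R x) = (\<lambda>t x. poly (pderiv P) t * poly R x)"
    "pdx (\<lambda>t x. poly P t * poly R x) = (\<lambda>t x. poly P t * poly (pderiv R) x)"
    unfolding pdt_def pdx_def
    by (intro ext DERIV_imp_deriv; auto intro!: derivative_eq_intros poly_DERIV)+
  then show ?case using * by (cases b) auto
qed auto

text \<open>\<open>smooth2\<close> quantifies over all mixed partial derivatives; products of a
  polynomial in \<open>t\<close> and one in \<open>x\<close> are closed under both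
  differentiations.\<close>

lemma smooth2_poly_product: "smooth2 W (\<lambda>t x. poly p t * poly r x)"
  unfolding smooth2_def
proof (intro allI conjI impI)
  fix bs t x
  obtain P R where *: "pd2 bs (\<lambda>t x. poly p t * poly r x) = (\<lambda>t x. poly P t * poly R x)"
    using pd2_poly_product by blast
  show "continuous_on W (\<lambda>z. pd2 bs (\<lambda>t x. poly p t * poly r x) (fst z) (snd z))"
    unfolding * by (intro continuous_intros)
  show "(\<lambda>s. pd2 bs (\<lambda>t x. poly p t * poly r x) s x) differentiable at t"
    "(\<lambda>y. pd2 bs (\<lambda>t x. poly p t * poly r x) t y) differentiable at x"
    unfolding * using poly_DERIV real_differentiable_def by (metis DERIV_cmult DERIV_cmult_right)+
qed

lemma exists_zero_algebra: "\<exists>\<Omega> A2 A1. in_class \<Omega> A2 A1 \<and> alg_zero \<Omega> A2 A1"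
proof -
  \<comment> \<open>The factor \<open>1 + t^2\<close> has no zero, which keeps \<open>A1_xx\<close>
    nonzero, and its dependence on \<open>t\<close> excludes time translations.\<close>
  define A2 A1 :: "real \<Rightarrow> real \<Rightarrow> real" where "A2 = (\<lambda>t x. 1)" and "A1 = (\<lambda>t x. (1 + t\<^sup>2) * x\<^sup>2)"
  have pA2: "pdt A2 t x = 0" "pdx A2 t x = 0" for t x by (simp_all add: pdt_def pdx_def A2_def)
  have pA1: "pdt A1 t x = 2 * t * x\<^sup>2" for t x unfolding pdt_def A1_def
    by (rule DERIV_imp_deriv) (auto intro!: derivative_eq_intros)
  have pA1x: "pdx A1 = (\<lambda>t x. (1 + t\<^sup>2) * (2 * x))" unfolding pdx_def A1_def
    by (intro ext DERIV_imp_deriv) (auto intro!: derivative_eq_intros)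
  have pA1xx: "pdx (pdx A1) t x = (1 + t\<^sup>2) * 2" for t x
    unfolding pA1x unfolding pdx_def
    by (rule DERIV_imp_deriv) (auto intro!: derivative_eq_intros)
  have nz: "(1 + t\<^sup>2) \<noteq> (0 :: real)" for t by (metis add_nonneg_pos less_numeral_extra(1,3) add.commute zero_le_power2)
  have "smooth2 UNIV A2" "smooth2 UNIV A1"
    using smooth2_poly_product[of UNIV 1 1] smooth2_poly_product[of UNIV "[:1, 0, 1:]" "[:0, 0, 1:]"]
    by (simp_all add: A2_def A1_def power2_eq_square)
  then have "in_class UNIV A2 A1" using nz convex_connected[OF convex_UNIV]
    by (simp add: in_class_def pA1xx del: distrib_right_numeral) (simp add: A2_def)
  moreover have "alg_zero UNIV A2 A1" unfolding alg_zero_def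
  proof (intro allI iffI)
    fix Q assume "is_sym UNIV A2 A1 Q"
    then show "vf_agree UNIV Q vzero"
    proof (rule determining_equations[rotated 2])
      show "pdx (pdx A1) t x \<noteq> 0" for t x using nz[of t] unfolding pA1xx by simp
      fix \<tau> \<rho> s1 s0
      assume s: "smooth1 (fst ` UNIV) \<tau>" "smooth1 (fst ` UNIV) \<rho>" and
       Q: "\<And>t x u. (t, x) \<in> UNIV \<Longrightarrow> vtau Q t x u = \<tau> t"
        "\<And>t x u. (t, x) \<in> UNIV \<Longrightarrow> vxi Q t x u = (deriv \<tau> t + s1) * x + \<rho> t"
        "\<And>t x u. (t, x) \<in> UNIV \<Longrightarrow> veta Q t x u = s1 * u + s0"
       and e2: "\<And>t x. (t, x) \<in> UNIV \<Longrightarrow> \<tau> t * pdt A2 t x + ((deriv \<tau> t + s1) * x + \<rho> t) * pdx A2 t x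
        = (deriv \<tau> t + 2 * s1) * A2 t x"
       and e1: "\<And>t x. (t, x) \<in> UNIV \<Longrightarrow> \<tau> t * pdt A1 t x + ((deriv \<tau> t + s1) * x + \<rho> t) * pdx A1 t x
        = s1 * A1 t x + s0 - deriv (deriv \<tau>) t * x - deriv \<rho> t"
      have d: "deriv \<tau> t = - 2 * s1" for t using e2[of t 0] unfolding pA2 by (simp add: A2_def)
      then have dd: "deriv (deriv \<tau>) t = 0" for t using deriv_zero_on_open[of UNIV t "deriv \<tau>"] by simp
      note e1' = e1[OF UNIV_I, unfolded pA1 pA1x, unfolded A1_def d dd]
      \<comment> \<open>Coefficient of \<open>x^2\<close> in the condition on \<open>A1\<close>,
        isolated by the values at 0, 1 and -1. At \<open>t = 0\<close> it gives
        \<open>s1 = 0\<close>; then \<tau> is constant, and \<open>t = 1\<close> shows that it is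
        zero.\<close>
      have quad: "2 * t * \<tau> t = 3 * s1 * (1 + t\<^sup>2)" for t
        using e1'[of t 0] e1'[of t 1] e1'[of t "-1"] by (simp add: algebra_simps)
      have s1: "s1 = 0" using quad[of 0] by simp
      have "\<rho> t * (1 + t\<^sup>2) = 0" for t
        using e1'[of t 1] e1'[of t "-1"] by (simp add: s1 algebra_simps)
      then have \<rho>: "\<rho> t = 0" for t using nz by (metis mult_eq_0_iff)
      have "\<exists>c. \<forall>t\<in>UNIV. \<tau> t = c"
        by (rule interval_constant) (use smooth1_DERIV[OF s(1)] d s1 in auto)
      then obtain c where c: "\<And>t. \<tau> t = c" by auto
      have \<tau>: "\<tau> t = 0" for t using quad[of 1] c s1 by simp
      have "\<rho> = (\<lambda>t. 0)" using \<rho> by auto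
      then have "s0 = 0" using e1'[of 0 0] by simp
      then show ?thesis using Q by (simp add: vf_agree_def basis_fields_affine d s1 \<rho> \<tau>)
    qed (auto simp: A2_def)
  next
    fix Q assume "vf_agree UNIV Q vzero"
    moreover have "is_sym UNIV A2 A1 vzero"
      unfolding basis_fields_affine by (rule is_sym_affine_vf) auto
    ultimately show "is_sym UNIV A2 A1 Q" by (rule is_sym_cong[OF open_UNIV])
  qed
  ultimately show ?thesis by blast
qed

section \<open>Equations with two symmetries\<close>

text \<open>\<open>|y + c| powr (- \<beta>)\<close> is an integrating factor on either side of the
  singular point.\<close>

lemma linear_ode_power:
  fixes f f' :: "real \<Rightarrow> real"
  assumes "\<And>y. y \<in> {u<..<v} \<Longrightarrow> (f has_real_derivative f' y) (at y)"
    and "\<And>y. y \<in> {u<..<v} \<Longrightarrow> y + c \<noteq> 0"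
    and "\<And>y. y \<in> {u<..<v} \<Longrightarrow> (y + c) * f' y = \<beta> * f y"
  shows "\<exists>C. \<forall>y\<in>{u<..<v}. f y = C * \<bar>y + c\<bar> powr \<beta>"
proof -
  have "((\<lambda>y. f y * \<bar>y + c\<bar> powr (- \<beta>)) has_real_derivative 0) (at y)" if y: "y \<in> {u<..<v}" for y
  proof -
    have "((\<lambda>y. \<bar>y + c\<bar> powr (- \<beta>)) has_real_derivative (- \<beta>) * \<bar>y + c\<bar> powr (- \<beta>) / (y + c) * 1) (at y)"
      by (rule DERIV_chain2[of "\<lambda>z. \<bar>z\<bar> powr (- \<beta>)" _ "\<lambda>y. y + c" y, OF DERIV_abs_powr[OF assms(2)[OF y]]])
        (auto intro!: derivative_eq_intros)
    from DERIV_mult[OF assms(1)[OF y] this]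
    show ?thesis
    proof (rule DERIV_cong)
      have "f' y = \<beta> * f y / (y + c)" using assms(2,3)[OF y] by (simp add: field_simps)
      then show "f' y * \<bar>y + c\<bar> powr - \<beta> + - \<beta> * \<bar>y + c\<bar> powr - \<beta> / (y + c) * 1 * f y = 0"
        by simp
    qed
  qed
  then obtain C where C: "\<And>y. y \<in> {u<..<v} \<Longrightarrow> f y * \<bar>y + c\<bar> powr (- \<beta>) = C"
    using interval_constant[of "{u<..<v}" "\<lambda>y. f y * \<bar>y + c\<bar> powr (- \<beta>)"] by auto
  have "f y = C * \<bar>y + c\<bar> powr \<beta>" if "y \<in> {u<..<v}" for y
    using C[OF that] assms(2)[OF that] by (auto simp: powr_minus field_simps)
  then show ?thesis by blast
qed

lemma linear_ode_exp:
  fixes f f' :: "real \<Rightarrow> real"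
  assumes "n \<noteq> 0" "\<And>y. y \<in> {u<..<v} \<Longrightarrow> (f has_real_derivative f' y) (at y)"
    and "\<And>y. y \<in> {u<..<v} \<Longrightarrow> n * f' y = - f y"
  shows "\<exists>C. \<forall>y\<in>{u<..<v}. f y = C * exp (- y / n)"
proof -
  have "((\<lambda>y. f y * exp (y / n)) has_real_derivative 0) (at y)" if y: "y \<in> {u<..<v}" for y
  proof -
    have "((\<lambda>y. exp (y / n)) has_real_derivative exp (y / n) / n) (at y)"
      using assms(1) by (auto intro!: derivative_eq_intros)
    from DERIV_mult[OF assms(2)[OF y] this]
    show ?thesis
    proof (rule DERIV_cong)
      have "f' y = - f y / n" using assms(1) assms(3)[OF y] by (simp add: field_simps)
      then show "f' y * exp (y / n) + exp (y / n) / n * f y = 0" by simp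
    qed
  qed
  then obtain C where C: "\<And>y. y \<in> {u<..<v} \<Longrightarrow> f y * exp (y / n) = C"
    using interval_constant[of "{u<..<v}" "\<lambda>y. f y * exp (y / n)"] by auto
  have "f y = C * exp (- y / n)" if "y \<in> {u<..<v}" for y
    using C[OF that] by (auto simp: exp_minus field_simps)
  then show ?thesis by blast
qed

lemma linear_ode_log:
  fixes f f' :: "real \<Rightarrow> real"
  assumes "\<And>y. y \<in> {u<..<v} \<Longrightarrow> (f has_real_derivative f' y) (at y)"
    and "\<And>y. y \<in> {u<..<v} \<Longrightarrow> y + c \<noteq> 0"
    and "\<And>y. y \<in> {u<..<v} \<Longrightarrow> (y + c) * f' y = b"
  shows "\<exists>C. \<forall>y\<in>{u<..<v}. f y = b * ln \<bar>y + c\<bar> + C"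
proof -
  have "((\<lambda>y. f y - b * ln \<bar>y + c\<bar>) has_real_derivative 0) (at y)" if y: "y \<in> {u<..<v}" for y
  proof -
    have "((\<lambda>y. ln \<bar>y + c\<bar>) has_real_derivative 1 / (y + c) * 1) (at y)"
      by (rule DERIV_chain2[of "\<lambda>z. ln \<bar>z\<bar>" _ "\<lambda>y. y + c" y, OF DERIV_ln_abs[OF assms(2)[OF y]]])
        (auto intro!: derivative_eq_intros)
    from DERIV_diff[OF assms(1)[OF y] DERIV_cmult[OF this, of b]]
    show ?thesis
      by (rule DERIV_cong) (use assms(2,3)[OF y] in \<open>simp add: field_simps\<close>)
  qed
  then obtain C where C: "\<And>y. y \<in> {u<..<v} \<Longrightarrow> f y - b * ln \<bar>y + c\<bar> = C"
    using interval_constant[of "{u<..<v}" "\<lambda>y. f y - b * ln \<bar>y + c\<bar>"] by auto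
  have "f y = b * ln \<bar>y + c\<bar> + C" if "y \<in> {u<..<v}" for y using C[OF that] by simp
  then show ?thesis by blast
qed

text \<open>An antiderivative of \<open>\<kappa> exp (- m t)\<close>. For
  \<open>m \<noteq> 0\<close> the constant of integration makes it a multiple of
  \<open>exp (- m t)\<close>, which is what the summand \<open>t\<close> of Case 7 has to
  match.\<close>

definition exp_time :: "real \<Rightarrow> real \<Rightarrow> real \<Rightarrow> real" where
  "exp_time \<kappa> m t = (if m = 0 then \<kappa> * t else - \<kappa> / m * exp (- m * t))"

lemma DERIV_exp_time: "(exp_time \<kappa> m has_real_derivative \<kappa> * exp (- m * t)) (at t)"
proof (cases "m = 0")
  case True
  then show ?thesis unfolding exp_time_def[abs_def] by (auto intro!: derivative_eq_intros)
next
  case False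
  then show ?thesis unfolding exp_time_def[abs_def] by (auto intro!: derivative_eq_intros)
qed

lemma deriv_exp_time: "deriv (exp_time \<kappa> m) = (\<lambda>t. \<kappa> * exp (- m * t))"
  by (rule ext, rule DERIV_imp_deriv, rule DERIV_exp_time)

lemma deriv_scaled_exp: "deriv (\<lambda>t. c * exp (- m * t)) t = - m * c * exp (- m * t)"
  by (rule DERIV_imp_deriv) (auto intro!: derivative_eq_intros)

lemma smooth1_scaled_exp: "open J \<Longrightarrow> smooth1 J (\<lambda>t. c * exp (- m * t))"
  by (intro smooth1_intros)

lemma smooth1_exp_time: "open J \<Longrightarrow> smooth1 J (exp_time \<kappa> m)"
  by (rule smooth1_stepI[OF _ DERIV_exp_time smooth1_scaled_exp])

section \<open>Constants of a second symmetry and reduction to Cases 4 to 7\<close>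

context normal_form
begin

text \<open>Proportionality holds at all times near \<open>t1\<close> with the constants taken at
  \<open>t1\<close>. The two final relations are the t-derivatives of \<open>p = k \<tau>'\<close>
  and of \<open>l = L \<tau>'\<close>, the latter after \<open>q = n \<tau>'\<close> has eliminated
  \<rho>'.\<close>

lemma second_symmetry_constants:
  assumes D: "good_dom D" "D \<subseteq> nf_dom \<sigma> J" and data: "sym_data D Q \<tau> \<rho> s1 s0"
    and t1: "t1 \<in> fst ` D" and nz: "deriv \<tau> t1 \<noteq> 0"
  obtains x1 r k n m L where "(t1, x1) \<in> D" "r > 0"
    "{x1 * exp (- \<sigma> * t1) - r<..<x1 * exp (- \<sigma> * t1) + r} \<subseteq> J"
    "\<And>y. y \<in> {x1 * exp (- \<sigma> * t1) - r<..<x1 * exp (- \<sigma> * t1) + r} \<Longrightarrow> comp_eqs 1 k n m L y"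
    "k * m = m - \<sigma>" "(m + \<sigma>) * (L + n * (m + \<sigma>)) = \<sigma>0 * (k - 2)"
proof -
  have oD: "open D" using D(1) by (auto simp: good_dom_def)
  obtain x1 where tx: "(t1, x1) \<in> D" using t1 by auto
  define y1 where "y1 = x1 * exp (- \<sigma> * t1)"
  define p where "p t = deriv \<tau> t + s1 - \<sigma> * \<tau> t" for t
  define q where "q t = \<rho> t * exp (- \<sigma> * t)" for t
  define l where "l t = exp (- \<sigma> * t) * (s0 - deriv \<rho> t - \<sigma>0 * \<tau> t + s1 * \<sigma>0 * t)" for t
  obtain r where r: "r > 0" "{t1 - r<..<t1 + r} \<subseteq> fst ` D" "{y1 - r<..<y1 + r} \<subseteq> J"
    and ce: "\<And>t y. t \<in> {t1 - r<..<t1 + r} \<Longrightarrow> y \<in> {y1 - r<..<y1 + r} \<Longrightarrow>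
      comp_eqs (deriv \<tau> t) (p t) (q t) (deriv (deriv \<tau>) t) (l t) y"
    unfolding p_def q_def l_def y1_def using sym_data_box[OF oD D(2) data tx] by metis
  let ?U = "{t1 - r<..<t1 + r}"
  have U: "t1 \<in> ?U" "open ?U" using r(1) by auto
  define a0 where "a0 = deriv \<tau> t1"
  have a0: "a0 \<noteq> 0" using nz by (simp add: a0_def)
  define k n m L where "k = p t1 / a0" "n = q t1 / a0" "m = deriv (deriv \<tau>) t1 / a0" "L = l t1 / a0"
  note kn = this
  have base: "comp_eqs 1 k n m L y" if "y \<in> {y1 - r<..<y1 + r}" for y
  proof -
    \<comment> \<open>Subtracting \<open>- 1 / a0\<close> times the vector at \<open>t1\<close> from
      the zero vector normalises its first entry to 1.\<close>
    have "comp_eqs 0 0 0 0 0 y" by (simp add: comp_eqs_def)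
    from comp_eqs_diff[OF this ce[OF U(1) that], of "- 1 / a0"]
    show ?thesis using a0 by (simp add: kn flip: a0_def)
  qed
  have pr: "p t = deriv \<tau> t * k" "q t = deriv \<tau> t * n" "deriv (deriv \<tau>) t = deriv \<tau> t * m" "l t = deriv \<tau> t * L"
    if t: "t \<in> ?U" for t
    using comp_eqs_proportional[OF r(1,3) ce[OF t] base] by auto
  have sm: "smooth1 (fst ` D) \<tau>" "smooth1 (fst ` D) \<rho>" using data by (auto simp: sym_data_def)
  have d\<tau>: "(\<tau> has_real_derivative deriv \<tau> t) (at t)"
    "(deriv \<tau> has_real_derivative deriv \<tau> t * m) (at t)"
    "(\<rho> has_real_derivative deriv \<rho> t) (at t)" if t: "t \<in> ?U" for t
    using smooth1_DERIV[OF sm(1), of t] smooth1_DERIV[OF smooth1_deriv[OF sm(1)], of t]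
      smooth1_DERIV[OF sm(2), of t] subsetD[OF r(2) t] pr(3)[OF t] by simp_all
  have km: "k * m = m - \<sigma>"
  proof -
    \<comment> \<open>The derivative of \<open>p\<close> is
      \<open>\<tau>'' - \<sigma> \<tau>'\<close> by definition and \<open>k \<tau>''\<close> by
      proportionality, with \<open>\<tau>'' = m \<tau>'\<close>.\<close>
    have "(p has_real_derivative deriv \<tau> t1 * m - \<sigma> * deriv \<tau> t1) (at t1)"
      unfolding p_def by (auto intro!: derivative_eq_intros d\<tau>[OF U(1)])
    moreover have "(p has_real_derivative deriv \<tau> t1 * m * k) (at t1)"
    proof (rule has_field_derivative_transform_within_open[OF _ U(2,1)])
      show "((\<lambda>t. deriv \<tau> t * k) has_real_derivative deriv \<tau> t1 * m * k) (at t1)"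
        by (auto intro!: derivative_eq_intros d\<tau>(2)[OF U(1)])
    qed (simp add: pr)
    ultimately have "deriv \<tau> t1 * m - \<sigma> * deriv \<tau> t1 = deriv \<tau> t1 * m * k" by (rule DERIV_unique)
    then have "a0 * (k * m) = a0 * (m - \<sigma>)" by (simp add: a0_def algebra_simps)
    then show ?thesis using a0 by simp
  qed
  have \<rho>': "deriv \<rho> t * exp (- \<sigma> * t) = deriv \<tau> t * (n * (m + \<sigma>))" if t: "t \<in> ?U" for t
  proof -
    have "(q has_real_derivative deriv \<rho> t * exp (- \<sigma> * t) - \<sigma> * (\<rho> t * exp (- \<sigma> * t))) (at t)"
      unfolding q_def by (auto intro!: derivative_eq_intros d\<tau>[OF t])
    moreover have "(q has_real_derivative deriv \<tau> t * m * n) (at t)"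
    proof (rule has_field_derivative_transform_within_open[OF _ U(2) t])
      show "((\<lambda>t. deriv \<tau> t * n) has_real_derivative deriv \<tau> t * m * n) (at t)"
        by (auto intro!: derivative_eq_intros d\<tau>(2)[OF t])
    qed (simp add: pr)
    ultimately have "deriv \<rho> t * exp (- \<sigma> * t) - \<sigma> * (\<rho> t * exp (- \<sigma> * t)) = deriv \<tau> t * m * n"
      by (rule DERIV_unique)
    then show ?thesis using pr(2)[OF t] by (simp add: q_def algebra_simps)
  qed
  define N where "N = L + n * (m + \<sigma>)"
  \<comment> \<open>With \<rho>' moved to the right as a multiple of \<tau>', the left side can be
    differentiated once more without meeting a second derivative of \<rho>.\<close>
  have G: "exp (- \<sigma> * t) * (s0 - \<sigma>0 * \<tau> t + s1 * \<sigma>0 * t) = deriv \<tau> t * N" if t: "t \<in> ?U" for t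
  proof -
    have "exp (- \<sigma> * t) * (s0 - \<sigma>0 * \<tau> t + s1 * \<sigma>0 * t) = l t + deriv \<rho> t * exp (- \<sigma> * t)"
      by (simp add: l_def algebra_simps)
    then show ?thesis unfolding \<rho>'[OF t] pr(4)[OF t] N_def by (simp add: algebra_simps)
  qed
  have e\<sigma>: "exp (- \<sigma> * t1) * \<sigma>0 = \<sigma>0" using \<sigma>\<sigma>0 by auto
  \<comment> \<open>If \<open>\<sigma>0\<close> is nonzero then \<open>\<sigma> = 0\<close>, and
    \<open>p = k \<tau>'\<close> at \<open>t1\<close> reads
    \<open>s1 = a0 * (k - 1)\<close>.\<close>
  have s1: "\<sigma>0 * s1 = \<sigma>0 * (a0 * (k - 1))"
  proof -
    have "\<sigma>0 * (a0 + s1 - \<sigma> * \<tau> t1) = \<sigma>0 * (a0 * k)" using pr(1)[OF U(1)] by (simp add: p_def a0_def)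
    moreover have "\<sigma>0 * (\<sigma> * \<tau> t1) = 0" using \<sigma>\<sigma>0 by auto
    ultimately show ?thesis by (simp add: algebra_simps)
  qed
  have N: "(m + \<sigma>) * N = \<sigma>0 * (k - 2)"
  proof -
    let ?g = "\<lambda>t. exp (- \<sigma> * t) * (s0 - \<sigma>0 * \<tau> t + s1 * \<sigma>0 * t)"
    have "(?g has_real_derivative (- \<sigma>) * ?g t1 + exp (- \<sigma> * t1) * (s1 * \<sigma>0 - \<sigma>0 * deriv \<tau> t1)) (at t1)"
      by (auto intro!: derivative_eq_intros d\<tau>[OF U(1)] simp: algebra_simps)
    moreover have "(?g has_real_derivative deriv \<tau> t1 * m * N) (at t1)"
    proof (rule has_field_derivative_transform_within_open[OF _ U(2,1)])
      show "((\<lambda>t. deriv \<tau> t * N) has_real_derivative deriv \<tau> t1 * m * N) (at t1)"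
        by (auto intro!: derivative_eq_intros d\<tau>(2)[OF U(1)])
    qed (rule G[symmetric])
    ultimately have "(- \<sigma>) * ?g t1 + exp (- \<sigma> * t1) * (s1 * \<sigma>0 - \<sigma>0 * deriv \<tau> t1) = deriv \<tau> t1 * m * N"
      by (rule DERIV_unique)
    then have "(- \<sigma>) * (a0 * N) + (exp (- \<sigma> * t1) * \<sigma>0) * (s1 - a0) = a0 * m * N"
      unfolding G[OF U(1)] by (simp add: a0_def algebra_simps)
    then have "(- \<sigma>) * (a0 * N) + (\<sigma>0 * s1 - \<sigma>0 * a0) = a0 * m * N"
      unfolding e\<sigma> by (simp add: algebra_simps)
    then have "a0 * ((m + \<sigma>) * N) = a0 * (\<sigma>0 * (k - 2))"
      unfolding s1 by (simp add: algebra_simps)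
    then show ?thesis using a0 by simp
  qed
  show ?thesis
    by (rule that[OF tx r(1) r(3)[unfolded y1_def] base[unfolded y1_def] km N[unfolded N_def]])
qed

text \<open>A zero of the component would annihilate the whole vector, whose first entry is
  1.\<close>

lemma comp_eqs_component_nonzero:
  assumes S: "{u<..<v} \<subseteq> J" and ce: "\<And>y. y \<in> {u<..<v} \<Longrightarrow> comp_eqs 1 k n m L y" and y: "y \<in> {u<..<v}"
  shows "k * y + n \<noteq> 0"
proof
  assume z: "k * y + n = 0"
  define r where "r = min (y - u) (v - y)"
  have r: "{y - r<..<y + r} \<subseteq> {u<..<v}" by (auto simp: r_def)
  have "r > 0" using y by (simp add: r_def)
  then have "(1 :: real) = 0 \<and> k = 0 \<and> n = 0 \<and> m = 0 \<and> L = 0"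
    by (rule comp_eqs_unique[OF _ subset_trans[OF r S] ce[OF subsetD[OF r]] z])
  then show False by simp
qed

text \<open>Used to show that the amplitude \<open>d\<close> in the following reductions is nonzero:
  for \<open>d = 0\<close> the solution \<psi> would be affine.\<close>

lemma \<psi>_not_affine:
  assumes S: "{u<..<v} \<subseteq> J" "u < v" and aff: "\<And>y. y \<in> {u<..<v} \<Longrightarrow> \<psi> y = a * y + b"
  shows False
proof -
  obtain y where y: "y \<in> {u<..<v}" using dense[OF S(2)] by auto
  have da: "d\<psi> y = a" if "y \<in> {u<..<v}" for y
  proof -
    have "((\<lambda>y. a * y + b) has_real_derivative d\<psi> y) (at y)"
      by (rule has_field_derivative_transform_within_open[OF d\<psi>[OF subsetD[OF S(1) that]] open_greaterThanLessThan that])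
        (rule aff)
    moreover have "((\<lambda>y. a * y + b) has_real_derivative a) (at y)"
      by (auto intro!: derivative_eq_intros)
    ultimately show ?thesis by (rule DERIV_unique)
  qed
  have "((\<lambda>y. a) has_real_derivative dd\<psi> y) (at y)"
    by (rule has_field_derivative_transform_within_open[OF dd\<psi>[OF subsetD[OF S(1) y]] open_greaterThanLessThan y])
      (rule da)
  then have "dd\<psi> y = 0" using DERIV_unique DERIV_const by blast
  then show False using dd\<psi>_nz[OF subsetD[OF S(1) y]] by simp
qed

text \<open>The solutions are singular at \<open>y = - n / k\<close>; with
  \<open>T' = \<kappa> exp (- m t)\<close> the shift
  \<open>X0 = \<kappa> U1 (n / k) exp (- k m t)\<close> moves this point to \<open>w = 0\<close>.
  The parameters \<kappa>, \<open>U1\<close>, \<open>U0\<close> stay free, because the treatment of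
  the leftover \<open>U1 * (exp (\<sigma> t) h + \<sigma>0 t) + U0\<close> differs between Cases 4
  and 7.\<close>

lemma power_reduction:
  assumes S: "{u<..<v} \<subseteq> J" "u < v" and ce: "\<And>y. y \<in> {u<..<v} \<Longrightarrow> comp_eqs 1 k n m L y"
    and km: "k * m = m - \<sigma>" and k: "k \<noteq> 0" "k \<noteq> 1"
  defines "\<beta> \<equiv> (k - 1) / k"
  obtains c2 d h where "c2 \<noteq> 0" "d \<noteq> 0" "(k - 1) * h = - (L + n * (m + \<sigma>))"
    "\<And>\<kappa> U1 U0 t x w. \<kappa> \<noteq> 0 \<Longrightarrow> U1 \<noteq> 0 \<Longrightarrow> x * exp (- \<sigma> * t) \<in> {u<..<v} \<Longrightarrow>
      w = \<kappa> * exp (- m * t) * U1 * x + \<kappa> * U1 * (n / k) * exp (- (k * m) * t) \<Longrightarrow>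
      w \<noteq> 0 \<and> \<kappa> * exp (- m * t) * U1\<^sup>2 * nfA2 \<sigma> \<phi> t x = U1 * c2 / \<bar>\<kappa> * U1\<bar> powr \<beta> * (w * \<bar>w\<bar> powr \<beta>) \<and>
      U1 * nfA1 \<sigma> \<sigma>0 \<psi> t x + U0 - (- m * \<kappa> * exp (- m * t) * U1 * x
          + - (k * m) * (\<kappa> * U1 * (n / k)) * exp (- (k * m) * t)) / (\<kappa> * exp (- m * t))
        = U1 * d / \<bar>\<kappa> * U1\<bar> powr \<beta> * \<bar>w\<bar> powr \<beta> + U1 * (exp (\<sigma> * t) * h + \<sigma>0 * t) + U0"
proof -
  define c where "c = n / k"
  have n: "n = k * c" using k by (simp add: c_def)
  have z: "y + c \<noteq> 0" if "y \<in> {u<..<v}" for y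
  proof
    assume "y + c = 0"
    then have "k * (y + c) = 0" by simp
    then show False using comp_eqs_component_nonzero[OF S(1) ce that] n by (simp add: algebra_simps)
  qed
  have k\<beta>: "k * \<beta> = k - 1" using k by (simp add: \<beta>_def)
  have ode\<phi>: "(y + c) * d\<phi> y = (1 + \<beta>) * \<phi> y"
    and ode\<psi>: "k * ((y + c) * d\<psi> y) = (k - 1) * \<psi> y + L - m * y" if "y \<in> {u<..<v}" for y
  proof -
    have "k * ((y + c) * d\<phi> y) = (k * y + n) * d\<phi> y" by (simp add: n algebra_simps)
    also have "\<dots> = (k + k * \<beta>) * \<phi> y" using ce[OF that] by (simp add: comp_eqs_def k\<beta>)
    finally have "k * ((y + c) * d\<phi> y) = k * ((1 + \<beta>) * \<phi> y)" by (simp add: algebra_simps)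
    then show "(y + c) * d\<phi> y = (1 + \<beta>) * \<phi> y" using k(1) by simp
    have "k * ((y + c) * d\<psi> y) = (k * y + n) * d\<psi> y" by (simp add: n algebra_simps)
    also have "\<dots> = (k - 1) * \<psi> y + L - m * y" using ce[OF that] by (simp add: comp_eqs_def)
    finally show "k * ((y + c) * d\<psi> y) = (k - 1) * \<psi> y + L - m * y" .
  qed
  \<comment> \<open>The quotient obeys the ODE with exponent \<beta> instead of
    \<open>1 + \<beta>\<close>, which produces the signed form
    \<open>(y + c) * |y + c| powr \<beta>\<close> of the list.\<close>
  have "\<exists>C. \<forall>y\<in>{u<..<v}. \<phi> y / (y + c) = C * \<bar>y + c\<bar> powr \<beta>"
  proof (rule linear_ode_power)
    fix y assume y: "y \<in> {u<..<v}"
    show "((\<lambda>y. \<phi> y / (y + c)) has_real_derivative (d\<phi> y * (y + c) - \<phi> y * 1) / ((y + c) * (y + c))) (at y)"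
      by (rule DERIV_divide[OF d\<phi>[OF subsetD[OF S(1) y]]]) (auto intro!: derivative_eq_intros z[OF y])
    have "(y + c) * d\<phi> y - \<phi> y = \<beta> * \<phi> y" using ode\<phi>[OF y] by (simp add: algebra_simps)
    then show "(y + c) * ((d\<phi> y * (y + c) - \<phi> y * 1) / ((y + c) * (y + c))) = \<beta> * (\<phi> y / (y + c))"
      using z[OF y] by (simp add: mult.commute)
  qed (rule z)
  then obtain c2 where c2: "\<And>y. y \<in> {u<..<v} \<Longrightarrow> \<phi> y / (y + c) = c2 * \<bar>y + c\<bar> powr \<beta>" by blast
  have \<phi>: "\<phi> y = c2 * ((y + c) * \<bar>y + c\<bar> powr \<beta>)" if "y \<in> {u<..<v}" for y
  proof -
    have "\<phi> y = (y + c) * (\<phi> y / (y + c))" using z[OF that] by simp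
    then show ?thesis unfolding c2[OF that] by (simp only: mult_ac)
  qed
  \<comment> \<open>Chosen so that \<open>c' - m * (y + c)\<close> is a particular solution of the
    \<psi>-equation.\<close>
  define c' where "c' = - (L + m * c) / (k - 1)"
  have c': "(k - 1) * c' = - (L + m * c)" using k by (simp add: c'_def)
  have "\<exists>C. \<forall>y\<in>{u<..<v}. \<psi> y + m * (y + c) - c' = C * \<bar>y + c\<bar> powr \<beta>"
  proof (rule linear_ode_power)
    fix y assume y: "y \<in> {u<..<v}"
    show "((\<lambda>y. \<psi> y + m * (y + c) - c') has_real_derivative d\<psi> y + m) (at y)"
      by (auto intro!: derivative_eq_intros d\<psi>[OF subsetD[OF S(1) y]])
    have "k * ((y + c) * (d\<psi> y + m)) = ((k - 1) * \<psi> y + L - m * y) + k * m * (y + c)"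
      using ode\<psi>[OF y] by (simp add: algebra_simps)
    also have "\<dots> = (k - 1) * \<psi> y + (k - 1) * (m * (y + c)) + (L + m * c)"
      by (simp add: algebra_simps)
    also have "\<dots> = (k * \<beta>) * (\<psi> y + m * (y + c) - c')"
      unfolding k\<beta> using c' by (simp add: algebra_simps)
    finally have "k * ((y + c) * (d\<psi> y + m)) = k * (\<beta> * (\<psi> y + m * (y + c) - c'))" by simp
    then show "(y + c) * (d\<psi> y + m) = \<beta> * (\<psi> y + m * (y + c) - c')" using k(1) by simp
  qed (rule z)
  then obtain d where d: "\<And>y. y \<in> {u<..<v} \<Longrightarrow> \<psi> y + m * (y + c) - c' = d * \<bar>y + c\<bar> powr \<beta>" by blast
  have \<psi>: "\<psi> y = d * \<bar>y + c\<bar> powr \<beta> - m * (y + c) + c'" if "y \<in> {u<..<v}" for y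
    using d[OF that] by linarith
  obtain y0 where y0: "y0 \<in> {u<..<v}" using dense[OF S(2)] by auto
  have c2_nz: "c2 \<noteq> 0" using \<phi>_nz[OF subsetD[OF S(1) y0]] \<phi>[OF y0] by auto
  have d_nz: "d \<noteq> 0"
  proof
    assume "d = 0"
    then show False using \<psi>_not_affine[OF S, of "- m" "c' - m * c"] \<psi> by (simp add: algebra_simps)
  qed
  \<comment> \<open>The constant left after \<open>T''\<close> and \<open>X0'\<close> are
    subtracted: \<open>c' - m * c\<close> stems from the particular solution, \<open>m * n\<close>
    from \<open>X0'\<close>.\<close>
  define h where "h = c' - m * c + m * n"
  have "(k - 1) * h = - (L + m * c) - (k - 1) * (m * c) + (k - 1) * (m * n)"
    unfolding h_def using c' by (simp add: algebra_simps)
  also have "\<dots> = - (L + 2 * (m * n)) + k * m * n" using n by (simp add: algebra_simps)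
  also have "\<dots> = - (L + n * (m + \<sigma>))" unfolding km by (simp add: algebra_simps)
  finally have kh: "(k - 1) * h = - (L + n * (m + \<sigma>))" .
  have "w \<noteq> 0 \<and> \<kappa> * exp (- m * t) * U1\<^sup>2 * nfA2 \<sigma> \<phi> t x = U1 * c2 / \<bar>\<kappa> * U1\<bar> powr \<beta> * (w * \<bar>w\<bar> powr \<beta>) \<and>
      U1 * nfA1 \<sigma> \<sigma>0 \<psi> t x + U0 - (- m * \<kappa> * exp (- m * t) * U1 * x
          + - (k * m) * (\<kappa> * U1 * (n / k)) * exp (- (k * m) * t)) / (\<kappa> * exp (- m * t))
        = U1 * d / \<bar>\<kappa> * U1\<bar> powr \<beta> * \<bar>w\<bar> powr \<beta> + U1 * (exp (\<sigma> * t) * h + \<sigma>0 * t) + U0"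
    if nz: "\<kappa> \<noteq> 0" "U1 \<noteq> 0" and y: "x * exp (- \<sigma> * t) \<in> {u<..<v}"
      and w: "w = \<kappa> * exp (- m * t) * U1 * x + \<kappa> * U1 * (n / k) * exp (- (k * m) * t)"
    for \<kappa> U1 U0 t x w
  proof -
    define y where "y = x * exp (- \<sigma> * t)"
    define E F P K where "E = exp (\<sigma> * t)" "F = exp (- m * t)" "P = \<bar>y + c\<bar> powr \<beta>" "K = \<bar>\<kappa> * U1\<bar> powr \<beta>"
    note defs = this
    have yS: "y \<in> {u<..<v}" using that by (simp add: y_def)
    have pos: "E > 0" "F > 0" "K > 0" using nz by (auto simp: defs)
    have x: "x = y * E" by (simp add: y_def defs mult.assoc flip: exp_add)
    \<comment> \<open>By \<open>k * m = m - \<sigma>\<close> both summands of \<open>w\<close> carry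
      the same exponential \<open>E * F\<close>, since \<open>x = y * E\<close>.\<close>
    have "- (k * m) * t = \<sigma> * t + (- m * t)" unfolding km by (simp add: algebra_simps)
    then have G: "exp (- (k * m) * t) = E * F" by (simp only: exp_add defs)
    have E2: "exp (2 * \<sigma> * t) = E * E" by (simp add: defs flip: exp_add)
    have w': "w = (\<kappa> * U1) * (E * F) * (y + c)"
      unfolding w x G c_def[symmetric] defs(2)[symmetric] by (simp add: algebra_simps)
    \<comment> \<open>As \<open>k * \<beta> = k - 1\<close> and
      \<open>(k - 1) * m = - \<sigma>\<close>, the power \<open>(E * F) powr \<beta>\<close> equals
      \<open>E\<close>, the exponential factor of \<psi> in \<open>A1\<close>.\<close>
    have "\<beta> * (- (k * m)) = - (k * \<beta>) * m" by simp
    also have "\<dots> = \<sigma>" unfolding k\<beta> using km by (simp add: algebra_simps)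
    finally have \<beta>km: "\<beta> * (- (k * m) * t) = \<sigma> * t" by (metis mult.assoc)
    have "(E * F) powr \<beta> = exp (\<beta> * (- (k * m) * t))"
      unfolding G[symmetric] by (simp add: powr_def)
    then have EF: "(E * F) powr \<beta> = E" unfolding \<beta>km by (simp add: defs)
    have wp: "\<bar>w\<bar> powr \<beta> = K * (E * P)"
      unfolding w' abs_mult[of _ "y + c"] abs_mult[of _ "E * F"] using pos EF
      by (simp add: powr_mult defs abs_mult)
    have v: "nfA2 \<sigma> \<phi> t x = E * E * (c2 * ((y + c) * P))" "nfA1 \<sigma> \<sigma>0 \<psi> t x = E * (d * P - m * (y + c) + c') + \<sigma>0 * t"
      using \<phi>[OF yS] \<psi>[OF yS] unfolding nfA2_def nfA1_def y_def[symmetric] E2 by (simp_all add: defs)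
    have "w \<noteq> 0" using nz z[OF yS] pos unfolding w' by simp
    moreover have "\<kappa> * F * U1\<^sup>2 * nfA2 \<sigma> \<phi> t x = U1 * c2 / K * (w * \<bar>w\<bar> powr \<beta>)"
      unfolding wp v unfolding w' using pos by (simp add: power2_eq_square)
    moreover have "U1 * nfA1 \<sigma> \<sigma>0 \<psi> t x + U0 - (- m * \<kappa> * F * U1 * x
          + - (k * m) * (\<kappa> * U1 * c) * (E * F)) / (\<kappa> * F)
        = U1 * d / K * \<bar>w\<bar> powr \<beta> + U1 * (E * h + \<sigma>0 * t) + U0"
    proof -
      have "(- m * \<kappa> * F * U1 * x + - (k * m) * (\<kappa> * U1 * c) * (E * F)) / (\<kappa> * F)
         = - m * U1 * y * E - m * U1 * n * E"
        using nz(1) pos(2) unfolding x n by (simp add: field_simps)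
      then show ?thesis unfolding wp v using pos(3) by (simp add: h_def algebra_simps)
    qed
    ultimately show ?thesis unfolding G c_def[symmetric] defs(2)[symmetric] defs(4)[symmetric] defs(1)[symmetric] by blast
  qed
  then show ?thesis by (rule that[OF c2_nz d_nz kh])
qed

text \<open>For \<open>k = 1\<close> the term in \<psi> drops out of its equation, which integrates
  to \<open>d * ln |y + n|\<close> with \<open>d = L + n * m\<close>, up to an affine function. The
  drift \<open>\<sigma>0 * t = - m * d * t\<close> is \<open>d\<close> times the logarithm of the
  factor \<open>exp (- m t)\<close> in \<open>w\<close>, so \<open>ln |w|\<close> absorbs
  it.\<close>

lemma log_reduction:
  assumes S: "{u<..<v} \<subseteq> J" "u < v" and ce: "\<And>y. y \<in> {u<..<v} \<Longrightarrow> comp_eqs 1 1 n m L y"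
    and km: "\<sigma> = 0" and N: "m * (L + n * m) = - \<sigma>0"
  obtains c2 d h where "c2 \<noteq> 0" "d \<noteq> 0"
    "\<And>t x w. x \<in> {u<..<v} \<Longrightarrow>
      w = d * exp (- m * t) * (1 / d) * x + n * exp (- m * t) \<Longrightarrow>
      w \<noteq> 0 \<and> d * exp (- m * t) * (1 / d)\<^sup>2 * nfA2 \<sigma> \<phi> t x = c2 * w \<and>
      (1 / d) * nfA1 \<sigma> \<sigma>0 \<psi> t x + h - (- m * d * exp (- m * t) * (1 / d) * x + - m * n * exp (- m * t)) / (d * exp (- m * t))
        = ln \<bar>w\<bar>"
proof -
  have z: "y + n \<noteq> 0" if "y \<in> {u<..<v}" for y
    using comp_eqs_component_nonzero[OF S(1) ce that] by simp
  have "\<exists>C. \<forall>y\<in>{u<..<v}. \<phi> y / (y + n) = C * \<bar>y + n\<bar> powr 0"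
  proof (rule linear_ode_power)
    fix y assume y: "y \<in> {u<..<v}"
    show "((\<lambda>y. \<phi> y / (y + n)) has_real_derivative (d\<phi> y * (y + n) - \<phi> y * 1) / ((y + n) * (y + n))) (at y)"
      by (rule DERIV_divide[OF d\<phi>[OF subsetD[OF S(1) y]]]) (auto intro!: derivative_eq_intros z[OF y])
    have "(y + n) * d\<phi> y = \<phi> y" using ce[OF y] by (simp add: comp_eqs_def)
    then show "(y + n) * ((d\<phi> y * (y + n) - \<phi> y * 1) / ((y + n) * (y + n))) = 0 * (\<phi> y / (y + n))"
      by (simp add: mult.commute)
  qed (rule z)
  then obtain c where c: "\<And>y. y \<in> {u<..<v} \<Longrightarrow> \<phi> y / (y + n) = c * \<bar>y + n\<bar> powr 0" by blast
  have \<phi>: "\<phi> y = c * (y + n)" if "y \<in> {u<..<v}" for y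
    using c[OF that] z[OF that] by (simp add: field_simps)
  define d where "d = L + n * m"
  have "\<exists>C. \<forall>y\<in>{u<..<v}. \<psi> y + m * y = d * ln \<bar>y + n\<bar> + C"
  proof (rule linear_ode_log)
    fix y assume y: "y \<in> {u<..<v}"
    show "((\<lambda>y. \<psi> y + m * y) has_real_derivative d\<psi> y + m) (at y)"
      by (auto intro!: derivative_eq_intros d\<psi>[OF subsetD[OF S(1) y]])
    show "(y + n) * (d\<psi> y + m) = d" using ce[OF y] by (simp add: comp_eqs_def d_def algebra_simps)
  qed (rule z)
  then obtain C where C: "\<And>y. y \<in> {u<..<v} \<Longrightarrow> \<psi> y + m * y = d * ln \<bar>y + n\<bar> + C" by blast
  have \<psi>: "\<psi> y = d * ln \<bar>y + n\<bar> + C - m * y" if "y \<in> {u<..<v}" for y using C[OF that] by simp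
  obtain y0 where y0: "y0 \<in> {u<..<v}" using dense[OF S(2)] by auto
  have c_nz: "c \<noteq> 0" using \<phi>_nz[OF subsetD[OF S(1) y0]] \<phi>[OF y0] by auto
  have d_nz: "d \<noteq> 0"
  proof
    assume "d = 0"
    then show False using \<psi>_not_affine[OF S, of "- m" C] \<psi> by simp
  qed
  have \<sigma>0: "\<sigma>0 = - m * d" using N by (simp add: d_def)
  \<comment> \<open>\<open>h\<close> is the \<open>U0\<close> of the transformation; it cancels the
    constants \<open>C / d\<close> from \<psi> and \<open>m * n / d\<close> from
    \<open>- X0' / T'\<close>.\<close>
  define h where "h = - C / d - m * n / d"
  have "w \<noteq> 0 \<and> d * exp (- m * t) * (1 / d)\<^sup>2 * nfA2 \<sigma> \<phi> t x = (c / d) * w \<and>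
      (1 / d) * nfA1 \<sigma> \<sigma>0 \<psi> t x + h - (- m * d * exp (- m * t) * (1 / d) * x + - m * n * exp (- m * t)) / (d * exp (- m * t))
        = ln \<bar>w\<bar>"
    if x: "x \<in> {u<..<v}" and w: "w = d * exp (- m * t) * (1 / d) * x + n * exp (- m * t)" for t x w
  proof -
    have w': "w = exp (- m * t) * (x + n)" using d_nz unfolding w by (simp add: algebra_simps)
    have lnw: "ln \<bar>w\<bar> = - m * t + ln \<bar>x + n\<bar>"
      unfolding w' abs_mult using z[OF x] by (simp add: ln_mult)
    have v: "nfA2 \<sigma> \<phi> t x = c * (x + n)" "nfA1 \<sigma> \<sigma>0 \<psi> t x = d * ln \<bar>x + n\<bar> + C - m * x - m * d * t"
      using \<phi>[OF x] \<psi>[OF x] by (simp_all add: nfA2_def nfA1_def km \<sigma>0)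
    have "d * exp (- m * t) * (1 / d)\<^sup>2 * nfA2 \<sigma> \<phi> t x = (c / d) * w"
      unfolding v w' using d_nz by (simp add: power2_eq_square field_simps)
    moreover have "(- m * d * exp (- m * t) * (1 / d) * x + - m * n * exp (- m * t)) / (d * exp (- m * t))
      = - m * (x + n) / d" using d_nz by (simp add: field_simps)
    then have "(1 / d) * nfA1 \<sigma> \<sigma>0 \<psi> t x + h - (- m * d * exp (- m * t) * (1 / d) * x + - m * n * exp (- m * t)) / (d * exp (- m * t))
        = ln \<bar>w\<bar>"
      unfolding lnw v h_def using d_nz by (simp add: field_simps)
    ultimately show ?thesis using z[OF x] w' by simp
  qed
  moreover have "c / d \<noteq> 0" using c_nz d_nz by simp
  ultimately show ?thesis using that[of "c / d" d h] d_nz by blast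
qed

text \<open>For \<open>k = 0\<close> the component is the constant \<open>n\<close>, the solutions
  are exponentials in \<open>y\<close>, and \<open>m = \<sigma>\<close>. The shift
  \<open>X0 = \<sigma> t\<close> makes the factor \<open>exp (\<sigma> t)\<close> a part of
  \<open>exp w\<close>.\<close>

lemma exp_reduction:
  assumes S: "{u<..<v} \<subseteq> J" "u < v" and ce: "\<And>y. y \<in> {u<..<v} \<Longrightarrow> comp_eqs 1 0 n \<sigma> L y"
    and \<sigma>0: "\<sigma>0 = 0" and N: "\<sigma> * (L + n * (2 * \<sigma>)) = 0"
  obtains \<kappa> U1 c1 U0 where "\<kappa> \<noteq> 0" "U1 \<noteq> 0" "c1 \<noteq> 0"
    "\<And>t x w. x * exp (- \<sigma> * t) \<in> {u<..<v} \<Longrightarrow> w = \<kappa> * exp (- \<sigma> * t) * U1 * x + \<sigma> * t \<Longrightarrow>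
      \<kappa> * exp (- \<sigma> * t) * U1\<^sup>2 * nfA2 \<sigma> \<phi> t x = exp w \<and>
      U1 * nfA1 \<sigma> \<sigma>0 \<psi> t x + U0 - (- \<sigma> * \<kappa> * exp (- \<sigma> * t) * U1 * x + \<sigma>) / (\<kappa> * exp (- \<sigma> * t)) = c1 * exp w"
proof -
  obtain y0 where y0: "y0 \<in> {u<..<v}" using dense[OF S(2)] by auto
  have n: "n \<noteq> 0" using comp_eqs_component_nonzero[OF S(1) ce y0] by simp
  have "\<exists>C. \<forall>y\<in>{u<..<v}. \<phi> y = C * exp (- y / n)"
    by (rule linear_ode_exp[OF n, of u v _ d\<phi>])
      (use d\<phi> S(1) ce in \<open>auto simp: comp_eqs_def\<close>)
  then obtain c where \<phi>: "\<And>y. y \<in> {u<..<v} \<Longrightarrow> \<phi> y = c * exp (- y / n)" by blast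
  define c' where "c' = L + \<sigma> * n"
  have "\<exists>C. \<forall>y\<in>{u<..<v}. \<psi> y + \<sigma> * y - c' = C * exp (- y / n)"
  proof (rule linear_ode_exp[OF n])
    fix y assume y: "y \<in> {u<..<v}"
    show "((\<lambda>y. \<psi> y + \<sigma> * y - c') has_real_derivative d\<psi> y + \<sigma>) (at y)"
      by (auto intro!: derivative_eq_intros d\<psi>[OF subsetD[OF S(1) y]])
    show "n * (d\<psi> y + \<sigma>) = - (\<psi> y + \<sigma> * y - c')"
      using ce[OF y] by (simp add: comp_eqs_def c'_def algebra_simps)
  qed
  then obtain d where d: "\<And>y. y \<in> {u<..<v} \<Longrightarrow> \<psi> y + \<sigma> * y - c' = d * exp (- y / n)" by blast
  have \<psi>: "\<psi> y = d * exp (- y / n) - \<sigma> * y + c'" if "y \<in> {u<..<v}" for y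
    using d[OF that] by linarith
  have c_nz: "c \<noteq> 0" using \<phi>_nz[OF subsetD[OF S(1) y0]] \<phi>[OF y0] by auto
  have d_nz: "d \<noteq> 0"
  proof
    assume "d = 0"
    then show False using \<psi>_not_affine[OF S, of "- \<sigma>" c'] \<psi> by simp
  qed
  \<comment> \<open>\<open>\<kappa> * U1 = - 1 / n\<close> matches the exponents of
    \<open>exp w\<close> and \<phi>, and \<open>\<kappa> * U1^2 * c = 1\<close> normalises the
    amplitude. The constant \<open>c'\<close> is absorbed by \<open>U0\<close> if
    \<open>\<sigma> = 0\<close>; otherwise \<open>c' = - \<sigma> * n\<close>, and it cancels
    against \<open>X0' / T'\<close>.\<close>
  define U1 \<kappa> U0 where "U1 = - n / c" "\<kappa> = c / n\<^sup>2" "U0 = (if \<sigma> = 0 then n * c' / c else 0)"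
  have nz: "U1 \<noteq> 0" "\<kappa> \<noteq> 0" using n c_nz by (simp_all add: U1_\<kappa>_U0_def)
  have kU: "\<kappa> * U1 = - 1 / n" "\<kappa> * U1\<^sup>2 * c = 1"
    using n c_nz by (simp_all add: U1_\<kappa>_U0_def field_simps power2_eq_square)
  have "\<kappa> * exp (- \<sigma> * t) * U1\<^sup>2 * nfA2 \<sigma> \<phi> t x = exp w \<and>
      U1 * nfA1 \<sigma> \<sigma>0 \<psi> t x + U0 - (- \<sigma> * \<kappa> * exp (- \<sigma> * t) * U1 * x + \<sigma>) / (\<kappa> * exp (- \<sigma> * t)) = (U1 * d) * exp w"
    if y: "x * exp (- \<sigma> * t) \<in> {u<..<v}" and w: "w = \<kappa> * exp (- \<sigma> * t) * U1 * x + \<sigma> * t" for t x w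
  proof -
    define y where "y = x * exp (- \<sigma> * t)"
    define E P where "E = exp (\<sigma> * t)" "P = exp (- y / n)"
    note defs = this
    have yS: "y \<in> {u<..<v}" using that by (simp add: y_def)
    have E: "E > 0" "exp (- \<sigma> * t) = 1 / E" "exp (2 * \<sigma> * t) = E * E"
      by (simp_all add: defs exp_minus field_simps flip: exp_add)
    have x: "x = y * E" using E by (simp add: y_def)
    have "w = (\<kappa> * U1) * y + \<sigma> * t" unfolding w by (simp add: y_def)
    then have ew: "exp w = P * E" unfolding kU by (simp add: defs flip: exp_add)
    have v: "nfA2 \<sigma> \<phi> t x = E * E * (c * P)" "nfA1 \<sigma> \<sigma>0 \<psi> t x = E * (d * P - \<sigma> * y + c')"
      using \<phi>[OF yS] \<psi>[OF yS] unfolding nfA2_def nfA1_def y_def[symmetric] E(3) by (simp_all add: defs \<sigma>0)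
    have "\<kappa> * exp (- \<sigma> * t) * U1\<^sup>2 * nfA2 \<sigma> \<phi> t x = (\<kappa> * U1\<^sup>2 * c) * (P * E)"
      unfolding v unfolding E(2) using E(1) by (simp add: field_simps)
    then have 1: "\<kappa> * exp (- \<sigma> * t) * U1\<^sup>2 * nfA2 \<sigma> \<phi> t x = exp w" unfolding kU ew by simp
    have "(- \<sigma> * \<kappa> * exp (- \<sigma> * t) * U1 * x + \<sigma>) / (\<kappa> * exp (- \<sigma> * t)) = - \<sigma> * U1 * y * E + \<sigma> * E / \<kappa>"
      unfolding E(2) using E(1) nz unfolding x by (simp add: field_simps)
    moreover have "U1 * E * c' + U0 - \<sigma> * E / \<kappa> = 0"
    proof (cases "\<sigma> = 0")
      case True
      then show ?thesis using n c_nz by (simp add: defs U1_\<kappa>_U0_def field_simps)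
    next
      case False
      then have "L + n * (2 * \<sigma>) = 0" using N by (simp del: mult_numeral_left)
      moreover have "c' + \<sigma> * n = L + n * (2 * \<sigma>)" by (simp add: c'_def algebra_simps)
      ultimately have "c' = - \<sigma> * n" by linarith
      then show ?thesis using n c_nz False by (simp add: U1_\<kappa>_U0_def field_simps power2_eq_square)
    qed
    ultimately have "U1 * nfA1 \<sigma> \<sigma>0 \<psi> t x + U0 - (- \<sigma> * \<kappa> * exp (- \<sigma> * t) * U1 * x + \<sigma>) / (\<kappa> * exp (- \<sigma> * t)) = (U1 * d) * exp w"
      unfolding v ew by (simp add: algebra_simps)
    with 1 show ?thesis ..
  qed
  moreover have "U1 * d \<noteq> 0" using nz d_nz by simp
  ultimately show ?thesis using that[OF nz(2,1)] by blast
qed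

text \<open>The reductions hold only where \<open>y\<close> lies in the interval on which the ODEs
  are known, so the domain is first shrunk to a box with this property.\<close>

lemma equiv_to_maximal:
  assumes \<sigma>: "\<sigma> = 0 \<or> \<sigma> = - 1" and D: "open D" "D \<subseteq> nf_dom \<sigma> J" and tx: "(t1, x1) \<in> D"
    and S: "{u<..<v} \<subseteq> J" "x1 * exp (- \<sigma> * t1) \<in> {u<..<v}"
    and ce: "\<And>y. y \<in> {u<..<v} \<Longrightarrow> comp_eqs 1 k n m L y"
    and km: "k * m = m - \<sigma>" and N: "(m + \<sigma>) * (L + n * (m + \<sigma>)) = \<sigma>0 * (k - 2)"
  shows "locally_equiv_to {4..7} D (nfA2 \<sigma> \<phi>) (nfA1 \<sigma> \<sigma>0 \<psi>)"
proof -
  have uv: "u < v" using S(2) by simp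
  have "open (D \<inter> (\<lambda>p. snd p * exp (- \<sigma> * fst p)) -` {u<..<v})"
    by (intro open_Int D open_vimage open_greaterThanLessThan continuous_intros)
  then obtain r where r: "r > 0" "{t1 - r<..<t1 + r} \<times> {x1 - r<..<x1 + r}
      \<subseteq> D \<inter> (\<lambda>p. snd p * exp (- \<sigma> * fst p)) -` {u<..<v}"
    by (rule open_prod_box[of _ t1 x1]) (use tx S(2) in auto)
  define \<Omega> where "\<Omega> = {t1 - r<..<t1 + r} \<times> {x1 - r<..<x1 + r}"
  have \<Omega>: "\<Omega> \<subseteq> D" "open \<Omega>" "convex \<Omega>" "\<Omega> \<noteq> {}" "open (fst ` \<Omega>)"
    using r by (auto simp: \<Omega>_def open_Times convex_Times)
  have y: "x * exp (- \<sigma> * t) \<in> {u<..<v}" if "(t, x) \<in> \<Omega>" for t x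
    using subsetD[OF r(2), of "(t, x)"] that by (simp add: \<Omega>_def)
  have goal: "locally_equiv_to {4..7} D (nfA2 \<sigma> \<phi>) (nfA1 \<sigma> \<sigma>0 \<psi>)"
    if "j \<in> {4..7}" "equiv_map \<Omega> T X0 U0 U1 (nfA2 \<sigma> \<phi>) (nfA1 \<sigma> \<sigma>0 \<psi>) B2 B1"
      "listed_case j B2 B1 (eq_pt T X0 U1 ` \<Omega>)" for j T X0 U0 U1 B2 B1
    unfolding locally_equiv_to_def using that \<Omega> by blast
  consider (exp) "k = 0" | (log) "k = 1" | (power) "k \<noteq> 0" "k \<noteq> 1" by blast
  then show ?thesis
  proof cases
    case exp
    have m: "m = \<sigma>" using km exp by simp
    \<comment> \<open>For \<open>\<sigma> = 0\<close> this says \<open>\<sigma>0 = 0\<close>; for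
      \<open>\<sigma> = - 1\<close> that follows from
      \<open>\<sigma> * \<sigma>0 = 0\<close>.\<close>
    have "(2 * \<sigma>) * (L + n * (2 * \<sigma>)) = - 2 * \<sigma>0" using N exp m by simp
    then have \<sigma>0: "\<sigma>0 = 0" and N': "\<sigma> * (L + n * (2 * \<sigma>)) = 0"
      using \<sigma> \<sigma>\<sigma>0 by auto
    obtain \<kappa> U1 c1 U0 where nz: "\<kappa> \<noteq> 0" "U1 \<noteq> 0" "c1 \<noteq> 0" and
      red: "\<And>t x w. x * exp (- \<sigma> * t) \<in> {u<..<v} \<Longrightarrow> w = \<kappa> * exp (- \<sigma> * t) * U1 * x + \<sigma> * t \<Longrightarrow>
      \<kappa> * exp (- \<sigma> * t) * U1\<^sup>2 * nfA2 \<sigma> \<phi> t x = exp w \<and>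
      U1 * nfA1 \<sigma> \<sigma>0 \<psi> t x + U0 - (- \<sigma> * \<kappa> * exp (- \<sigma> * t) * U1 * x + \<sigma>) / (\<kappa> * exp (- \<sigma> * t)) = c1 * exp w"
      using exp_reduction[OF S(1) uv ce[unfolded exp m] \<sigma>0 N'] by metis
    have dX: "deriv (\<lambda>t. \<sigma> * t) t = \<sigma>" for t
      by (rule DERIV_imp_deriv) (auto intro!: derivative_eq_intros)
    show ?thesis
    proof (rule goal[of 6 "exp_time \<kappa> \<sigma>" "\<lambda>t. \<sigma> * t" U0 U1 c6A2 "c6A1 c1"])
      show "equiv_map \<Omega> (exp_time \<kappa> \<sigma>) (\<lambda>t. \<sigma> * t) U0 U1 (nfA2 \<sigma> \<phi>) (nfA1 \<sigma> \<sigma>0 \<psi>) c6A2 (c6A1 c1)"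
        unfolding equiv_map_def deriv_exp_time deriv_scaled_exp dX c6A2_def c6A1_def
        using nz red[OF y refl] smooth1_exp_time[OF \<Omega>(5)] \<Omega>(5)
        by (auto intro!: smooth1_mult)
      show "listed_case 6 c6A2 (c6A1 c1) (eq_pt (exp_time \<kappa> \<sigma>) (\<lambda>t. \<sigma> * t) U1 ` \<Omega>)"
        unfolding listed_case_def using nz by auto
    qed simp
  next
    case log
    have \<sigma>0': "\<sigma> = 0" using km log by simp
    then have N': "m * (L + n * m) = - \<sigma>0" using N log by simp
    obtain c2 d h where nz: "c2 \<noteq> 0" "d \<noteq> 0" and
      red: "\<And>t x w. x \<in> {u<..<v} \<Longrightarrow>
      w = d * exp (- m * t) * (1 / d) * x + n * exp (- m * t) \<Longrightarrow>
      w \<noteq> 0 \<and> d * exp (- m * t) * (1 / d)\<^sup>2 * nfA2 \<sigma> \<phi> t x = c2 * w \<and>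
      (1 / d) * nfA1 \<sigma> \<sigma>0 \<psi> t x + h - (- m * d * exp (- m * t) * (1 / d) * x + - m * n * exp (- m * t)) / (d * exp (- m * t))
        = ln \<bar>w\<bar>"
      using log_reduction[OF S(1) uv ce[unfolded log] \<sigma>0' N'] by metis
    have y': "x \<in> {u<..<v}" if "(t, x) \<in> \<Omega>" for t x using y[OF that] \<sigma>0' by simp
    show ?thesis
    proof (rule goal[of 5 "exp_time d m" "\<lambda>t. n * exp (- m * t)" h "1 / d" "c5A2 c2" c5A1])
      show "equiv_map \<Omega> (exp_time d m) (\<lambda>t. n * exp (- m * t)) h (1 / d) (nfA2 \<sigma> \<phi>) (nfA1 \<sigma> \<sigma>0 \<psi>) (c5A2 c2) c5A1"
        unfolding equiv_map_def deriv_exp_time deriv_scaled_exp c5A2_def c5A1_def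
      proof (intro conjI allI impI)
        fix t x assume "(t, x) \<in> \<Omega>"
        note red' = red[OF y'[OF this] refl, of t]
        show "c2 * (d * exp (- m * t) * (1 / d) * x + n * exp (- m * t)) = d * exp (- m * t) * (1 / d)\<^sup>2 * nfA2 \<sigma> \<phi> t x"
          using red' by argo
        show "ln \<bar>d * exp (- m * t) * (1 / d) * x + n * exp (- m * t)\<bar> = 1 / d * nfA1 \<sigma> \<sigma>0 \<psi> t x + h -
           (- m * d * exp (- m * t) * (1 / d) * x + - m * n * exp (- m * t)) / (d * exp (- m * t))"
          using red' by argo
      next
        show "smooth1 (fst ` \<Omega>) (\<lambda>t. n * exp (- m * t))"
          by (rule smooth1_scaled_exp[OF \<Omega>(5)])
      qed (use nz smooth1_exp_time[OF \<Omega>(5)] smooth1_scaled_exp[OF \<Omega>(5)] in auto)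
      show "listed_case 5 (c5A2 c2) c5A1 (eq_pt (exp_time d m) (\<lambda>t. n * exp (- m * t)) (1 / d) ` \<Omega>)"
        unfolding listed_case_def using nz red[OF y' refl]
        by (auto simp: domNZ_def eq_pt_def deriv_exp_time)
    qed simp
  next
    case power
    define \<beta> where "\<beta> = (k - 1) / k"
    have k\<beta>: "k * \<beta> = k - 1" using power by (simp add: \<beta>_def)
    have mk: "m * (k - 1) = - \<sigma>" using km by (simp add: algebra_simps)
    obtain c2 d h where nz: "c2 \<noteq> 0" "d \<noteq> 0" and h: "(k - 1) * h = - (L + n * (m + \<sigma>))" and
      red: "\<And>\<kappa> U1 U0 t x w. \<kappa> \<noteq> 0 \<Longrightarrow> U1 \<noteq> 0 \<Longrightarrow> x * exp (- \<sigma> * t) \<in> {u<..<v} \<Longrightarrow>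
      w = \<kappa> * exp (- m * t) * U1 * x + \<kappa> * U1 * (n / k) * exp (- (k * m) * t) \<Longrightarrow>
      w \<noteq> 0 \<and> \<kappa> * exp (- m * t) * U1\<^sup>2 * nfA2 \<sigma> \<phi> t x = U1 * c2 / \<bar>\<kappa> * U1\<bar> powr \<beta> * (w * \<bar>w\<bar> powr \<beta>) \<and>
      U1 * nfA1 \<sigma> \<sigma>0 \<psi> t x + U0 - (- m * \<kappa> * exp (- m * t) * U1 * x
          + - (k * m) * (\<kappa> * U1 * (n / k)) * exp (- (k * m) * t)) / (\<kappa> * exp (- m * t))
        = U1 * d / \<bar>\<kappa> * U1\<bar> powr \<beta> * \<bar>w\<bar> powr \<beta> + U1 * (exp (\<sigma> * t) * h + \<sigma>0 * t) + U0"
      using power_reduction[OF S(1) uv ce km power, folded \<beta>_def] by metis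
    have goal': "locally_equiv_to {4..7} D (nfA2 \<sigma> \<phi>) (nfA1 \<sigma> \<sigma>0 \<psi>)"
      if "j \<in> {4..7}" and nz': "\<kappa> \<noteq> 0" "U1 \<noteq> 0"
        and B: "\<And>t w. w \<noteq> 0 \<Longrightarrow> B2 (exp_time \<kappa> m t) w = U1 * c2 / \<bar>\<kappa> * U1\<bar> powr \<beta> * (w * \<bar>w\<bar> powr \<beta>)"
        "\<And>t w. w \<noteq> 0 \<Longrightarrow> B1 (exp_time \<kappa> m t) w
          = U1 * d / \<bar>\<kappa> * U1\<bar> powr \<beta> * \<bar>w\<bar> powr \<beta> + U1 * (exp (\<sigma> * t) * h + \<sigma>0 * t) + U0"
        and lc: "\<And>D. D \<subseteq> domNZ \<Longrightarrow> listed_case j B2 B1 D"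
      for j \<kappa> U1 U0 B2 B1
    proof (rule goal[OF that(1), of "exp_time \<kappa> m" "\<lambda>t. \<kappa> * U1 * (n / k) * exp (- (k * m) * t)" U0 U1 B2 B1])
      show "equiv_map \<Omega> (exp_time \<kappa> m) (\<lambda>t. \<kappa> * U1 * (n / k) * exp (- (k * m) * t)) U0 U1 (nfA2 \<sigma> \<phi>) (nfA1 \<sigma> \<sigma>0 \<psi>) B2 B1"
        unfolding equiv_map_def deriv_exp_time deriv_scaled_exp
      proof (intro conjI allI impI)
        fix t x assume "(t, x) \<in> \<Omega>"
        note red' = red[OF nz' y[OF this] refl]
        show "B2 (exp_time \<kappa> m t) (\<kappa> * exp (- m * t) * U1 * x + \<kappa> * U1 * (n / k) * exp (- (k * m) * t))
            = \<kappa> * exp (- m * t) * U1\<^sup>2 * nfA2 \<sigma> \<phi> t x"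
          using red' B(1) by metis
        show "B1 (exp_time \<kappa> m t) (\<kappa> * exp (- m * t) * U1 * x + \<kappa> * U1 * (n / k) * exp (- (k * m) * t))
           = U1 * nfA1 \<sigma> \<sigma>0 \<psi> t x + U0 - (- m * \<kappa> * exp (- m * t) * U1 * x
             + - (k * m) * (\<kappa> * U1 * (n / k)) * exp (- (k * m) * t)) / (\<kappa> * exp (- m * t))"
          using red' B(2) by metis
      next
        show "smooth1 (fst ` \<Omega>) (\<lambda>t. \<kappa> * U1 * (n / k) * exp (- (k * m) * t))"
          by (rule smooth1_scaled_exp[OF \<Omega>(5)])
      qed (use nz' smooth1_exp_time[OF \<Omega>(5)] smooth1_scaled_exp[OF \<Omega>(5)] in auto)
      show "listed_case j B2 B1 (eq_pt (exp_time \<kappa> m) (\<lambda>t. \<kappa> * U1 * (n / k) * exp (- (k * m) * t)) U1 ` \<Omega>)"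
      proof (rule lc)
        show "eq_pt (exp_time \<kappa> m) (\<lambda>t. \<kappa> * U1 * (n / k) * exp (- (k * m) * t)) U1 ` \<Omega> \<subseteq> domNZ"
          using red[OF nz' y refl] by (auto simp: domNZ_def eq_pt_def deriv_exp_time)
      qed
    qed
    \<comment> \<open>\<open>\<kappa> = c2\<close> and \<open>U1 = 1 / c2\<close> give
      \<open>\<kappa> * U1 = 1\<close> and amplitude 1 in \<open>A2\<close>; \<open>U0\<close>
      removes the constant leftover.\<close>
    have case4: ?thesis if const: "\<And>t. exp (\<sigma> * t) * h + \<sigma>0 * t = C" for C
    proof (rule goal'[of 4 c2 "1 / c2" "c4A2 (k - 1)" "c4A1 (k - 1) (d / c2)" "- C / c2"])
      have e: "(k - 1) / (1 + (k - 1)) = \<beta>" by (simp add: \<beta>_def)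
      show "c4A2 (k - 1) (exp_time c2 m t) w = 1 / c2 * c2 / \<bar>c2 * (1 / c2)\<bar> powr \<beta> * (w * \<bar>w\<bar> powr \<beta>)" for t w
        unfolding c4A2_def e using nz by simp
      show "c4A1 (k - 1) (d / c2) (exp_time c2 m t) w
          = 1 / c2 * d / \<bar>c2 * (1 / c2)\<bar> powr \<beta> * \<bar>w\<bar> powr \<beta> + 1 / c2 * (exp (\<sigma> * t) * h + \<sigma>0 * t) + - C / c2" for t w
        unfolding c4A1_def e const using nz by simp
      show "listed_case 4 (c4A2 (k - 1)) (c4A1 (k - 1) (d / c2)) D" if "D \<subseteq> domNZ" for D
      proof -
        have "k - 1 \<noteq> - 1" "k - 1 \<noteq> 0" "d / c2 \<noteq> 0" using power nz by auto
        then show ?thesis unfolding listed_case_def using that by blast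
      qed
    qed (use nz in auto)
    \<comment> \<open>\<open>U1 = c2\<close> makes the new amplitude
      \<open>c2^2 / sqrt |\<kappa> * c2|\<close> positive, which is the normalisation in Case 7;
      \<kappa> has to make the leftover equal to \<open>T\<close>.\<close>
    have case7: ?thesis if k2: "k = 2" and \<kappa>: "\<kappa> \<noteq> 0"
      and lin: "\<And>t. c2 * (exp (\<sigma> * t) * h + \<sigma>0 * t) + U0 = exp_time \<kappa> m t" for \<kappa> U0
    proof (rule goal'[of 7 \<kappa> c2 "c7A2 (c2\<^sup>2 / sqrt \<bar>\<kappa> * c2\<bar>)" "c7A1 (c2 * d / sqrt \<bar>\<kappa> * c2\<bar>)" U0])
      have \<beta>: "\<beta> = 1 / 2" by (simp add: \<beta>_def k2)
      have sq: "\<bar>z\<bar> powr \<beta> = sqrt \<bar>z\<bar>" for z by (simp add: \<beta> powr_half_sqrt)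
      show "c7A2 (c2\<^sup>2 / sqrt \<bar>\<kappa> * c2\<bar>) (exp_time \<kappa> m t) w = c2 * c2 / \<bar>\<kappa> * c2\<bar> powr \<beta> * (w * \<bar>w\<bar> powr \<beta>)" for t w
        unfolding c7A2_def sq by (simp add: power2_eq_square)
      show "c7A1 (c2 * d / sqrt \<bar>\<kappa> * c2\<bar>) (exp_time \<kappa> m t) w
         = c2 * d / \<bar>\<kappa> * c2\<bar> powr \<beta> * \<bar>w\<bar> powr \<beta> + c2 * (exp (\<sigma> * t) * h + \<sigma>0 * t) + U0" for t w
        unfolding c7A1_def sq using lin[of t] by simp
      show "listed_case 7 (c7A2 (c2\<^sup>2 / sqrt \<bar>\<kappa> * c2\<bar>)) (c7A1 (c2 * d / sqrt \<bar>\<kappa> * c2\<bar>)) D" if "D \<subseteq> domNZ" for D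
      proof -
        have "c2\<^sup>2 / sqrt \<bar>\<kappa> * c2\<bar> > 0" "c2 * d / sqrt \<bar>\<kappa> * c2\<bar> \<noteq> 0" using nz \<kappa> by auto
        then show ?thesis unfolding listed_case_def using that by blast
      qed
    qed (use nz \<kappa> in auto)
    show ?thesis
    proof (cases "\<sigma> = 0")
      case True
      then have m: "m = 0" using mk power by simp
      then have "\<sigma>0 = 0 \<or> k = 2" using N True by auto
      then show ?thesis
      proof
        assume "\<sigma>0 = 0"
        then show ?thesis using case4[of h] True by simp
      next
        assume k2: "k = 2"
        show ?thesis
        proof (cases "\<sigma>0 = 0")
          case True
          then show ?thesis using case4[of h] \<open>\<sigma> = 0\<close> by simp
        next
          case False
          \<comment> \<open>The leftover \<open>c2 * (h + \<sigma>0 * t) + U0\<close> becomes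
            \<open>\<kappa> * t = T\<close>.\<close>
          then show ?thesis
            using case7[OF k2, of "c2 * \<sigma>0" "- c2 * h"] nz \<open>\<sigma> = 0\<close> by (simp add: exp_time_def m algebra_simps)
        qed
      qed
    next
      case False
      then have \<sigma>': "\<sigma> = - 1" "\<sigma>0 = 0" using \<sigma> \<sigma>\<sigma>0 by auto
      show ?thesis
      proof (cases "h = 0")
        case True
        then show ?thesis using case4[of 0] \<sigma>' by simp
      next
        case False
        \<comment> \<open>This quantity is \<open>- (k - 1) * h\<close>. As
          \<open>\<sigma>0 = 0\<close>, the second relation leaves \<open>m + \<sigma> = 0\<close>,
          so \<open>m = 1\<close>, and then \<open>m * (k - 1) = - \<sigma>\<close> gives
          \<open>k = 2\<close>.\<close>
        then have "L + n * (m + \<sigma>) \<noteq> 0"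
          using h power by (metis mult_eq_0_iff neg_equal_0_iff_equal right_minus_eq)
        then have m: "m = 1" using N \<sigma>' by simp
        then have k2: "k = 2" using mk \<sigma>' by simp
        \<comment> \<open>Here \<open>T = c2 * h * exp (- t)\<close> is the leftover itself.\<close>
        show ?thesis
          using case7[OF k2, of "- c2 * h" 0] nz False by (simp add: exp_time_def m \<sigma>')
      qed
    qed
  qed
qed

lemma span1_or_equiv_to_maximal:
  assumes \<sigma>: "\<sigma> = 0 \<or> \<sigma> = - 1" and D: "good_dom D" "D \<subseteq> nf_dom \<sigma> J"
  shows "alg_span1 D (nfA2 \<sigma> \<phi>) (nfA1 \<sigma> \<sigma>0 \<psi>) (affine_vf 1 0 \<sigma> 0 \<sigma> \<sigma>0) \<or>
    locally_equiv_to {4..7} D (nfA2 \<sigma> \<phi>) (nfA1 \<sigma> \<sigma>0 \<psi>)"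
proof (cases "alg_span1 D (nfA2 \<sigma> \<phi>) (nfA1 \<sigma> \<sigma>0 \<psi>) (affine_vf 1 0 \<sigma> 0 \<sigma> \<sigma>0)")
  case False
  have oD: "open D" using D(1) by (simp add: good_dom_def)
  from False obtain Q \<tau> \<rho> s1 s0 t1 where 1: "sym_data D Q \<tau> \<rho> s1 s0" "t1 \<in> fst ` D" "deriv \<tau> t1 \<noteq> 0"
    using span1_or_second_symmetry[OF D] by blast
  have "locally_equiv_to {4..7} D (nfA2 \<sigma> \<phi>) (nfA1 \<sigma> \<sigma>0 \<psi>)"
  proof (rule second_symmetry_constants[OF D 1])
    fix x1 r k n m L
    assume a: "(t1, x1) \<in> D" "r > 0"
     "{x1 * exp (- \<sigma> * t1) - r<..<x1 * exp (- \<sigma> * t1) + r} \<subseteq> J"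
     "\<And>y. y \<in> {x1 * exp (- \<sigma> * t1) - r<..<x1 * exp (- \<sigma> * t1) + r} \<Longrightarrow> comp_eqs 1 k n m L y"
     "k * m = m - \<sigma>" "(m + \<sigma>) * (L + n * (m + \<sigma>)) = \<sigma>0 * (k - 2)"
    show ?thesis
      by (rule equiv_to_maximal[OF \<sigma> oD D(2) a(1,3) _ a(4-6)]) (use a(2) in simp)
  qed
  then show ?thesis ..
qed simp

end

section \<open>Straightening a symmetry\<close>

text \<open>The chain rule needs joint differentiability, which follows from the partial derivative
  in \<open>t\<close> at the point and a continuous one in \<open>x\<close> nearby.\<close>

lemma smooth2_DERIV_curve:
  assumes D: "open D" and A: "smooth2 D A" and mem: "(s, X s) \<in> D"
    and X: "(X has_real_derivative v) (at s)"
  shows "((\<lambda>s. A s (X s)) has_real_derivative pdt A s (X s) + pdx A s (X s) * v) (at s)"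
proof -
  obtain r where r: "r > 0" "{s - r<..<s + r} \<times> {X s - r<..<X s + r} \<subseteq> D"
    using open_prod_box[OF D mem] by blast
  let ?S = "{s - r<..<s + r}" and ?Y = "{X s - r<..<X s + r}"
  have box: "(t, y) \<in> D" if "t \<in> ?S" "y \<in> ?Y" for t y using r(2) that by auto
  have sY: "s \<in> ?S" "X s \<in> ?Y" using r(1) by auto
  have "((\<lambda>(t, y). A t y) has_derivative (\<lambda>(ht, hy). pdt A s (X s) * ht + blinfun_mult_right (pdx A s (X s)) hy))
      (at (s, X s) within ?S \<times> ?Y)"
  proof (rule has_derivative_partialsI)
    show "((\<lambda>t. A t (X s)) has_derivative (*) (pdt A s (X s))) (at s within ?S)"
      using smooth2_DERIV(1)[OF A mem] has_field_derivative_imp_has_derivative has_derivative_at_withinI by blast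
    show "(A t has_derivative blinfun_apply (blinfun_mult_right (pdx A t y))) (at y within ?Y)"
      if "t \<in> ?S" "y \<in> ?Y" for t y
      using smooth2_DERIV(2)[OF A box[OF that]] has_field_derivative_imp_has_derivative has_derivative_at_withinI
      by (metis blinfun_mult_right.rep_eq)
    have "continuous_on (?S \<times> ?Y) (\<lambda>p. pdx A (fst p) (snd p))"
      by (rule continuous_on_subset[OF smooth2_continuous_on[OF smooth2_pdx[OF A]] r(2)])
    then have "continuous_on (?S \<times> ?Y) (\<lambda>p. blinfun_mult_right (pdx A (fst p) (snd p)))"
      by (intro bounded_linear.continuous_on[OF bounded_linear_blinfun_mult_right])
    then show "continuous (at (s, X s) within ?S \<times> ?Y) (\<lambda>(t, y). blinfun_mult_right (pdx A t y))"
      using sY by (auto simp: continuous_on_eq_continuous_within case_prod_unfold)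
  qed (use sY in auto)
  moreover have "at (s, X s) within ?S \<times> ?Y = at (s, X s)"
    by (rule at_within_open) (use sY in \<open>auto intro: open_Times\<close>)
  ultimately have dA: "((\<lambda>(t, y). A t y) has_derivative (\<lambda>(ht, hy). pdt A s (X s) * ht + blinfun_mult_right (pdx A s (X s)) hy))
      (at (s, X s))" by simp
  have dP: "((\<lambda>s. (s, X s)) has_derivative (\<lambda>h. (h, v * h))) (at s)"
    using X by (intro has_derivative_Pair has_derivative_ident) (simp add: has_field_derivative_def)
  have "((\<lambda>s. case (s, X s) of (t, y) \<Rightarrow> A t y) has_derivative
      (\<lambda>h. case (h, v * h) of (ht, hy) \<Rightarrow> pdt A s (X s) * ht + blinfun_mult_right (pdx A s (X s)) hy)) (at s)"
    by (rule has_derivative_compose[OF dP dA])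
  then have "((\<lambda>s. A s (X s)) has_derivative (\<lambda>h. pdt A s (X s) * h + pdx A s (X s) * (v * h))) (at s)"
    by simp
  then show ?thesis
    unfolding has_field_derivative_def by (rule has_derivative_eq_rhs) (auto simp: algebra_simps)
qed

lemma smooth1_affine_comp:
  assumes "open J" "smooth1 K f" "\<And>y. y \<in> J \<Longrightarrow> c * y \<in> K"
  shows "smooth1 J (\<lambda>y. f (c * y))"
  by (rule smooth1_compose[OF assms(1,2)]) (use assms in \<open>auto intro!: smooth1_intros\<close>)

text \<open>Straightening of the symmetry \<open>\<tau> \<partial>_t + \<xi> \<partial>_x + (s1 u + s0) \<partial>_u\<close>: choosing \<open>T' = 1 / \<tau>\<close> and
  \<open>X0' = s1 X0 / \<tau> - \<rho> / \<tau>^2\<close> turns \<open>(t, x) \<mapsto> (x / \<tau> + X0) exp (- s1 T)\<close> into an invariant, and along the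
  curves on which it is constant the coefficients satisfy linear ODEs.\<close>
lemma straightening:
  fixes A2 A1 :: "real \<Rightarrow> real \<Rightarrow> real"
  assumes D: "open D" and sm: "smooth2 D A2" "smooth2 D A1"
    and nz: "\<And>t x. (t, x) \<in> D \<Longrightarrow> A2 t x \<noteq> 0 \<and> pdx (pdx A1) t x \<noteq> 0"
    and tx0: "(t0, x0) \<in> D" and \<tau>0: "\<tau> t0 \<noteq> 0"
    and s\<tau>: "smooth1 (fst ` D) \<tau>" and s\<rho>: "smooth1 (fst ` D) \<rho>"
    and d\<tau>: "\<And>t. t \<in> fst ` D \<Longrightarrow> (\<tau> has_real_derivative \<tau>1 t) (at t)"
    and d\<tau>1: "\<And>t. t \<in> fst ` D \<Longrightarrow> (\<tau>1 has_real_derivative \<tau>2 t) (at t)"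
    and d\<rho>: "\<And>t. t \<in> fst ` D \<Longrightarrow> (\<rho> has_real_derivative \<rho>1 t) (at t)"
    and e2: "\<And>t x. (t, x) \<in> D \<Longrightarrow> \<tau> t * pdt A2 t x + ((\<tau>1 t + s1) * x + \<rho> t) * pdx A2 t x = (\<tau>1 t + 2 * s1) * A2 t x"
    and e1: "\<And>t x. (t, x) \<in> D \<Longrightarrow> \<tau> t * pdt A1 t x + ((\<tau>1 t + s1) * x + \<rho> t) * pdx A1 t x
        = s1 * A1 t x + s0 - \<tau>2 t * x - \<rho>1 t"
    and \<sigma>: "s1 * \<sigma>0 = 0" "s0 = s1 * U0 + \<sigma>0"
  obtains \<Omega> T X0 \<phi> \<psi> J where "\<Omega> \<subseteq> D" "open \<Omega>" "convex \<Omega>" "\<Omega> \<noteq> {}" "adm_phipsi J \<phi> \<psi>"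
    "equiv_map \<Omega> T X0 U0 1 A2 A1 (nfA2 s1 \<phi>) (nfA1 s1 \<sigma>0 \<psi>)" "eq_pt T X0 1 ` \<Omega> \<subseteq> nf_dom s1 J"
proof -
  have "open (D \<inter> (fst -` {t \<in> fst ` D. \<tau> t \<noteq> 0}))"
  proof -
    have "open {t \<in> fst ` D. \<tau> t \<noteq> 0}"
      using continuous_open_preimage[OF smooth1_continuous_on[OF s\<tau>] open_fst_image[OF D], of "- {0}"]
      by (simp add: vimage_def Int_def open_Compl)
    then show ?thesis by (intro open_Int D open_vimage_fst)
  qed
  moreover have "(t0, x0) \<in> D \<inter> (fst -` {t \<in> fst ` D. \<tau> t \<noteq> 0})" using tx0 \<tau>0 by force
  ultimately obtain R where R: "R > 0" "{t0 - R<..<t0 + R} \<times> {x0 - R<..<x0 + R} \<subseteq> D \<inter> (fst -` {t \<in> fst ` D. \<tau> t \<noteq> 0})"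
    by (rule open_prod_box)
  define I where "I = {t0 - R<..<t0 + R}"
  have t0I: "t0 \<in> I" using R(1) by (simp add: I_def)
  have oI: "open I" by (simp add: I_def)
  have I: "t \<in> fst ` D" "\<tau> t \<noteq> 0" if "t \<in> I" for t
  proof -
    have "(t, x0) \<in> D \<inter> (fst -` {t \<in> fst ` D. \<tau> t \<noteq> 0})"
      using that R(1) by (intro subsetD[OF R(2)]) (simp add: I_def)
    then show "t \<in> fst ` D" "\<tau> t \<noteq> 0" by auto
  qed
  have box: "(t, x) \<in> D" if "t \<in> I" "x \<in> {x0 - R<..<x0 + R}" for t x
    using subsetD[OF R(2), of "(t, x)"] that by (simp add: I_def)
  have sI: "smooth1 I \<tau>" "smooth1 I \<rho>"
    using smooth1_subset[OF s\<tau>, of I] smooth1_subset[OF s\<rho>, of I] I(1) by (simp_all add: subsetI)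
  have "smooth1 I (\<lambda>t. 1 / \<tau> t)" by (intro smooth1_divide oI sI smooth1_const I)
  then obtain T where T: "smooth1 I T" "T t0 = 0" "\<And>t. t \<in> I \<Longrightarrow> (T has_real_derivative 1 / \<tau> t) (at t)"
    using smooth1_antiderivative[OF R(1), of t0] unfolding I_def by blast
  have "smooth1 I (\<lambda>t. - (exp (- s1 * T t) * (\<rho> t / (\<tau> t * \<tau> t))))"
    using I(2) by (intro smooth1_minus smooth1_mult smooth1_divide smooth1_exp_comp smooth1_const oI sI T(1)) auto
  then obtain Z where Z: "smooth1 I Z" "Z t0 = 0"
    "\<And>t. t \<in> I \<Longrightarrow> (Z has_real_derivative - (exp (- s1 * T t) * (\<rho> t / (\<tau> t * \<tau> t)))) (at t)"
    using smooth1_antiderivative[OF R(1), of t0] unfolding I_def by blast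
  \<comment> \<open>Variation of constants for the linear equation that \<open>X0\<close> has to
    satisfy.\<close>
  define X0 where "X0 t = exp (s1 * T t) * Z t" for t
  have X0: "smooth1 I X0" "X0 t0 = 0"
    unfolding X0_def[abs_def] using T(1) Z(1,2) by (auto intro!: smooth1_mult smooth1_exp_comp oI smooth1_const)
  have dX0: "(X0 has_real_derivative s1 * X0 t / \<tau> t - \<rho> t / (\<tau> t * \<tau> t)) (at t)" if t: "t \<in> I" for t
  proof -
    have "exp (s1 * T t) * exp (- s1 * T t) = 1" by (simp flip: exp_add)
    then have *: "exp (s1 * T t) * (exp (- s1 * T t) * z) = z" for z by (simp only: mult_1 mult.assoc[symmetric])
    have "(X0 has_real_derivative (exp (s1 * T t) * (s1 * (1 / \<tau> t))) * Z t + - (exp (- s1 * T t) * (\<rho> t / (\<tau> t * \<tau> t))) * exp (s1 * T t)) (at t)"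
      unfolding X0_def[abs_def]
      by (rule DERIV_mult[OF _ Z(3)[OF t]]) (auto intro!: derivative_eq_intros T(3)[OF t])
    moreover have "(exp (s1 * T t) * (s1 * (1 / \<tau> t))) * Z t + - (exp (- s1 * T t) * (\<rho> t / (\<tau> t * \<tau> t))) * exp (s1 * T t)
      = s1 * X0 t / \<tau> t - exp (s1 * T t) * (exp (- s1 * T t) * (\<rho> t / (\<tau> t * \<tau> t)))"
      by (simp add: X0_def mult_ac)
    ultimately show ?thesis unfolding * by simp
  qed
  note d = d\<tau>[OF I(1)] d\<tau>1[OF I(1)] d\<rho>[OF I(1)]
  define inv where "inv t x = (x / \<tau> t + X0 t) * exp (- s1 * T t)" for t x
  \<comment> \<open>\<open>curve y\<close> solves \<open>inv s x = y\<close> for \<open>x\<close>;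
    it is an integral curve of the symmetry, parametrised by \<open>t\<close>.\<close>
  define curve where "curve y s = \<tau> s * (y * exp (s1 * T s) - X0 s)" for y s
  have curve_inv: "curve (inv t x) t = x" if "t \<in> I" for t x
    using I(2)[OF that] by (simp add: curve_def inv_def mult.assoc flip: exp_add)
  define y0 where "y0 = inv t0 x0"
  have co: "continuous_on (I \<times> UNIV) (\<lambda>p. \<tau> (fst p))" "continuous_on (I \<times> UNIV) (\<lambda>p. X0 (fst p))"
    "continuous_on (I \<times> UNIV) (\<lambda>p. T (fst p))"
    using smooth1_continuous_on[OF sI(1)] smooth1_continuous_on[OF X0(1)] smooth1_continuous_on[OF T(1)]
    by (auto intro!: continuous_on_compose2[of I _ "I \<times> UNIV" fst] continuous_intros)
  have oIU: "open (I \<times> (UNIV :: real set))" by (intro open_Times oI open_UNIV)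
  have "continuous_on (I \<times> UNIV) (\<lambda>p. curve (snd p) (fst p))"
    unfolding curve_def by (intro continuous_intros co)
  then have "open ((I \<times> UNIV) \<inter> (\<lambda>p. curve (snd p) (fst p)) -` {x0 - R<..<x0 + R})"
    by (rule continuous_open_preimage[OF _ oIU open_greaterThanLessThan])
  moreover have "(t0, y0) \<in> (I \<times> UNIV) \<inter> (\<lambda>p. curve (snd p) (fst p)) -` {x0 - R<..<x0 + R}"
    using t0I R(1) by (simp add: y0_def curve_inv)
  ultimately obtain r where r: "r > 0"
    "{t0 - r<..<t0 + r} \<times> {y0 - r<..<y0 + r} \<subseteq> (I \<times> UNIV) \<inter> (\<lambda>p. curve (snd p) (fst p)) -` {x0 - R<..<x0 + R}"
    by (rule open_prod_box)
  define J where "J = {y0 - r<..<y0 + r}"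
  have "continuous_on (I \<times> UNIV) (\<lambda>p. inv (fst p) (snd p))"
    unfolding inv_def by (intro continuous_intros co) (use I(2) in auto)
  then have "open ((I \<times> UNIV) \<inter> (\<lambda>p. inv (fst p) (snd p)) -` J)"
    unfolding J_def by (rule continuous_open_preimage[OF _ oIU open_greaterThanLessThan])
  then have "open (((I \<times> UNIV) \<inter> (\<lambda>p. inv (fst p) (snd p)) -` J) \<inter> {t0 - r<..<t0 + r} \<times> {x0 - R<..<x0 + R})"
    by (rule open_Int[OF _ open_Times[OF open_greaterThanLessThan open_greaterThanLessThan]])
  moreover have "(t0, x0) \<in> ((I \<times> UNIV) \<inter> (\<lambda>p. inv (fst p) (snd p)) -` J) \<inter> {t0 - r<..<t0 + r} \<times> {x0 - R<..<x0 + R}"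
    using t0I r(1) R(1) by (simp add: J_def y0_def)
  ultimately obtain q where q: "q > 0" "{t0 - q<..<t0 + q} \<times> {x0 - q<..<x0 + q}
      \<subseteq> ((I \<times> UNIV) \<inter> (\<lambda>p. inv (fst p) (snd p)) -` J) \<inter> {t0 - r<..<t0 + r} \<times> {x0 - R<..<x0 + R}"
    by (rule open_prod_box)
  \<comment> \<open>Two nested boxes: \<open>r\<close> keeps the curves with parameter in
    \<open>J\<close> inside \<open>D\<close> for times within \<open>r\<close> of \<open>t0\<close>,
    and \<open>q\<close> keeps the parameters of the points of \<Omega> inside \<open>J\<close>. So
    every point of \<Omega> is joined to the slice \<open>t = t0\<close> within
    \<open>D\<close>.\<close>
  define \<Omega> where "\<Omega> = {t0 - q<..<t0 + q} \<times> {x0 - q<..<x0 + q}"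
  have \<Omega>: "t \<in> I \<and> inv t x \<in> J \<and> t \<in> {t0 - r<..<t0 + r} \<and> (t, x) \<in> D" if "(t, x) \<in> \<Omega>" for t x
    using subsetD[OF q(2), of "(t, x)"] that box[of t x] by (simp add: \<Omega>_def)
  let ?I' = "{t0 - r<..<t0 + r}"
  have onD: "s \<in> I \<and> (s, curve y s) \<in> D" if "s \<in> ?I'" "y \<in> J" for s y
  proof -
    have "(s, y) \<in> (I \<times> UNIV) \<inter> (\<lambda>p. curve (snd p) (fst p)) -` {x0 - R<..<x0 + R}"
      using that by (intro subsetD[OF r(2)]) (simp add: J_def)
    then show ?thesis using box by auto
  qed
  \<comment> \<open>As \<open>T\<close> and \<open>X0\<close> vanish at \<open>t0\<close>, these are
    the transformed coefficients on the slice \<open>t = t0\<close>, which the curve with parameter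
    \<open>y\<close> meets at \<open>\<tau> t0 * y\<close>.\<close>
  define \<psi> where "\<psi> y = A1 t0 (\<tau> t0 * y) + U0 + ((\<tau>1 t0 + s1) * (\<tau> t0 * y) + \<rho> t0) / \<tau> t0 - s1 * y" for y
  define \<phi> where "\<phi> y = A2 t0 (\<tau> t0 * y) / \<tau> t0" for y
  have c0: "curve y t0 = \<tau> t0 * y" for y by (simp add: curve_def T(2) X0(2))
  have dcurve: "(curve y has_real_derivative ((\<tau>1 s + s1) * curve y s + \<rho> s) / \<tau> s) (at s)" if s: "s \<in> I" for y s
  proof -
    have "(curve y has_real_derivative \<tau>1 s * (y * exp (s1 * T s) - X0 s)
        + (y * (exp (s1 * T s) * (s1 * (1 / \<tau> s))) - (s1 * X0 s / \<tau> s - \<rho> s / (\<tau> s * \<tau> s))) * \<tau> s) (at s)"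
      unfolding curve_def[abs_def]
      by (rule DERIV_mult[OF d(1)[OF s]]) (auto intro!: derivative_eq_intros T(3)[OF s] dX0[OF s])
    moreover have "\<tau>1 s * (y * exp (s1 * T s) - X0 s)
        + (y * (exp (s1 * T s) * (s1 * (1 / \<tau> s))) - (s1 * X0 s / \<tau> s - \<rho> s / (\<tau> s * \<tau> s))) * \<tau> s
       = ((\<tau>1 s + s1) * curve y s + \<rho> s) / \<tau> s"
      using I(2)[OF s] unfolding curve_def by (simp add: field_simps)
    ultimately show ?thesis by simp
  qed
  have A1_curve: "A1 s (curve y s) + U0 + ((\<tau>1 s + s1) * curve y s + \<rho> s) / \<tau> s - s1 * (y * exp (s1 * T s))
     = exp (s1 * T s) * \<psi> y + \<sigma>0 * T s" if y: "y \<in> J" and s': "s \<in> ?I'" for y s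
  proof -
    \<comment> \<open>\<open>At\<close> is the transformed \<open>A1\<close> along the curve. It
      satisfies \<open>At' = (s1 * At + \<sigma>0) / \<tau>\<close>, and \<open>H\<close> is
      constant because \<open>s1 * \<sigma>0 = 0\<close>.\<close>
    define At where "At s = A1 s (curve y s) + U0 + ((\<tau>1 s + s1) * curve y s + \<rho> s) / \<tau> s - s1 * (y * exp (s1 * T s))" for s
    define H where "H s = exp (- s1 * T s) * (At s - \<sigma>0 * T s)" for s
    have "(H has_real_derivative 0) (at s)" if s: "s \<in> ?I'" for s
    proof -
      note sI = conjunct1[OF onD[OF s y]] and sD = conjunct2[OF onD[OF s y]]
      note nz = I(2)[OF sI]
      define x v where "x = curve y s" "v = ((\<tau>1 s + s1) * x + \<rho> s) / \<tau> s"
      note xv = this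
      have dx: "(curve y has_real_derivative v) (at s)" using dcurve[OF sI] by (simp add: xv)
      have v\<tau>: "v * \<tau> s = (\<tau>1 s + s1) * x + \<rho> s" using nz by (simp add: xv)
      have dA: "((\<lambda>s. A1 s (curve y s)) has_real_derivative (s1 * A1 s x + s0 - \<tau>2 s * x - \<rho>1 s) / \<tau> s) (at s)"
      proof (rule DERIV_cong[OF smooth2_DERIV_curve[OF D sm(2) sD dx]])
        have "\<tau> s * (pdt A1 s x + pdx A1 s x * v) = \<tau> s * pdt A1 s x + (v * \<tau> s) * pdx A1 s x"
          by (simp add: algebra_simps)
        then have "\<tau> s * (pdt A1 s x + pdx A1 s x * v) = s1 * A1 s x + s0 - \<tau>2 s * x - \<rho>1 s"
          using e1[OF sD] unfolding v\<tau> xv(1) by simp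
        then show "pdt A1 s (curve y s) + pdx A1 s (curve y s) * v = (s1 * A1 s x + s0 - \<tau>2 s * x - \<rho>1 s) / \<tau> s"
          using nz by (simp add: xv(1) field_simps)
      qed
      have dxi: "((\<lambda>s. ((\<tau>1 s + s1) * curve y s + \<rho> s) / \<tau> s) has_real_derivative
         ((\<tau>2 s * x + (\<tau>1 s + s1) * v + \<rho>1 s) * \<tau> s - (v * \<tau> s) * \<tau>1 s) / (\<tau> s * \<tau> s)) (at s)"
      proof (rule DERIV_cong[OF DERIV_divide[OF _ d(1)[OF sI] nz]])
        show "((\<lambda>s. (\<tau>1 s + s1) * curve y s + \<rho> s) has_real_derivative \<tau>2 s * x + (\<tau>1 s + s1) * v + \<rho>1 s) (at s)"
          by (rule derivative_eq_intros d(2,3)[OF sI] dx refl)+ (simp add: xv(1))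
      qed (simp add: v\<tau> xv(1))
      have dE: "((\<lambda>s. s1 * (y * exp (s1 * T s))) has_real_derivative s1 * (y * (exp (s1 * T s) * (s1 * (1 / \<tau> s))))) (at s)"
        by (auto intro!: derivative_eq_intros T(3)[OF sI])
      have "(At has_real_derivative (s1 * A1 s x + s0 - \<tau>2 s * x - \<rho>1 s) / \<tau> s
          + ((\<tau>2 s * x + (\<tau>1 s + s1) * v + \<rho>1 s) * \<tau> s - (v * \<tau> s) * \<tau>1 s) / (\<tau> s * \<tau> s)
          - s1 * (y * (exp (s1 * T s) * (s1 * (1 / \<tau> s))))) (at s)"
        unfolding At_def[abs_def]
        by (rule DERIV_diff[OF DERIV_add[OF _ dxi] dE]) (use DERIV_add[OF dA DERIV_const] in simp)
      moreover have "(s1 * A1 s x + s0 - \<tau>2 s * x - \<rho>1 s) / \<tau> s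
          + ((\<tau>2 s * x + (\<tau>1 s + s1) * v + \<rho>1 s) * \<tau> s - (v * \<tau> s) * \<tau>1 s) / (\<tau> s * \<tau> s)
          - s1 * (y * (exp (s1 * T s) * (s1 * (1 / \<tau> s))))
          = (s1 * (A1 s x + v - s1 * (y * exp (s1 * T s))) + s0) / \<tau> s"
        using nz by (simp add: field_simps)
      moreover have "A1 s x + v - s1 * (y * exp (s1 * T s)) = At s - U0" by (simp add: At_def xv)
      moreover have "s1 * (At s - U0) + s0 = s1 * At s + \<sigma>0" using \<sigma>(2) by (simp add: algebra_simps)
      ultimately have dAt: "(At has_real_derivative (s1 * At s + \<sigma>0) / \<tau> s) (at s)"
        by (simp only:)
      have "(H has_real_derivative (exp (- s1 * T s) * (- s1 * (1 / \<tau> s))) * (At s - \<sigma>0 * T s)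
          + ((s1 * At s + \<sigma>0) / \<tau> s - \<sigma>0 * (1 / \<tau> s)) * exp (- s1 * T s)) (at s)"
        unfolding H_def[abs_def]
        by (rule DERIV_mult[OF _ DERIV_diff[OF dAt DERIV_cmult[OF T(3)[OF sI]]]])
          (auto intro!: derivative_eq_intros T(3)[OF sI])
      moreover have "(exp (- s1 * T s) * (- s1 * (1 / \<tau> s))) * (At s - \<sigma>0 * T s)
          + ((s1 * At s + \<sigma>0) / \<tau> s - \<sigma>0 * (1 / \<tau> s)) * exp (- s1 * T s) = exp (- s1 * T s) * ((s1 * \<sigma>0) * T s) / \<tau> s"
        using nz by (simp add: field_simps)
      ultimately show ?thesis using \<sigma>(1) by simp
    qed
    then obtain C where C: "\<And>s. s \<in> ?I' \<Longrightarrow> H s = C"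
      using interval_constant[of ?I' H] by auto
    have "H t0 = \<psi> y" unfolding H_def At_def c0 by (simp add: T(2) \<psi>_def)
    then have "H s = \<psi> y" using C[OF s'] C[of t0] r(1) by simp
    then have "exp (s1 * T s) * H s = exp (s1 * T s) * \<psi> y" by simp
    moreover have "exp (s1 * T s) * H s = At s - \<sigma>0 * T s"
      by (simp add: H_def flip: exp_add mult.assoc)
    ultimately show ?thesis by (simp add: At_def)
  qed
  have A2_curve: "A2 s (curve y s) / \<tau> s = exp (2 * s1 * T s) * \<phi> y" if y: "y \<in> J" and s': "s \<in> ?I'" for y s
  proof -
    \<comment> \<open>\<open>A2 / \<tau> = T' * A2\<close> is the transformed coefficient; along the
      curve its logarithmic derivative is \<open>2 * s1 / \<tau> = 2 * s1 * T'\<close>.\<close>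
    define H where "H s = exp (- (2 * s1) * T s) * (A2 s (curve y s) / \<tau> s)" for s
    have "(H has_real_derivative 0) (at s)" if s: "s \<in> ?I'" for s
    proof -
      note sI = conjunct1[OF onD[OF s y]] and sD = conjunct2[OF onD[OF s y]]
      note nz = I(2)[OF sI]
      define x v where "x = curve y s" "v = ((\<tau>1 s + s1) * x + \<rho> s) / \<tau> s"
      note xv = this
      have dx: "(curve y has_real_derivative v) (at s)" using dcurve[OF sI] by (simp add: xv)
      have v\<tau>: "v * \<tau> s = (\<tau>1 s + s1) * x + \<rho> s" using nz by (simp add: xv)
      have dA: "((\<lambda>s. A2 s (curve y s)) has_real_derivative ((\<tau>1 s + 2 * s1) * A2 s x) / \<tau> s) (at s)"
      proof (rule DERIV_cong[OF smooth2_DERIV_curve[OF D sm(1) sD dx]])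
        have "\<tau> s * (pdt A2 s x + pdx A2 s x * v) = \<tau> s * pdt A2 s x + (v * \<tau> s) * pdx A2 s x"
          by (simp add: algebra_simps)
        then have "\<tau> s * (pdt A2 s x + pdx A2 s x * v) = (\<tau>1 s + 2 * s1) * A2 s x"
          using e2[OF sD] unfolding v\<tau> xv(1) by simp
        then show "pdt A2 s (curve y s) + pdx A2 s (curve y s) * v = ((\<tau>1 s + 2 * s1) * A2 s x) / \<tau> s"
          using nz by (simp add: xv(1) field_simps)
      qed
      have "(H has_real_derivative (exp (- (2 * s1) * T s) * (- (2 * s1) * (1 / \<tau> s))) * (A2 s (curve y s) / \<tau> s)
          + (((\<tau>1 s + 2 * s1) * A2 s x) / \<tau> s * \<tau> s - A2 s (curve y s) * \<tau>1 s) / (\<tau> s * \<tau> s) * exp (- (2 * s1) * T s)) (at s)"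
        unfolding H_def[abs_def]
        by (rule DERIV_mult[OF _ DERIV_divide[OF dA d(1)[OF sI] nz]])
          (auto intro!: derivative_eq_intros T(3)[OF sI])
      moreover have "(exp (- (2 * s1) * T s) * (- (2 * s1) * (1 / \<tau> s))) * (A2 s (curve y s) / \<tau> s)
          + (((\<tau>1 s + 2 * s1) * A2 s x) / \<tau> s * \<tau> s - A2 s (curve y s) * \<tau>1 s) / (\<tau> s * \<tau> s) * exp (- (2 * s1) * T s) = 0"
        using nz by (simp add: field_simps xv(1))
      ultimately show ?thesis by (simp only:)
    qed
    then obtain C where C: "\<And>s. s \<in> ?I' \<Longrightarrow> H s = C"
      using interval_constant[of ?I' H] by auto
    have "H t0 = \<phi> y" unfolding H_def c0 by (simp add: T(2) \<phi>_def)
    then have "H s = \<phi> y" using C[OF s'] C[of t0] r(1) by simp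
    then have "exp (2 * s1 * T s) * H s = exp (2 * s1 * T s) * \<phi> y" by simp
    moreover have "exp (2 * s1 * T s) * H s = A2 s (curve y s) / \<tau> s"
      by (simp add: H_def flip: exp_add mult.assoc)
    ultimately show ?thesis by simp
  qed
  have t0y: "(t0, \<tau> t0 * y) \<in> D" if "y \<in> J" for y
    using onD[OF _ that, of t0] r(1) by (simp add: c0)
  have oJ: "open J" by (simp add: J_def)
  have sAt: "smooth1 J (\<lambda>y. A (t0 :: real) (\<tau> t0 * y))" if "smooth2 D A" for A
    by (rule smooth1_affine_comp[OF oJ smooth2_slice_x[OF that, of t0]]) (use t0y in simp)
  have adm: "adm_phipsi J \<phi> \<psi>"
    unfolding adm_phipsi_def
  proof (intro conjI ballI)
    show "smooth1 J \<phi>" unfolding \<phi>_def[abs_def]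
      by (intro smooth1_divide smooth1_const sAt sm oJ) (rule \<tau>0)
    show "smooth1 J \<psi>" unfolding \<psi>_def[abs_def]
      by (intro smooth1_add smooth1_diff smooth1_divide smooth1_mult smooth1_const smooth1_ident sAt sm oJ) (rule \<tau>0)
    fix y assume y: "y \<in> J"
    show "\<phi> y \<noteq> 0" using nz[OF t0y[OF y]] \<tau>0 by (simp add: \<phi>_def)
    have d1: "(\<psi> has_real_derivative pdx A1 t0 (\<tau> t0 * y) * \<tau> t0 + (\<tau>1 t0 + s1) - s1) (at y)" if "y \<in> J" for y
    proof -
      have "((\<lambda>y. A1 t0 (\<tau> t0 * y)) has_real_derivative pdx A1 t0 (\<tau> t0 * y) * \<tau> t0) (at y)"
        by (rule DERIV_chain2[of "A1 t0" _ "\<lambda>y. \<tau> t0 * y" y, OF smooth2_DERIV(2)[OF sm(2) t0y[OF that]]])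
          (auto intro!: derivative_eq_intros)
      then show ?thesis unfolding \<psi>_def[abs_def] using \<tau>0 by (auto intro!: derivative_eq_intros)
    qed
    have "deriv (deriv \<psi>) y = deriv (\<lambda>y. pdx A1 t0 (\<tau> t0 * y) * \<tau> t0 + (\<tau>1 t0 + s1) - s1) y"
      by (rule deriv_cong_open[OF oJ DERIV_imp_deriv[OF d1] y])
    also have "\<dots> = pdx (pdx A1) t0 (\<tau> t0 * y) * \<tau> t0 * \<tau> t0"
    proof (rule DERIV_imp_deriv)
      have "((\<lambda>y. pdx A1 t0 (\<tau> t0 * y)) has_real_derivative pdx (pdx A1) t0 (\<tau> t0 * y) * \<tau> t0) (at y)"
        by (rule DERIV_chain2[of "pdx A1 t0" _ "\<lambda>y. \<tau> t0 * y" y, OF smooth2_DERIV(2)[OF smooth2_pdx[OF sm(2)] t0y[OF y]]])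
          (auto intro!: derivative_eq_intros)
      then show "((\<lambda>y. pdx A1 t0 (\<tau> t0 * y) * \<tau> t0 + (\<tau>1 t0 + s1) - s1) has_real_derivative
         pdx (pdx A1) t0 (\<tau> t0 * y) * \<tau> t0 * \<tau> t0) (at y)"
        by (auto intro!: derivative_eq_intros)
    qed
    finally show "deriv (deriv \<psi>) y \<noteq> 0" using nz[OF t0y[OF y]] \<tau>0 by simp
  qed (rule oJ)
  have dT: "deriv T t = 1 / \<tau> t" if "t \<in> I" for t using T(3)[OF that] by (rule DERIV_imp_deriv)
  have ddT: "deriv (deriv T) t = - \<tau>1 t / (\<tau> t * \<tau> t)" if t: "t \<in> I" for t
  proof -
    have "deriv (deriv T) t = deriv (\<lambda>t. 1 / \<tau> t) t" by (rule deriv_cong_open[OF oI dT t])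
    also have "\<dots> = (0 * \<tau> t - 1 * \<tau>1 t) / (\<tau> t * \<tau> t)"
      by (rule DERIV_imp_deriv[OF DERIV_divide[OF DERIV_const d(1)[OF t] I(2)[OF t]]])
    finally show ?thesis by simp
  qed
  have "fst ` \<Omega> \<subseteq> I" using \<Omega> by auto
  then have sT: "smooth1 (fst ` \<Omega>) T" "smooth1 (fst ` \<Omega>) X0" using T(1) X0(1) smooth1_subset by blast+
  have eq: "equiv_map \<Omega> T X0 U0 1 A2 A1 (nfA2 s1 \<phi>) (nfA1 s1 \<sigma>0 \<psi>)"
    unfolding equiv_map_def
  proof (intro conjI allI impI)
    fix t x assume tx: "(t, x) \<in> \<Omega>"
    note t = conjunct1[OF \<Omega>[OF tx]]
    have y: "inv t x \<in> J" and t': "t \<in> ?I'" using \<Omega>[OF tx] by auto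
    note nz = I(2)[OF t]
    show "deriv T t \<noteq> 0" using dT[OF t] nz by simp
    have w: "deriv T t * 1 * x + X0 t = x / \<tau> t + X0 t" using dT[OF t] by simp
    have i: "(x / \<tau> t + X0 t) * exp (- s1 * T t) = inv t x" by (simp add: inv_def)
    have ie: "inv t x * exp (s1 * T t) = x / \<tau> t + X0 t" by (simp add: inv_def mult.assoc flip: exp_add)
    show "nfA2 s1 \<phi> (T t) (deriv T t * 1 * x + X0 t) = deriv T t * 1\<^sup>2 * A2 t x"
      using A2_curve[OF y t'] unfolding w nfA2_def i curve_inv[OF t] by (simp add: dT[OF t])
    have "nfA1 s1 \<sigma>0 \<psi> (T t) (deriv T t * 1 * x + X0 t)
      = A1 t x + U0 + ((\<tau>1 t + s1) * x + \<rho> t) / \<tau> t - s1 * (x / \<tau> t + X0 t)"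
      using A1_curve[OF y t'] unfolding w nfA1_def i curve_inv[OF t] ie by simp
    also have "\<dots> = 1 * A1 t x + U0 - (deriv (deriv T) t * 1 * x + deriv X0 t) / deriv T t"
      unfolding dT[OF t] ddT[OF t] DERIV_imp_deriv[OF dX0[OF t]] using nz by (simp add: field_simps)
    finally show "nfA1 s1 \<sigma>0 \<psi> (T t) (deriv T t * 1 * x + X0 t)
      = 1 * A1 t x + U0 - (deriv (deriv T) t * 1 * x + deriv X0 t) / deriv T t" .
  qed (use sT in auto)
  have "eq_pt T X0 1 ` \<Omega> \<subseteq> nf_dom s1 J"
  proof
    fix p assume "p \<in> eq_pt T X0 1 ` \<Omega>"
    then obtain t x where tx: "(t, x) \<in> \<Omega>" "p = (T t, x / \<tau> t + X0 t)"
      using dT \<Omega> by (force simp: eq_pt_def)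
    then show "p \<in> nf_dom s1 J" using \<Omega>[OF tx(1)] by (simp add: nf_dom_def inv_def)
  qed
  moreover have "\<Omega> \<subseteq> D" using \<Omega> by auto
  moreover have "open \<Omega>" "convex \<Omega>" "\<Omega> \<noteq> {}" using q(1) by (auto simp: \<Omega>_def open_Times convex_Times)
  ultimately show ?thesis using that adm eq by blast
qed

section \<open>Completeness of the list and assembly of its cases\<close>

lemma one_parameter_cases_nf:
  "c1A2 \<phi> = nfA2 0 \<phi>" "c1A1 \<psi> = nfA1 0 0 \<psi>" "c2A2 \<phi> = nfA2 0 \<phi>" "c2A1 \<psi> = nfA1 0 1 \<psi>"
  "c3A2 \<phi> = nfA2 (- 1) \<phi>" "c3A1 \<psi> = nfA1 (- 1) 0 \<psi>"
  "domJ J = nf_dom 0 J" "domJ3 J = nf_dom (- 1) J"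
  by (simp_all add: c1A2_def c1A1_def c2A2_def c2A1_def c3A2_def c3A1_def nfA2_def nfA1_def domJ_def domJ3_def nf_dom_def)

lemma listed_case_nf:
  assumes "(\<sigma>, \<sigma>0) \<in> {(0, 0), (0, 1), (- 1, 0)}" "adm_phipsi J \<phi> \<psi>" "D \<subseteq> nf_dom \<sigma> J"
  shows "\<exists>k\<in>{1..7}. listed_case k (nfA2 \<sigma> \<phi>) (nfA1 \<sigma> \<sigma>0 \<psi>) D"
proof -
  consider "\<sigma> = 0" "\<sigma>0 = 0" | "\<sigma> = 0" "\<sigma>0 = 1" | "\<sigma> = - 1" "\<sigma>0 = 0" using assms(1) by auto
  then show ?thesis
  proof cases
    case 1
    then have "listed_case 1 (nfA2 \<sigma> \<phi>) (nfA1 \<sigma> \<sigma>0 \<psi>) D"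
      unfolding listed_case_def one_parameter_cases_nf using assms(2,3) by (intro disjI1) auto
    then show ?thesis by force
  next
    case 2
    then have "listed_case 2 (nfA2 \<sigma> \<phi>) (nfA1 \<sigma> \<sigma>0 \<psi>) D"
      unfolding listed_case_def one_parameter_cases_nf using assms(2,3) by (intro disjI2[OF disjI1]) auto
    then show ?thesis by force
  next
    case 3
    then have "listed_case 3 (nfA2 \<sigma> \<phi>) (nfA1 \<sigma> \<sigma>0 \<psi>) D"
      unfolding listed_case_def one_parameter_cases_nf using assms(2,3) by (intro disjI2[OF disjI2[OF disjI1]]) auto
    then show ?thesis by force
  qed
qed

text \<open>Differentiating the condition in \<open>x\<close> leaves
  \<open>(s1 x + \<rho>) A1_xx = 0\<close>, so the x-component vanishes on an open set, and with it
  \<open>s1\<close>, \<rho> and finally \<open>s0\<close>.\<close>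

lemma symmetry_without_time_component:
  assumes D: "open D" "convex D" and sm: "smooth2 D A1" and A1: "\<And>t x. (t, x) \<in> D \<Longrightarrow> pdx (pdx A1) t x \<noteq> 0"
    and e1: "\<And>t x. (t, x) \<in> D \<Longrightarrow> (s1 * x + \<rho> t) * pdx A1 t x = s1 * A1 t x + s0 - deriv \<rho> t"
    and tx: "(t, x) \<in> D"
  shows "s1 = 0 \<and> \<rho> t = 0 \<and> s0 = 0"
proof -
  have xi: "s1 * x + \<rho> t = 0" if tx: "(t, x) \<in> D" for t x
  proof -
    have "((\<lambda>y. (s1 * y + \<rho> t) * pdx A1 t y) has_real_derivative s1 * pdx A1 t x + (s1 * x + \<rho> t) * pdx (pdx A1) t x) (at x)"
      by (auto intro!: derivative_eq_intros smooth2_DERIV(2)[OF smooth2_pdx[OF sm] tx])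
    moreover have "((\<lambda>y. (s1 * y + \<rho> t) * pdx A1 t y) has_real_derivative s1 * pdx A1 t x) (at x)"
    proof (rule has_field_derivative_transform_within_open[OF _ open_slices(2)[OF D(1), of t]])
      show "((\<lambda>y. s1 * A1 t y + s0 - deriv \<rho> t) has_real_derivative s1 * pdx A1 t x) (at x)"
        by (auto intro!: derivative_eq_intros smooth2_DERIV(2)[OF sm tx])
    qed (use tx e1 in auto)
    ultimately have "s1 * pdx A1 t x + (s1 * x + \<rho> t) * pdx (pdx A1) t x = s1 * pdx A1 t x" by (rule DERIV_unique)
    then show ?thesis using A1[OF tx] by simp
  qed
  obtain r where r: "r > 0" "{t - r<..<t + r} \<times> {x - r<..<x + r} \<subseteq> D"
    using open_prod_box[OF D(1) tx] by blast
  have "s1 * (x + r / 2) + \<rho> t = 0" by (rule xi[OF subsetD[OF r(2)]]) (use r(1) in auto)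
  then have "s1 * (x + r / 2) = s1 * x" using xi[OF tx] by linarith
  then have s1: "s1 = 0" using r(1) by simp
  have \<rho>: "\<rho> t = 0" if "t \<in> fst ` D" for t using xi that s1 by force
  have tI: "t \<in> fst ` D" using tx by force
  have "deriv \<rho> t = 0" by (rule deriv_zero_on_open[OF open_fst_image[OF D(1)] tI \<rho>])
  then show ?thesis using e1[OF tx] s1 \<rho>[OF tI] by simp
qed

text \<open>On a box around a point where the symmetry is nonzero, \<tau> cannot vanish identically;
  the symmetry is rectified near a point of the box with \<tau> nonzero.\<close>

lemma completeness:
  assumes cls: "in_class \<Omega> A2 A1" and sym: "is_sym \<Omega> A2 A1 Q" and nz: "\<not> vf_agree \<Omega> Q vzero"
  shows "locally_equiv_to {1..7} \<Omega> A2 A1"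
proof -
  obtain t x u where tx: "(t, x) \<in> \<Omega>"
    and nzQ: "\<not> (vtau Q t x u = 0 \<and> vxi Q t x u = 0 \<and> veta Q t x u = 0)"
    using nz by (auto simp: vf_agree_def basis_fields_affine)
  obtain r where r: "r > 0" "{t - r<..<t + r} \<times> {x - r<..<x + r} \<subseteq> \<Omega>"
    using open_prod_box[OF _ tx] cls by (auto simp: in_class_def)
  define D where "D = {t - r<..<t + r} \<times> {x - r<..<x + r}"
  have D: "open D" "convex D" "D \<subseteq> \<Omega>" "(t, x) \<in> D"
    using r by (auto simp: D_def open_Times convex_Times)
  have sm: "smooth2 D A2" "smooth2 D A1" and A: "A2 t x \<noteq> 0 \<and> pdx (pdx A1) t x \<noteq> 0" if "(t, x) \<in> D" for t x
    using cls D(3) smooth2_subset that by (auto simp: in_class_def)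
  note sm = sm[OF D(4)]
  have fst: "t \<in> fst ` D" if "(t, x) \<in> D" for t x using that by force
  show ?thesis
  proof (rule determining_equations[OF D(1,2) is_sym_subset[OF sym D(3)]])
    show "A2 t x \<noteq> 0" "pdx (pdx A1) t x \<noteq> 0" if "(t, x) \<in> D" for t x using A[OF that] by auto
    fix \<tau> \<rho> s1 s0
    assume s\<tau>: "smooth1 (fst ` D) \<tau>" and s\<rho>: "smooth1 (fst ` D) \<rho>"
      and Q: "\<And>t x u. (t, x) \<in> D \<Longrightarrow> vtau Q t x u = \<tau> t"
       "\<And>t x u. (t, x) \<in> D \<Longrightarrow> vxi Q t x u = (deriv \<tau> t + s1) * x + \<rho> t"
       "\<And>t x u. (t, x) \<in> D \<Longrightarrow> veta Q t x u = s1 * u + s0"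
      and e2: "\<And>t x. (t, x) \<in> D \<Longrightarrow> \<tau> t * pdt A2 t x + ((deriv \<tau> t + s1) * x + \<rho> t) * pdx A2 t x
        = (deriv \<tau> t + 2 * s1) * A2 t x"
      and e1: "\<And>t x. (t, x) \<in> D \<Longrightarrow> \<tau> t * pdt A1 t x + ((deriv \<tau> t + s1) * x + \<rho> t) * pdx A1 t x
        = s1 * A1 t x + s0 - deriv (deriv \<tau>) t * x - deriv \<rho> t"
    note oI = open_fst_image[OF D(1)]
    have "\<exists>t1\<in>fst ` D. \<tau> t1 \<noteq> 0"
    proof (rule ccontr)
      assume "\<not> (\<exists>t1\<in>fst ` D. \<tau> t1 \<noteq> 0)"
      then have \<tau>: "\<tau> t = 0" if "t \<in> fst ` D" for t using that by blast
      have d\<tau>: "deriv \<tau> t = 0" if "t \<in> fst ` D" for t by (rule deriv_zero_on_open[OF oI that \<tau>])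
      have dd\<tau>: "deriv (deriv \<tau>) t = 0" if "t \<in> fst ` D" for t by (rule deriv_zero_on_open[OF oI that d\<tau>])
      have "s1 = 0 \<and> \<rho> t = 0 \<and> s0 = 0"
      proof (rule symmetry_without_time_component[OF D(1,2) sm(2) conjunct2[OF A] _ D(4)])
        fix t x assume tx: "(t, x) \<in> D"
        show "(s1 * x + \<rho> t) * pdx A1 t x = s1 * A1 t x + s0 - deriv \<rho> t"
          using e1[OF tx] \<tau>[OF fst[OF tx]] d\<tau>[OF fst[OF tx]] dd\<tau>[OF fst[OF tx]] by simp
      qed
      then show False using nzQ Q[OF D(4)] \<tau>[OF fst[OF D(4)]] d\<tau>[OF fst[OF D(4)]] by simp
    qed
    then obtain t1 x1 where tx1: "(t1, x1) \<in> D" and \<tau>1: "\<tau> t1 \<noteq> 0" by force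
    \<comment> \<open>Rescaling the symmetry turns \<open>s1\<close> into -1 or, if
      \<open>s1 = 0\<close>, a nonzero \<open>s0\<close> into 1. For \<open>s1 \<noteq> 0\<close>
      the shift \<open>U0\<close> of \<open>u\<close> removes \<open>s0\<close>, which leaves the
      three pairs of Cases 1 to 3.\<close>
    define c where "c = (if s1 \<noteq> 0 then - 1 / s1 else if s0 \<noteq> 0 then 1 / s0 else 1)"
    have c: "c \<noteq> 0" by (simp add: c_def)
    define U0 where "U0 = (if s1 = 0 then 0 else - (c * s0))"
    define \<sigma>0 where "\<sigma>0 = (if s1 = 0 then c * s0 else 0)"
    have \<sigma>: "(c * s1, \<sigma>0) \<in> {(0, 0), (0, 1), (- 1, 0)}" "(c * s1) * \<sigma>0 = 0" "c * s0 = (c * s1) * U0 + \<sigma>0"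
      by (auto simp: c_def U0_def \<sigma>0_def)
    show ?thesis
    proof (rule straightening[of D A2 A1 t1 x1 "\<lambda>t. c * \<tau> t" "\<lambda>t. c * \<rho> t" "\<lambda>t. c * deriv \<tau> t"
          "\<lambda>t. c * deriv (deriv \<tau>) t" "\<lambda>t. c * deriv \<rho> t" "c * s1" "c * s0" \<sigma>0 U0, OF D(1) sm A tx1])
      show "c * \<tau> t1 \<noteq> 0" using c \<tau>1 by simp
      show "smooth1 (fst ` D) (\<lambda>t. c * \<tau> t)" "smooth1 (fst ` D) (\<lambda>t. c * \<rho> t)"
        by (intro smooth1_mult smooth1_const s\<tau> s\<rho> oI)+
      show "((\<lambda>t. c * \<tau> t) has_real_derivative c * deriv \<tau> t) (at t)"
        "((\<lambda>t. c * deriv \<tau> t) has_real_derivative c * deriv (deriv \<tau>) t) (at t)"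
        "((\<lambda>t. c * \<rho> t) has_real_derivative c * deriv \<rho> t) (at t)" if "t \<in> fst ` D" for t
        by (intro DERIV_cmult smooth1_DERIV[OF s\<tau> that] smooth1_DERIV[OF smooth1_deriv[OF s\<tau>] that]
            smooth1_DERIV[OF s\<rho> that])+
      show "c * \<tau> t * pdt A2 t x + ((c * deriv \<tau> t + c * s1) * x + c * \<rho> t) * pdx A2 t x
          = (c * deriv \<tau> t + 2 * (c * s1)) * A2 t x" if "(t, x) \<in> D" for t x
        using arg_cong[OF e2[OF that], of "\<lambda>z. c * z"] by (simp add: algebra_simps)
      show "c * \<tau> t * pdt A1 t x + ((c * deriv \<tau> t + c * s1) * x + c * \<rho> t) * pdx A1 t x
          = c * s1 * A1 t x + c * s0 - c * deriv (deriv \<tau>) t * x - c * deriv \<rho> t" if "(t, x) \<in> D" for t x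
        using arg_cong[OF e1[OF that], of "\<lambda>z. c * z"] by (simp add: algebra_simps)
      show "c * s1 * \<sigma>0 = 0" "c * s0 = c * s1 * U0 + \<sigma>0" by (fact \<sigma>)+
      fix \<Omega>' T X0 \<phi> \<psi> J
      assume *: "\<Omega>' \<subseteq> D" "open \<Omega>'" "convex \<Omega>'" "\<Omega>' \<noteq> {}" and adm: "adm_phipsi J \<phi> \<psi>"
        and eq: "equiv_map \<Omega>' T X0 U0 1 A2 A1 (nfA2 (c * s1) \<phi>) (nfA1 (c * s1) \<sigma>0 \<psi>)"
        and im: "eq_pt T X0 1 ` \<Omega>' \<subseteq> nf_dom (c * s1) J"
      obtain k where k: "k \<in> {1..7}"
         "listed_case k (nfA2 (c * s1) \<phi>) (nfA1 (c * s1) \<sigma>0 \<psi>) (eq_pt T X0 1 ` \<Omega>')"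
        using listed_case_nf[OF \<sigma>(1) adm im] by blast
      have "\<Omega>' \<subseteq> \<Omega>" using * D(3) by blast
      then show ?thesis unfolding locally_equiv_to_def using * eq k by blast
    qed
  qed
qed

lemma normal_form_adm:
  assumes "adm_phipsi J \<phi> \<psi>" "\<sigma> * \<sigma>0 = 0"
  shows "normal_form J \<phi> \<psi> (deriv \<phi>) (deriv \<psi>) (deriv (deriv \<psi>)) \<sigma> \<sigma>0"
proof -
  have "smooth1 J \<phi>" "smooth1 J \<psi>" using assms(1) by (simp_all add: adm_phipsi_def)
  note d = smooth1_DERIV[OF this(1)] smooth1_DERIV[OF this(2)] smooth1_DERIV[OF smooth1_deriv[OF this(2)]]
  show ?thesis
    by unfold_locales (use assms d in \<open>auto simp: adm_phipsi_def\<close>)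
qed

text \<open>Special \<phi> and \<psi> do admit a second symmetry; the last alternative accounts for
  them.\<close>

lemma one_parameter_cases:
  assumes "adm_phipsi J \<phi> \<psi>" "good_dom D" "D \<subseteq> nf_dom \<sigma> J" "\<sigma> = 0 \<or> \<sigma> = - 1" "\<sigma> * \<sigma>0 = 0"
  shows "is_sym D (nfA2 \<sigma> \<phi>) (nfA1 \<sigma> \<sigma>0 \<psi>) (affine_vf 1 0 \<sigma> 0 \<sigma> \<sigma>0) \<and>
    (alg_span1 D (nfA2 \<sigma> \<phi>) (nfA1 \<sigma> \<sigma>0 \<psi>) (affine_vf 1 0 \<sigma> 0 \<sigma> \<sigma>0) \<or>
     locally_equiv_to {4..7} D (nfA2 \<sigma> \<phi>) (nfA1 \<sigma> \<sigma>0 \<psi>))"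
proof -
  interpret normal_form J \<phi> \<psi> "deriv \<phi>" "deriv \<psi>" "deriv (deriv \<psi>)" \<sigma> \<sigma>0
    by (rule normal_form_adm[OF assms(1,5)])
  show ?thesis
    using basic_symmetry[OF assms(3), of 1] span1_or_equiv_to_maximal[OF assms(4,2,3)] by simp
qed

lemma one_parameter_example:
  assumes "\<sigma> * \<sigma>0 = 0"
  shows "\<exists>J \<phi> \<psi> D. adm_phipsi J \<phi> \<psi> \<and> good_dom D \<and> D \<subseteq> nf_dom \<sigma> J \<and>
    alg_span1 D (nfA2 \<sigma> \<phi>) (nfA1 \<sigma> \<sigma>0 \<psi>) (affine_vf 1 0 \<sigma> 0 \<sigma> \<sigma>0)"
proof -
  have "deriv exp = (exp :: real \<Rightarrow> real)" by (rule ext) (metis DERIV_exp DERIV_imp_deriv)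
  then have "adm_phipsi UNIV (\<lambda>y. 1) exp" by (simp add: adm_phipsi_def)
  moreover have "good_dom UNIV" "UNIV \<subseteq> nf_dom \<sigma> UNIV" by (simp_all add: good_dom_def nf_dom_def)
  ultimately show ?thesis using alg_span1_exp[OF assms] by blast
qed

lemma case4_algebra:
  assumes "\<alpha> \<noteq> - 1" "\<alpha> \<noteq> 0" "c1 \<noteq> 0" "good_dom D" "D \<subseteq> domNZ"
  shows "alg_span2 D (c4A2 \<alpha>) (c4A1 \<alpha> c1) (vD (\<lambda>t. 1)) (vadd (vD (\<lambda>t. t)) (vscale \<alpha> vS1))"
proof -
  have \<beta>: "\<alpha> / (1 + \<alpha>) = 1 - 1 / (1 + \<alpha>)" using assms(1) by (simp add: field_simps add_eq_0_iff)
  have "1 + \<alpha> \<noteq> 0" using assms(1) by (simp add: add_eq_0_iff)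
  from alg_span2_power[OF this _ assms(3) _ _ \<beta> assms(4,5), of 1 0] assms(2)
  show ?thesis by (simp add: c4A2_def c4A1_def basis_fields_affine)
qed

lemma case7_algebra:
  assumes "c1 \<noteq> 0" "c2 \<noteq> 0" "good_dom D" "D \<subseteq> domNZ"
  shows "alg_span2 D (c7A2 c2) (c7A1 c1) (vadd (vD (\<lambda>t. 1)) vS0) (vadd (vD (\<lambda>t. t)) vS1)"
proof -
  have "alg_span2 D (\<lambda>t x. c2 * (x * \<bar>x\<bar> powr (1 / 2))) (\<lambda>t x. c1 * \<bar>x\<bar> powr (1 / 2) + 1 * t)
    (affine_vf 1 0 0 0 0 1) (affine_vf 0 1 2 0 (2 - 1) 0)"
    by (rule alg_span2_power[OF _ _ assms(1,2) _ _ assms(3,4)]) simp_all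
  moreover have "\<bar>x\<bar> powr (1 / 2) = sqrt \<bar>x\<bar>" for x :: real by (rule powr_half_sqrt) simp
  ultimately show ?thesis by (simp add: c7A2_def c7A1_def basis_fields_affine mult.assoc)
qed

theorem theorem22:
  shows
   \<comment> \<open>Case 0: the general equation of the class admits only the zero algebra\<close>
   "(\<exists>\<Omega> A2 A1. in_class \<Omega> A2 A1 \<and> alg_zero \<Omega> A2 A1)
   \<comment> \<open>Completeness: every equation with a nonzero Lie invariance algebra is (locally)
       mapped by an element of the equivalence group to one of Cases 1--7\<close>
  \<and> (\<forall>\<Omega> A2 A1. in_class \<Omega> A2 A1 \<and> (\<exists>Q. is_sym \<Omega> A2 A1 Q \<and> \<not> vf_agree \<Omega> Q vzero)
        \<longrightarrow> locally_equiv_to {1..7} \<Omega> A2 A1)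
   \<comment> \<open>Case 1\<close>
  \<and> (\<forall>J \<phi> \<psi> D. adm_phipsi J \<phi> \<psi> \<and> good_dom D \<and> D \<subseteq> domJ J \<longrightarrow>
        is_sym D (c1A2 \<phi>) (c1A1 \<psi>) (vD (\<lambda>t. 1)) \<and>
        (alg_span1 D (c1A2 \<phi>) (c1A1 \<psi>) (vD (\<lambda>t. 1)) \<or>
         locally_equiv_to {4..7} D (c1A2 \<phi>) (c1A1 \<psi>)))
  \<and> (\<exists>J \<phi> \<psi> D. adm_phipsi J \<phi> \<psi> \<and> good_dom D \<and> D \<subseteq> domJ J \<and>
        alg_span1 D (c1A2 \<phi>) (c1A1 \<psi>) (vD (\<lambda>t. 1)))
   \<comment> \<open>Case 2\<close>
  \<and> (\<forall>J \<phi> \<psi> D. adm_phipsi J \<phi> \<psi> \<and> good_dom D \<and> D \<subseteq> domJ J \<longrightarrow>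
        is_sym D (c2A2 \<phi>) (c2A1 \<psi>) (vadd (vD (\<lambda>t. 1)) vS0) \<and>
        (alg_span1 D (c2A2 \<phi>) (c2A1 \<psi>) (vadd (vD (\<lambda>t. 1)) vS0) \<or>
         locally_equiv_to {4..7} D (c2A2 \<phi>) (c2A1 \<psi>)))
  \<and> (\<exists>J \<phi> \<psi> D. adm_phipsi J \<phi> \<psi> \<and> good_dom D \<and> D \<subseteq> domJ J \<and>
        alg_span1 D (c2A2 \<phi>) (c2A1 \<psi>) (vadd (vD (\<lambda>t. 1)) vS0))
   \<comment> \<open>Case 3\<close>
  \<and> (\<forall>J \<phi> \<psi> D. adm_phipsi J \<phi> \<psi> \<and> good_dom D \<and> D \<subseteq> domJ3 J \<longrightarrow>
        is_sym D (c3A2 \<phi>) (c3A1 \<psi>) (vadd (vD (\<lambda>t. 1)) (vscale (-1) vS1)) \<and>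
        (alg_span1 D (c3A2 \<phi>) (c3A1 \<psi>) (vadd (vD (\<lambda>t. 1)) (vscale (-1) vS1)) \<or>
         locally_equiv_to {4..7} D (c3A2 \<phi>) (c3A1 \<psi>)))
  \<and> (\<exists>J \<phi> \<psi> D. adm_phipsi J \<phi> \<psi> \<and> good_dom D \<and> D \<subseteq> domJ3 J \<and>
        alg_span1 D (c3A2 \<phi>) (c3A1 \<psi>) (vadd (vD (\<lambda>t. 1)) (vscale (-1) vS1)))
   \<comment> \<open>Case 4\<close>
  \<and> (\<forall>\<alpha> c1 D. \<alpha> \<noteq> -1 \<and> \<alpha> \<noteq> 0 \<and> c1 \<noteq> 0 \<and> good_dom D \<and> D \<subseteq> domNZ \<longrightarrow>
        alg_span2 D (c4A2 \<alpha>) (c4A1 \<alpha> c1) (vD (\<lambda>t. 1)) (vadd (vD (\<lambda>t. t)) (vscale \<alpha> vS1)))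
   \<comment> \<open>Case 5\<close>
  \<and> (\<forall>c2 D. c2 \<noteq> 0 \<and> good_dom D \<and> D \<subseteq> domNZ \<longrightarrow>
        alg_span2 D (c5A2 c2) c5A1 (vD (\<lambda>t. 1)) (vadd (vD (\<lambda>t. t)) vS0))
   \<comment> \<open>Case 6\<close>
  \<and> (\<forall>c1 D. c1 \<noteq> 0 \<and> good_dom D \<longrightarrow>
        alg_span2 D c6A2 (c6A1 c1) (vD (\<lambda>t. 1))
          (vadd (vadd (vD (\<lambda>t. t)) (vscale (-1) (vP (\<lambda>t. 1)))) (vscale (-1) vS1)))
   \<comment> \<open>Case 7\<close>
  \<and> (\<forall>c1 c2 D. c1 \<noteq> 0 \<and> c2 \<noteq> 0 \<and> good_dom D \<and> D \<subseteq> domNZ \<longrightarrow>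
        alg_span2 D (c7A2 c2) (c7A1 c1) (vadd (vD (\<lambda>t. 1)) vS0) (vadd (vD (\<lambda>t. t)) vS1))"
proof (intro conjI)
  show "\<exists>\<Omega> A2 A1. in_class \<Omega> A2 A1 \<and> alg_zero \<Omega> A2 A1" by (rule exists_zero_algebra)
  show "\<forall>\<Omega> A2 A1. in_class \<Omega> A2 A1 \<and> (\<exists>Q. is_sym \<Omega> A2 A1 Q \<and> \<not> vf_agree \<Omega> Q vzero)
        \<longrightarrow> locally_equiv_to {1..7} \<Omega> A2 A1"
    using completeness by blast
  have basic: "vD (\<lambda>t. 1) = affine_vf 1 0 0 0 0 0" "vadd (vD (\<lambda>t. 1)) vS0 = affine_vf 1 0 0 0 0 1"
    "vadd (vD (\<lambda>t. 1)) (vscale (- 1) vS1) = affine_vf 1 0 (- 1) 0 (- 1) 0"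
    by (simp_all add: basis_fields_affine)
  show "\<forall>J \<phi> \<psi> D. adm_phipsi J \<phi> \<psi> \<and> good_dom D \<and> D \<subseteq> domJ J \<longrightarrow>
        is_sym D (c1A2 \<phi>) (c1A1 \<psi>) (vD (\<lambda>t. 1)) \<and>
        (alg_span1 D (c1A2 \<phi>) (c1A1 \<psi>) (vD (\<lambda>t. 1)) \<or> locally_equiv_to {4..7} D (c1A2 \<phi>) (c1A1 \<psi>))"
    unfolding one_parameter_cases_nf basic(1)
    by (intro allI impI, elim conjE) (rule one_parameter_cases; simp)
  show "\<exists>J \<phi> \<psi> D. adm_phipsi J \<phi> \<psi> \<and> good_dom D \<and> D \<subseteq> domJ J \<and>
        alg_span1 D (c1A2 \<phi>) (c1A1 \<psi>) (vD (\<lambda>t. 1))"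
    unfolding one_parameter_cases_nf basic(1) using one_parameter_example[of 0 0] by simp
  show "\<forall>J \<phi> \<psi> D. adm_phipsi J \<phi> \<psi> \<and> good_dom D \<and> D \<subseteq> domJ J \<longrightarrow>
        is_sym D (c2A2 \<phi>) (c2A1 \<psi>) (vadd (vD (\<lambda>t. 1)) vS0) \<and>
        (alg_span1 D (c2A2 \<phi>) (c2A1 \<psi>) (vadd (vD (\<lambda>t. 1)) vS0) \<or>
         locally_equiv_to {4..7} D (c2A2 \<phi>) (c2A1 \<psi>))"
    unfolding one_parameter_cases_nf basic(2)
    by (intro allI impI, elim conjE) (rule one_parameter_cases; simp)
  show "\<exists>J \<phi> \<psi> D. adm_phipsi J \<phi> \<psi> \<and> good_dom D \<and> D \<subseteq> domJ J \<and>
        alg_span1 D (c2A2 \<phi>) (c2A1 \<psi>) (vadd (vD (\<lambda>t. 1)) vS0)"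
    unfolding one_parameter_cases_nf basic(2) using one_parameter_example[of 0 1] by simp
  show "\<forall>J \<phi> \<psi> D. adm_phipsi J \<phi> \<psi> \<and> good_dom D \<and> D \<subseteq> domJ3 J \<longrightarrow>
        is_sym D (c3A2 \<phi>) (c3A1 \<psi>) (vadd (vD (\<lambda>t. 1)) (vscale (-1) vS1)) \<and>
        (alg_span1 D (c3A2 \<phi>) (c3A1 \<psi>) (vadd (vD (\<lambda>t. 1)) (vscale (-1) vS1)) \<or>
         locally_equiv_to {4..7} D (c3A2 \<phi>) (c3A1 \<psi>))"
    unfolding one_parameter_cases_nf basic(3)
    by (intro allI impI, elim conjE) (rule one_parameter_cases; simp)
  show "\<exists>J \<phi> \<psi> D. adm_phipsi J \<phi> \<psi> \<and> good_dom D \<and> D \<subseteq> domJ3 J \<and>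
        alg_span1 D (c3A2 \<phi>) (c3A1 \<psi>) (vadd (vD (\<lambda>t. 1)) (vscale (-1) vS1))"
    unfolding one_parameter_cases_nf basic(3) using one_parameter_example[of "- 1" 0] by simp
  show "\<forall>\<alpha> c1 D. \<alpha> \<noteq> -1 \<and> \<alpha> \<noteq> 0 \<and> c1 \<noteq> 0 \<and> good_dom D \<and> D \<subseteq> domNZ \<longrightarrow>
        alg_span2 D (c4A2 \<alpha>) (c4A1 \<alpha> c1) (vD (\<lambda>t. 1)) (vadd (vD (\<lambda>t. t)) (vscale \<alpha> vS1))"
    using case4_algebra by blast
  show "\<forall>c2 D. c2 \<noteq> 0 \<and> good_dom D \<and> D \<subseteq> domNZ \<longrightarrow>
        alg_span2 D (c5A2 c2) c5A1 (vD (\<lambda>t. 1)) (vadd (vD (\<lambda>t. t)) vS0)"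
    using alg_span2_log by (simp add: c5A2_def c5A1_def basis_fields_affine)
  show "\<forall>c1 D. c1 \<noteq> 0 \<and> good_dom D \<longrightarrow>
        alg_span2 D c6A2 (c6A1 c1) (vD (\<lambda>t. 1))
          (vadd (vadd (vD (\<lambda>t. t)) (vscale (-1) (vP (\<lambda>t. 1)))) (vscale (-1) vS1))"
    using alg_span2_exp by (simp add: c6A2_def c6A1_def basis_fields_affine)
  show "\<forall>c1 c2 D. c1 \<noteq> 0 \<and> c2 \<noteq> 0 \<and> good_dom D \<and> D \<subseteq> domNZ \<longrightarrow>
        alg_span2 D (c7A2 c2) (c7A1 c1) (vadd (vD (\<lambda>t. 1)) vS0) (vadd (vD (\<lambda>t. t)) vS1)"
    using case7_algebra by blast
qed

end
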